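(* Let $r\ge 0$ be an integer, let $\mathcal{K}$ be the Fredholm integral operator with kernel $\kappa$ satisfying the standing assumptions in the context, and let $\lambda\neq 0$ be a simple eigenvalue of $\mathcal{K}$. Let $\mathcal{K}_n^M=\mathcal{Q}_n\mathcal{K}+\mathcal{K}\mathcal{Q}_n-\mathcal{Q}_n\mathcal{K}\mathcal{Q}_n$. For all sufficiently large $n$, let $\lambda_n^M$ be the simple eigenvalue of $\mathcal{K}_n^M$ approximating $\lambda$ (the unique eigenvalue of $\mathcal{K}_n^M$ inside $\Gamma$), let $\psi_n^M\in\mathcal{R}(E_n^M)$ with $\|\psi_n^M\|_\infty=1$ be a corresponding modified collocation eigenfunction, $\mathcal{K}_n^M\psi_n^M=\lambda_n^M\psi_n^M$, and let $\widetilde\psi_n^M=\frac1{\lambda_n^M}\mathcal{K}\psi_n^M$ be the iterated modified collocation eigenfunction. Then, for all sufficiently large $n$ (with $h=1/n$), $$\|\psi_n^M-E\psi_n^M\|_\infty=O(h^{4r+3}),\qquad \|\widetilde\psi_n^M-E\widetilde\psi_n^M\|_\infty=O(h^{4r+4}),$$ and $$|\lambda-\lambda_n^M|=O(h^{4r+4}).$$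
   Context: Kernel and operator: $\mathcal{X}=\mathcal{C}[0,1]$ with the supremum norm $\|\cdot\|_\infty$ (essential supremum norm on $\mathcal{L}^\infty[0,1]$), $\Omega=[0,1]\times[0,1]$, $\kappa:\Omega\to\mathbb{R}$, and $(\mathcal{K}x)(s)=\int_0^1\kappa(s,t)x(t)\,dt$, $s\in[0,1]$. Standing assumptions: $\kappa$ is smooth, $\kappa\in\mathcal{C}^{2r+2}(\Omega)$, and its partial derivatives $D^{(\alpha,\beta)}\kappa(s,t)=\frac{\partial^{\alpha+\beta}\kappa}{\partial s^\alpha\partial t^\beta}(s,t)$ with $0\le\alpha+\beta\le 2r+3$ exist with finite bound $C_2=\max_{0\le\alpha+\beta\le 2r+3}\sup_{0\le s,t\le1}|D^{(\alpha,\beta)}\kappa(s,t)|$. The operator $\mathcal{K}$ is compact on $\mathcal{C}[0,1]$, extends continuously to $\mathcal{L}^\infty[0,1]$ by the same formula, and $\mathcal{R}(\mathcal{K})\subset\mathcal{C}^{2r+2}[0,1]$. Projection: for $n\in\mathbb{N}$ let $h=1/n$, $t_j=j/n$, $\Delta_j=[t_{j-1},t_j]$. $\mathcal{X}_n$ is the space of $x\in\mathcal{L}^\infty[0,1]$ whose restriction to each $\Delta_j$ ($j=1,\dots,n$) is a polynomial of degree $\le 2r$ (no continuity at the $t_j$ required). Nodes: for $r\ge1$, $\tau_j^i=t_{j-1}+\frac{ih}{2r}$, $i=0,\dots,2r$; for $r=0$, the single node $\tau_j=\frac{t_{j-1}+t_j}{2}$. The interpolatory projection $\mathcal{Q}_n:\mathcal{C}[0,1]\to\mathcal{X}_n$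 sends $x$ to the function which on each $\Delta_j$ is the polynomial of degree $\le 2r$ agreeing with $x$ at the $2r+1$ nodes of $\Delta_j$; it is extended (Hahn–Banach) to a projection $\mathcal{L}^\infty[0,1]\to\mathcal{X}_n$. Spectral notions: $\Gamma$ is a fixed simple closed rectifiable positively oriented curve in the resolvent set $\rho(\mathcal{K})$ separating $\lambda$ from the rest of the spectrum of $\mathcal{K}$ (in particular from $0$), with $\lambda$ inside. $E=-\frac1{2\pi i}\int_\Gamma(\mathcal{K}-z\mathcal{I})^{-1}dz$ is the spectral projection of $\mathcal{K}$ associated with $\lambda$; when applied to functions that are only in $\mathcal{L}^\infty[0,1]$ it is given by the same formula for the extension of $\mathcal{K}$ to $\mathcal{L}^\infty[0,1]$. $E_n^M=-\frac1{2\pi i}\int_\Gamma(\mathcal{K}_n^M-z\mathcal{I})^{-1}dz$ is the spectral projection of $\mathcal{K}_n^M$; for $n$ large it is well defined and has the same rank as $E$. $\mathcal{R}(\cdot)$ denotes range. "Simple" means algebraic multiplicity (the rank of the spectral projection) equal to one. $O(h^p)$ means bounded in absolute value by $Ch^p$ with $C$ independent of $n$. *)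

theory Defs
  imports "HOL-Analysis.Analysis" "HOL-Complex_Analysis.Complex_Analysis"
    "HOL-Probability.Essential_Supremum" "HOL-Library.Landau_Symbols"
begin

section \<open>Complex normed spaces\<close>

class complex_normed_vector = real_normed_vector +
  fixes scaleC :: "complex \<Rightarrow> 'a \<Rightarrow> 'a" (infixr \<open>*\<^sub>C\<close> 75)
  assumes scaleC_add_right: "c *\<^sub>C (x + y) = c *\<^sub>C x + c *\<^sub>C y"
    and scaleC_add_left: "(c + d) *\<^sub>C x = c *\<^sub>C x + d *\<^sub>C x"
    and scaleC_scaleC: "c *\<^sub>C d *\<^sub>C x = (c * d) *\<^sub>C x"
    and scaleC_of_real: "complex_of_real a *\<^sub>C x = a *\<^sub>R x"
    and norm_scaleC: "norm (c *\<^sub>C x) = cmod c * norm x"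

lemma scaleC_one: "1 *\<^sub>C x = (x :: 'a :: complex_normed_vector)"
  using scaleC_of_real[of 1 x] by simp

global_interpretation complex_vector:
  vector_space "scaleC :: complex \<Rightarrow> 'a \<Rightarrow> 'a :: complex_normed_vector"
  by standard (simp_all add: scaleC_add_right scaleC_add_left scaleC_scaleC scaleC_one)

lemma bounded_linear_scaleC_right:
  "bounded_linear (\<lambda>x :: 'a :: complex_normed_vector. c *\<^sub>C x)"
proof (rule bounded_linear_intro[where K = "cmod c"])
  fix a :: real and x :: 'a
  show "c *\<^sub>C a *\<^sub>R x = a *\<^sub>R c *\<^sub>C x"
    by (simp flip: scaleC_of_real add: scaleC_scaleC mult.commute)
qed (simp_all add: scaleC_add_right norm_scaleC mult.commute)

instantiation blinfun :: (real_normed_vector, complex_normed_vector) complex_normed_vector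
begin

lift_definition scaleC_blinfun :: "complex \<Rightarrow> 'a \<Rightarrow>\<^sub>L 'b \<Rightarrow> 'a \<Rightarrow>\<^sub>L 'b"
  is "\<lambda>c f x. c *\<^sub>C f x"
  by (rule bounded_linear_compose[OF bounded_linear_scaleC_right])

instance
proof
  fix c d :: complex and a :: real and f g :: "'a \<Rightarrow>\<^sub>L 'b"
  show "c *\<^sub>C (f + g) = c *\<^sub>C f + c *\<^sub>C g"
    by transfer (simp add: scaleC_add_right)
  show "(c + d) *\<^sub>C f = c *\<^sub>C f + d *\<^sub>C f"
    by transfer (simp add: scaleC_add_left)
  show "c *\<^sub>C d *\<^sub>C f = (c * d) *\<^sub>C f"
    by transfer (simp add: scaleC_scaleC)
  show "complex_of_real a *\<^sub>C f = a *\<^sub>R f"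
    by transfer (simp add: scaleC_of_real)
  have le: "norm (e *\<^sub>C h) \<le> cmod e * norm h" for e and h :: "'a \<Rightarrow>\<^sub>L 'b"
  proof (rule norm_blinfun_bound)
    fix x
    have "norm (blinfun_apply (e *\<^sub>C h) x) = cmod e * norm (h x)"
      by (simp add: scaleC_blinfun.rep_eq norm_scaleC)
    also have "\<dots> \<le> cmod e * (norm h * norm x)"
      by (intro mult_left_mono norm_blinfun) simp
    finally show "norm (blinfun_apply (e *\<^sub>C h) x) \<le> cmod e * norm h * norm x"
      by (simp add: mult.assoc)
  qed simp
  show "norm (c *\<^sub>C f) = cmod c * norm f"
  proof (cases "c = 0")
    case True
    then show ?thesis using le[of 0 f] by simp
  next
    case False
    have "f = inverse c *\<^sub>C c *\<^sub>C f"
      using False by transfer (simp add: scaleC_scaleC scaleC_one)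
    then have "norm f \<le> norm (c *\<^sub>C f) / cmod c"
      using le[of "inverse c" "c *\<^sub>C f"] by (simp add: norm_inverse divide_inverse mult.commute)
    then have "cmod c * norm f \<le> norm (c *\<^sub>C f)"
      using False by (simp add: pos_le_divide_eq mult.commute)
    with le[of c f] show ?thesis by simp
  qed
qed

end

lemma scaleC_bcontfun_aux:
  assumes "f \<in> bcontfun"
  shows "(\<lambda>x. c *\<^sub>C (f x :: 'b :: complex_normed_vector)) \<in> bcontfun"
proof -
  have "continuous_on UNIV (\<lambda>x. c *\<^sub>C f x)"
    using assms by (auto simp: bcontfun_def intro: bounded_linear.continuous_on[OF bounded_linear_scaleC_right])
  moreover have "bounded (range (\<lambda>x. c *\<^sub>C f x))"
    using bounded_linear_image[OF _ bounded_linear_scaleC_right, of "range f" c] assms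
    by (simp add: bcontfun_def image_image)
  ultimately show ?thesis by (simp add: bcontfun_def)
qed

instantiation bcontfun :: (topological_space, complex_normed_vector) complex_normed_vector
begin

definition scaleC_bcontfun :: "complex \<Rightarrow> 'a \<Rightarrow>\<^sub>C 'b \<Rightarrow> 'a \<Rightarrow>\<^sub>C 'b"
  where "scaleC_bcontfun c f = Bcontfun (\<lambda>x. c *\<^sub>C f x)"

instance
proof
  have apply_scaleC: "(c *\<^sub>C f) x = c *\<^sub>C f x" for c and f :: "'a \<Rightarrow>\<^sub>C 'b" and x
    unfolding scaleC_bcontfun_def
    by (subst Bcontfun_inverse[OF scaleC_bcontfun_aux[OF apply_bcontfun]]) simp
  fix c d :: complex and a :: real and f g :: "'a \<Rightarrow>\<^sub>C 'b"
  show "c *\<^sub>C (f + g) = c *\<^sub>C f + c *\<^sub>C g"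
    by (rule bcontfun_eqI) (simp add: apply_scaleC scaleC_add_right)
  show "(c + d) *\<^sub>C f = c *\<^sub>C f + d *\<^sub>C f"
    by (rule bcontfun_eqI) (simp add: apply_scaleC scaleC_add_left)
  show "c *\<^sub>C d *\<^sub>C f = (c * d) *\<^sub>C f"
    by (rule bcontfun_eqI) (simp add: apply_scaleC scaleC_scaleC)
  show "complex_of_real a *\<^sub>C f = a *\<^sub>R f"
    by (rule bcontfun_eqI) (simp add: apply_scaleC scaleC_of_real)
  have le: "norm (e *\<^sub>C h) \<le> cmod e * norm h" for e and h :: "'a \<Rightarrow>\<^sub>C 'b"
    by (rule norm_bound)
      (simp add: apply_scaleC norm_scaleC mult_left_mono norm_bounded)
  show "norm (c *\<^sub>C f) = cmod c * norm f"
  proof (cases "c = 0")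
    case True
    then show ?thesis using le[of 0 f] by simp
  next
    case False
    have "f = inverse c *\<^sub>C c *\<^sub>C f"
      using False by (intro bcontfun_eqI) (simp add: apply_scaleC scaleC_scaleC scaleC_one)
    then have "norm f \<le> norm (c *\<^sub>C f) / cmod c"
      using le[of "inverse c" "c *\<^sub>C f"] by (simp add: norm_inverse divide_inverse mult.commute)
    then have "cmod c * norm f \<le> norm (c *\<^sub>C f)"
      using False by (simp add: pos_le_divide_eq mult.commute)
    with le[of c f] show ?thesis by simp
  qed
qed

end

instantiation complex :: complex_normed_vector
begin

definition scaleC_complex :: "complex \<Rightarrow> complex \<Rightarrow> complex"
  where "scaleC_complex c x = c * x"

instance
  by standard (simp_all add: scaleC_complex_def algebra_simps norm_mult scaleR_conv_of_real)

end


section \<open>Spectral theory\<close>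

text \<open>Operators are plain maps \<open>T\<close> of a complex normed space, used only when they are bounded
  and complex linear; then the inverse of \<open>T - z I\<close> is complex linear as well.\<close>

definition shifted :: "('a :: complex_normed_vector \<Rightarrow> 'a) \<Rightarrow> complex \<Rightarrow> 'a \<Rightarrow> 'a"
  where "shifted T z = (\<lambda>x. T x - z *\<^sub>C x)"

definition resolvent_set :: "('a :: complex_normed_vector \<Rightarrow> 'a) \<Rightarrow> complex set"
  where "resolvent_set T = {z. bij (shifted T z) \<and> bounded_linear (inv (shifted T z))}"

definition spectrum :: "('a :: complex_normed_vector \<Rightarrow> 'a) \<Rightarrow> complex set"
  where "spectrum T = - resolvent_set T"

definition resolvent :: "('a :: complex_normed_vector \<Rightarrow> 'a) \<Rightarrow> complex \<Rightarrow> 'a \<Rightarrow>\<^sub>L 'a"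
  where "resolvent T z = Blinfun (inv (shifted T z))"

definition eigenvalue :: "('a :: complex_normed_vector \<Rightarrow> 'a) \<Rightarrow> complex \<Rightarrow> bool"
  where "eigenvalue T z \<longleftrightarrow> (\<exists>x. x \<noteq> 0 \<and> T x = z *\<^sub>C x)"

definition rectifiable :: "(real \<Rightarrow> complex) \<Rightarrow> bool"
  where "rectifiable g \<longleftrightarrow> path g \<and>
    (\<exists>L. \<forall>d. d division_of {0..1} \<longrightarrow> (\<Sum>k\<in>d. dist (g (Inf k)) (g (Sup k))) \<le> L)"

text \<open>The Riemann--Stieltjes integral \<open>\<integral>\<^sub>g f(z) dz\<close> of a vector-valued function.  The library's
  contour integral needs a piecewise continuously differentiable path and a complex-valued
  integrand.  The limit is taken over gauges, as for the library's integral; for \<open>f\<close> continuous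
  on a rectifiable path it coincides with the limit as the mesh tends to zero.\<close>

definition path_integral :: "(real \<Rightarrow> complex) \<Rightarrow> (complex \<Rightarrow> 'a) \<Rightarrow> 'a :: complex_normed_vector"
  where "path_integral g f =
    Lim (division_filter {0..1}) (\<lambda>p. \<Sum>(t, k)\<in>p. (g (Sup k) - g (Inf k)) *\<^sub>C f (g t))"

definition spectral_projection ::
  "(real \<Rightarrow> complex) \<Rightarrow> ('a :: complex_normed_vector \<Rightarrow> 'a) \<Rightarrow> 'a \<Rightarrow>\<^sub>L 'a"
  where "spectral_projection g T =
    (- (1 / (2 * of_real pi * \<i>))) *\<^sub>C path_integral g (resolvent T)"

text \<open>The complex dimension of the range; \<open>dim\<close> is \<open>0\<close> on infinite-dimensional subspaces.\<close>

definition rank :: "'a :: complex_normed_vector \<Rightarrow>\<^sub>L 'a \<Rightarrow> nat"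
  where "rank P = complex_vector.dim (range (blinfun_apply P))"

text \<open>A simple closed rectifiable positively oriented curve in the resolvent set of \<open>T\<close> that
  separates \<open>z\<close>, which lies inside, from the rest of the spectrum.\<close>

definition isolating_curve ::
  "('a :: complex_normed_vector \<Rightarrow> 'a) \<Rightarrow> complex \<Rightarrow> (real \<Rightarrow> complex) \<Rightarrow> bool"
  where "isolating_curve T z g \<longleftrightarrow>
    simple_path g \<and> pathfinish g = pathstart g \<and> rectifiable g \<and>
    path_image g \<subseteq> resolvent_set T \<and>
    z \<in> inside (path_image g) \<and> spectrum T - {z} \<subseteq> outside (path_image g) \<and>
    winding_number g z = 1"


section \<open>The space of continuous functions on the unit interval\<close>

typedef unit_interval = "{0..1 :: real}"
  morphisms of_unit to_unit
  by (rule exI[of _ 0]) simp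

instantiation unit_interval :: metric_space
begin

definition dist_unit_interval :: "unit_interval \<Rightarrow> unit_interval \<Rightarrow> real"
  where "dist_unit_interval s t = dist (of_unit s) (of_unit t)"

definition uniformity_unit_interval :: "(unit_interval \<times> unit_interval) filter"
  where "uniformity_unit_interval = (INF e\<in>{0<..}. principal {(s, t). dist s t < e})"

definition open_unit_interval :: "unit_interval set \<Rightarrow> bool"
  where "open_unit_interval U = (\<forall>s\<in>U. \<forall>\<^sub>F (s', t) in uniformity. s' = s \<longrightarrow> t \<in> U)"

instance
  by standard
    (auto simp: dist_unit_interval_def uniformity_unit_interval_def open_unit_interval_def
      of_unit_inject intro: dist_triangle2)

end

type_synonym C01 = "unit_interval \<Rightarrow>\<^sub>C complex"

lemma continuous_on_C01:
  fixes x :: C01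
  shows "continuous_on {0..1} (\<lambda>t. x (to_unit t))"
proof -
  have "continuous_on {0..1} to_unit"
    unfolding continuous_on_iff by (auto simp: dist_unit_interval_def to_unit_inverse)
  then show ?thesis
    by (rule continuous_on_compose2[OF continuous_on_apply_bcontfun[of UNIV x]]) auto
qed


section \<open>The space of essentially bounded functions on the unit interval\<close>

abbreviation lebesgue01 :: "real measure"
  where "lebesgue01 \<equiv> lebesgue_on {0..1}"

definition ess_bounded :: "(real \<Rightarrow> complex) \<Rightarrow> bool"
  where "ess_bounded f \<longleftrightarrow>
    f \<in> borel_measurable lebesgue01 \<and> (\<exists>B. AE t in lebesgue01. cmod (f t) \<le> B)"

definition linf_rel :: "(real \<Rightarrow> complex) \<Rightarrow> (real \<Rightarrow> complex) \<Rightarrow> bool"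
  where "linf_rel f g \<longleftrightarrow> ess_bounded f \<and> ess_bounded g \<and> (AE t in lebesgue01. f t = g t)"

lemma ess_boundedI:
  "f \<in> borel_measurable lebesgue01 \<Longrightarrow> AE t in lebesgue01. cmod (f t) \<le> B \<Longrightarrow> ess_bounded f"
  by (auto simp: ess_bounded_def)

lemma ess_bounded_zero: "ess_bounded (\<lambda>_. 0)"
  by (rule ess_boundedI[where B = 0]) simp_all

lemma ess_bounded_add:
  assumes "ess_bounded f" "ess_bounded g"
  shows "ess_bounded (\<lambda>t. f t + g t)"
proof -
  obtain A B where A: "AE t in lebesgue01. cmod (f t) \<le> A" and B: "AE t in lebesgue01. cmod (g t) \<le> B"
    using assms by (auto simp: ess_bounded_def)
  have "AE t in lebesgue01. cmod (f t + g t) \<le> A + B"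
    using A B by eventually_elim (rule norm_triangle_mono)
  then show ?thesis
    using assms by (intro ess_boundedI borel_measurable_add) (auto simp: ess_bounded_def)
qed

lemma ess_bounded_cmult:
  assumes "ess_bounded f"
  shows "ess_bounded (\<lambda>t. c * f t)"
proof -
  obtain A where A: "AE t in lebesgue01. cmod (f t) \<le> A"
    using assms by (auto simp: ess_bounded_def)
  have "AE t in lebesgue01. cmod (c * f t) \<le> cmod c * A"
    using A by eventually_elim (simp add: norm_mult mult_left_mono)
  then show ?thesis
    using assms by (intro ess_boundedI borel_measurable_times) (auto simp: ess_bounded_def)
qed

quotient_type linf = "real \<Rightarrow> complex" / partial: linf_rel
proof (rule part_equivpI)
  show "\<exists>f. linf_rel f f"
    by (rule exI[of _ "\<lambda>_. 0"]) (simp add: linf_rel_def ess_bounded_zero)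
  show "symp linf_rel"
    by (rule sympI) (auto simp: linf_rel_def eq_commute)
  show "transp linf_rel"
  proof (rule transpI)
    fix f g h assume "linf_rel f g" "linf_rel g h"
    moreover from this have "AE t in lebesgue01. f t = g t" "AE t in lebesgue01. g t = h t"
      by (simp_all add: linf_rel_def)
    then have "AE t in lebesgue01. f t = h t"
      by eventually_elim simp
    ultimately show "linf_rel f h" by (simp add: linf_rel_def)
  qed
qed

lift_definition linf_norm :: "linf \<Rightarrow> real"
  is "\<lambda>f. real_of_ereal (esssup lebesgue01 (\<lambda>t. ereal (cmod (f t))))"
proof -
  fix f g assume fg: "linf_rel f g"
  have "esssup lebesgue01 (\<lambda>t. ereal (cmod (f t))) = esssup lebesgue01 (\<lambda>t. ereal (cmod (g t)))"
    by (rule esssup_AE_cong) (use fg in \<open>auto simp: linf_rel_def ess_bounded_def\<close>)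
  then show "real_of_ereal (esssup lebesgue01 (\<lambda>t. ereal (cmod (f t)))) =
      real_of_ereal (esssup lebesgue01 (\<lambda>t. ereal (cmod (g t))))"
    by simp
qed

lemma esssup_cmod:
  assumes "ess_bounded f"
  obtains N where "N \<ge> 0" "esssup lebesgue01 (\<lambda>t. ereal (cmod (f t))) = ereal N"
    "AE t in lebesgue01. cmod (f t) \<le> N"
    "\<And>B. AE t in lebesgue01. cmod (f t) \<le> B \<Longrightarrow> N \<le> B"
proof -
  let ?g = "\<lambda>t. ereal (cmod (f t))"
  have meas: "?g \<in> borel_measurable lebesgue01"
    using assms by (auto simp: ess_bounded_def)
  obtain B where B: "AE t in lebesgue01. cmod (f t) \<le> B"
    using assms by (auto simp: ess_bounded_def)
  have le: "esssup lebesgue01 ?g \<le> ereal C" if "AE t in lebesgue01. cmod (f t) \<le> C" for C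
    by (rule esssup_I[OF meas]) (use that in simp)
  have "emeasure lebesgue01 (space lebesgue01) \<noteq> 0"
    by (simp add: space_restrict_space emeasure_restrict_space)
  then have "0 = esssup lebesgue01 (\<lambda>_. 0 :: ereal)"
    by (simp add: esssup_const)
  also have "\<dots> \<le> esssup lebesgue01 ?g"
    by (rule esssup_mono) auto
  finally have pos: "0 \<le> esssup lebesgue01 ?g" .
  then obtain N where N: "esssup lebesgue01 ?g = ereal N"
    using le[OF B] by (cases "esssup lebesgue01 ?g") auto
  show ?thesis
  proof (rule that[of N])
    show "N \<ge> 0" using pos N by simp
    show "esssup lebesgue01 ?g = ereal N" by (rule N)
    show "AE t in lebesgue01. cmod (f t) \<le> N"
      using esssup_AE[of ?g lebesgue01] by (simp add: N)
    show "N \<le> C" if "AE t in lebesgue01. cmod (f t) \<le> C" for C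
      using le[OF that] by (simp add: N)
  qed
qed

lemma linf_norm_abs:
  "ess_bounded f \<Longrightarrow>
    linf_norm (abs_linf f) = real_of_ereal (esssup lebesgue01 (\<lambda>t. ereal (cmod (f t))))"
  by (rule linf_norm.abs_eq) (simp add: linf_rel_def)

lemma linf_norm_AE:
  assumes "ess_bounded f"
  shows "AE t in lebesgue01. cmod (f t) \<le> linf_norm (abs_linf f)"
proof -
  obtain N where N: "N \<ge> 0" "esssup lebesgue01 (\<lambda>t. ereal (cmod (f t))) = ereal N"
    "AE t in lebesgue01. cmod (f t) \<le> N"
    "\<And>B. AE t in lebesgue01. cmod (f t) \<le> B \<Longrightarrow> N \<le> B"
    by (rule esssup_cmod[OF assms(1)]) blast
  have "linf_norm (abs_linf f) = N"
    using N(2) by (simp add: linf_norm_abs[OF assms(1)])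
  with N(3) show ?thesis by simp
qed

lemma linf_norm_le:
  assumes "ess_bounded f" "AE t in lebesgue01. cmod (f t) \<le> B"
  shows "linf_norm (abs_linf f) \<le> B"
proof -
  obtain N where N: "N \<ge> 0" "esssup lebesgue01 (\<lambda>t. ereal (cmod (f t))) = ereal N"
    "AE t in lebesgue01. cmod (f t) \<le> N"
    "\<And>B. AE t in lebesgue01. cmod (f t) \<le> B \<Longrightarrow> N \<le> B"
    by (rule esssup_cmod[OF assms(1)]) blast
  have "linf_norm (abs_linf f) = N"
    using N(2) by (simp add: linf_norm_abs[OF assms(1)])
  with N(4)[OF assms(2)] show ?thesis by simp
qed

lemma linf_norm_nonneg:
  assumes "ess_bounded f"
  shows "0 \<le> linf_norm (abs_linf f)"
proof -
  obtain N where N: "N \<ge> 0" "esssup lebesgue01 (\<lambda>t. ereal (cmod (f t))) = ereal N"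
    "AE t in lebesgue01. cmod (f t) \<le> N"
    "\<And>B. AE t in lebesgue01. cmod (f t) \<le> B \<Longrightarrow> N \<le> B"
    by (rule esssup_cmod[OF assms(1)]) blast
  have "linf_norm (abs_linf f) = N"
    using N(2) by (simp add: linf_norm_abs[OF assms(1)])
  with N(1) show ?thesis by simp
qed

lemma linf_cases:
  obtains f where "x = abs_linf f" "ess_bounded f"
proof (rule that)
  show "x = abs_linf (rep_linf x)"
    by (rule Quotient3_abs_rep[OF Quotient3_linf, symmetric])
  show "ess_bounded (rep_linf x)"
    using Quotient3_rep_reflp[OF Quotient3_linf, of x] by (simp add: linf_rel_def)
qed

lemma abs_linf_eqI:
  "ess_bounded f \<Longrightarrow> ess_bounded g \<Longrightarrow> AE t in lebesgue01. f t = g t \<Longrightarrow> abs_linf f = abs_linf g"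
  using Quotient3_rel_abs[OF Quotient3_linf, of f g] by (simp add: linf_rel_def)

lemma abs_linf_eqD:
  "abs_linf f = abs_linf g \<Longrightarrow> ess_bounded f \<Longrightarrow> ess_bounded g \<Longrightarrow> AE t in lebesgue01. f t = g t"
  using Quotient3_rel[OF Quotient3_linf, of f g] by (simp add: linf_rel_def)

lemma linf_rel_refl: "ess_bounded f \<Longrightarrow> linf_rel f f"
  by (simp add: linf_rel_def)

instantiation linf :: complex_normed_vector
begin

lift_definition zero_linf :: linf is "\<lambda>_. 0"
  by (simp add: linf_rel_def ess_bounded_zero)

lift_definition plus_linf :: "linf \<Rightarrow> linf \<Rightarrow> linf" is "\<lambda>f g t. f t + g t"
  by (auto simp: linf_rel_def ess_bounded_add)

lift_definition scaleC_linf :: "complex \<Rightarrow> linf \<Rightarrow> linf" is "\<lambda>c f t. c * f t"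
  by (auto simp: linf_rel_def ess_bounded_cmult)

definition scaleR_linf :: "real \<Rightarrow> linf \<Rightarrow> linf"
  where "scaleR_linf a x = complex_of_real a *\<^sub>C x"

definition uminus_linf :: "linf \<Rightarrow> linf"
  where "uminus_linf x = (- 1) *\<^sub>C x"

definition minus_linf :: "linf \<Rightarrow> linf \<Rightarrow> linf"
  where "minus_linf x y = x + (- 1) *\<^sub>C y"

definition norm_linf :: "linf \<Rightarrow> real"
  where "norm_linf = linf_norm"

definition sgn_linf :: "linf \<Rightarrow> linf"
  where "sgn_linf x = inverse (norm x) *\<^sub>R x"

definition dist_linf :: "linf \<Rightarrow> linf \<Rightarrow> real"
  where "dist_linf x y = norm (x - y)"

definition uniformity_linf :: "(linf \<times> linf) filter"
  where "uniformity_linf = (INF e\<in>{0<..}. principal {(x, y). dist x y < e})"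

definition open_linf :: "linf set \<Rightarrow> bool"
  where "open_linf U = (\<forall>x\<in>U. \<forall>\<^sub>F (x', y) in uniformity. x' = x \<longrightarrow> y \<in> U)"

instance
proof
  fix x y z :: linf and a b :: real and c d :: complex
  obtain f where f: "x = abs_linf f" "ess_bounded f" by (rule linf_cases)
  obtain g where g: "y = abs_linf g" "ess_bounded g" by (rule linf_cases)
  obtain h where h: "z = abs_linf h" "ess_bounded h" by (rule linf_cases)
  note fgh = f g h
  note red = plus_linf.abs_eq scaleC_linf.abs_eq zero_linf.abs_eq linf_rel_refl
    ess_bounded_add ess_bounded_cmult ess_bounded_zero uminus_linf_def minus_linf_def scaleR_linf_def
  show "x + y + z = x + (y + z)" "x + y = y + x" "0 + x = x" "- x + x = 0" "x - y = x + - y"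
    using ess_bounded_cmult[OF f(2), of "- 1"] by (simp_all add: fgh red zero_linf_def add_ac)
  show "a *\<^sub>R (x + y) = a *\<^sub>R x + a *\<^sub>R y" "(a + b) *\<^sub>R x = a *\<^sub>R x + b *\<^sub>R x"
    "a *\<^sub>R b *\<^sub>R x = (a * b) *\<^sub>R x" "1 *\<^sub>R x = x"
    by (simp_all add: fgh red algebra_simps)
  show "c *\<^sub>C (x + y) = c *\<^sub>C x + c *\<^sub>C y" "(c + d) *\<^sub>C x = c *\<^sub>C x + d *\<^sub>C x"
    "c *\<^sub>C d *\<^sub>C x = (c * d) *\<^sub>C x" "complex_of_real a *\<^sub>C x = a *\<^sub>R x"
    by (simp_all add: fgh red algebra_simps)
  show "dist x y = norm (x - y)" by (rule dist_linf_def)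
  show "sgn x = inverse (norm x) *\<^sub>R x" by (rule sgn_linf_def)
  show "uniformity = (INF e\<in>{0<..}. principal {(x :: linf, y). dist x y < e})"
    by (rule uniformity_linf_def)
  show "open U = (\<forall>x\<in>U. \<forall>\<^sub>F (x', y) in uniformity. x' = x \<longrightarrow> y \<in> U)" for U :: "linf set"
    by (rule open_linf_def)
  show "(norm x = 0) = (x = 0)"
  proof
    assume "norm x = 0"
    then have "AE t in lebesgue01. f t = 0"
      using linf_norm_AE[OF f(2)] by (simp add: f(1) norm_linf_def)
    then show "x = 0"
      unfolding f(1) zero_linf_def by (intro abs_linf_eqI f(2) ess_bounded_zero)
  next
    assume "x = 0"
    then have "AE t in lebesgue01. f t = 0"
      using abs_linf_eqD[of f "\<lambda>_. 0"] f by (simp add: zero_linf_def ess_bounded_zero)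
    then have "AE t in lebesgue01. cmod (f t) \<le> 0"
      by eventually_elim simp
    from linf_norm_le[OF f(2) this] linf_norm_nonneg[OF f(2)]
    show "norm x = 0" by (simp add: f(1) norm_linf_def)
  qed
  have "AE t in lebesgue01. cmod (f t + g t) \<le> norm x + norm y"
    using linf_norm_AE[OF f(2)] linf_norm_AE[OF g(2)]
    by eventually_elim (simp add: fgh norm_linf_def norm_triangle_mono)
  from linf_norm_le[OF ess_bounded_add[OF f(2) g(2)] this]
  show "norm (x + y) \<le> norm x + norm y"
    using fgh by (simp add: red norm_linf_def)
  have le: "norm (e *\<^sub>C abs_linf k) \<le> cmod e * norm (abs_linf k)" if k: "ess_bounded k" for e k
  proof -
    have "AE t in lebesgue01. cmod (e * k t) \<le> cmod e * norm (abs_linf k)"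
      using linf_norm_AE[OF k]
      by eventually_elim (simp add: norm_linf_def norm_mult mult_left_mono)
    from linf_norm_le[OF ess_bounded_cmult[OF k] this] show ?thesis
      using k by (simp add: red norm_linf_def)
  qed
  show nC: "norm (e *\<^sub>C x) = cmod e * norm x" for e
  proof (cases "e = 0")
    case True
    then show ?thesis
      using le[OF f(2), of 0] linf_norm_nonneg[OF ess_bounded_cmult[OF f(2), of 0]]
      by (simp add: fgh red norm_linf_def)
  next
    case False
    have "norm (inverse e *\<^sub>C (abs_linf (\<lambda>t. e * f t))) \<le> cmod (inverse e) * norm (abs_linf (\<lambda>t. e * f t))"
      by (rule le[OF ess_bounded_cmult[OF f(2)]])
    moreover have "inverse e *\<^sub>C (abs_linf (\<lambda>t. e * f t)) = x"
      using False f by (simp add: red flip: mult.assoc)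
    ultimately have "norm x \<le> norm (abs_linf (\<lambda>t. e * f t)) / cmod e"
      by (simp add: norm_inverse divide_inverse mult.commute)
    then have "cmod e * norm x \<le> norm (abs_linf (\<lambda>t. e * f t))"
      using False by (simp add: pos_le_divide_eq mult.commute)
    also have "abs_linf (\<lambda>t. e * f t) = e *\<^sub>C x"
      using f by (simp add: red)
    finally have "cmod e * norm x \<le> norm (e *\<^sub>C x)" .
    with le[OF f(2), of e] show ?thesis by (simp add: f(1))
  qed
  show "norm (a *\<^sub>R x) = \<bar>a\<bar> * norm x"
    by (simp add: scaleR_linf_def nC)
qed

end

lemma linf_minus:
  "ess_bounded f \<Longrightarrow> ess_bounded g \<Longrightarrow> abs_linf f - abs_linf g = abs_linf (\<lambda>t. f t - g t)"
  unfolding minus_linf_def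
  using ess_bounded_cmult[of g "- 1"]
  by (simp only: plus_linf.abs_eq scaleC_linf.abs_eq linf_rel_refl) simp

lemma ess_bounded_diff: "ess_bounded f \<Longrightarrow> ess_bounded g \<Longrightarrow> ess_bounded (\<lambda>t. f t - g t)"
  using ess_bounded_add[OF _ ess_bounded_cmult[of g "- 1"], of f] by simp

instance linf :: banach
proof
  fix X :: "nat \<Rightarrow> linf" assume X: "Cauchy X"
  have "\<exists>f. X n = abs_linf f \<and> ess_bounded f" for n
    using linf_cases[of "X n"] by blast
  then obtain f where f: "\<And>n. X n = abs_linf (f n)" "\<And>n. ess_bounded (f n)"
    by metis
  have dist: "AE t in lebesgue01. cmod (f m t - f n t) \<le> dist (X m) (X n)" for m n
    using linf_norm_AE[OF ess_bounded_diff[OF f(2) f(2)], of m n]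
    by (simp add: f linf_minus dist_norm norm_linf_def)
  then have AE: "AE t in lebesgue01. \<forall>m n. cmod (f m t - f n t) \<le> dist (X m) (X n)"
    by (simp add: AE_all_countable)
  define g where "g t = lim (\<lambda>n. f n t)" for t
  have lim: "AE t in lebesgue01. (\<lambda>n. f n t) \<longlonglongrightarrow> g t"
    using AE
  proof eventually_elim
    case (elim t)
    have "Cauchy (\<lambda>n. f n t)"
    proof (rule metric_CauchyI)
      fix e :: real assume "e > 0"
      then obtain M where "\<forall>m\<ge>M. \<forall>n\<ge>M. dist (X m) (X n) < e"
        using X unfolding Cauchy_def by blast
      then show "\<exists>M. \<forall>m\<ge>M. \<forall>n\<ge>M. dist (f m t) (f n t) < e"
        using elim by (intro exI[of _ M]) (simp add: dist_norm, meson order_le_less_trans)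
    qed
    then show ?case
      by (simp add: g_def Cauchy_convergent flip: convergent_LIMSEQ_iff)
  qed
  have g_meas: "g \<in> borel_measurable lebesgue01"
    unfolding g_def using f(2) by (intro borel_measurable_lim_metric) (simp add: ess_bounded_def)
  have tail: "AE t in lebesgue01. cmod (f n t - g t) \<le> e" if e: "\<And>m. m \<ge> N \<Longrightarrow> dist (X n) (X m) \<le> e" for n N e
    using AE lim
  proof eventually_elim
    case (elim t)
    have "(\<lambda>m. cmod (f n t - f m t)) \<longlonglongrightarrow> cmod (f n t - g t)"
      by (intro tendsto_intros elim)
    moreover have "\<forall>\<^sub>F m in sequentially. cmod (f n t - f m t) \<le> e"
      using eventually_ge_at_top[of N] by eventually_elim (use elim(1) e order_trans in blast)
    ultimately show ?case
      by (rule tendsto_upperbound) simp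
  qed
  obtain N where N: "\<And>m n. m \<ge> N \<Longrightarrow> n \<ge> N \<Longrightarrow> dist (X m) (X n) < 1"
    using X unfolding Cauchy_def by (meson zero_less_one)
  have "AE t in lebesgue01. cmod (f N t - g t) \<le> 1"
    by (rule tail[of N]) (use N in \<open>auto intro: less_imp_le\<close>)
  moreover have "(\<lambda>t. f N t - g t) \<in> borel_measurable lebesgue01"
    using f(2) g_meas by (intro borel_measurable_diff) (auto simp: ess_bounded_def)
  ultimately have "ess_bounded (\<lambda>t. f N t - g t)"
    by (intro ess_boundedI)
  from ess_bounded_diff[OF f(2)[of N] this] have g: "ess_bounded g"
    by simp
  have "X \<longlonglongrightarrow> abs_linf g"
  proof (rule metric_LIMSEQ_I)
    fix e :: real assume "e > 0"
    then obtain M where M: "\<And>m n. m \<ge> M \<Longrightarrow> n \<ge> M \<Longrightarrow> dist (X m) (X n) < e / 2"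
      using X unfolding Cauchy_def by (meson half_gt_zero)
    have "dist (X n) (abs_linf g) \<le> e / 2" if "n \<ge> M" for n
    proof -
      have "AE t in lebesgue01. cmod (f n t - g t) \<le> e / 2"
        by (rule tail[of M]) (use M that in \<open>auto intro: less_imp_le\<close>)
      from linf_norm_le[OF ess_bounded_diff[OF f(2) g] this] show ?thesis
        by (simp add: f g linf_minus dist_norm norm_linf_def)
    qed
    then show "\<exists>M. \<forall>n\<ge>M. dist (X n) (abs_linf g) < e"
      using \<open>e > 0\<close> by (intro exI[of _ M]) force
  qed
  then show "convergent X"
    by (rule convergentI)
qed

definition C01_to_linf :: "C01 \<Rightarrow> linf"
  where "C01_to_linf x = abs_linf (\<lambda>t. x (to_unit t))"

lemma ess_bounded_C01: "ess_bounded (\<lambda>t. apply_bcontfun (x :: C01) (to_unit t))"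
proof (rule ess_boundedI)
  show "(\<lambda>t. x (to_unit t)) \<in> borel_measurable lebesgue01"
    by (intro continuous_imp_measurable_on_sets_lebesgue continuous_on_C01) simp
  show "AE t in lebesgue01. cmod (x (to_unit t)) \<le> norm x"
    by (simp add: norm_bounded)
qed


section \<open>Kernel and integral operator\<close>

definition partial_s :: "(real \<Rightarrow> real \<Rightarrow> real) \<Rightarrow> real \<Rightarrow> real \<Rightarrow> real"
  where "partial_s k = (\<lambda>s t. vector_derivative (\<lambda>u. k u t) (at s within {0..1}))"

definition partial_t :: "(real \<Rightarrow> real \<Rightarrow> real) \<Rightarrow> real \<Rightarrow> real \<Rightarrow> real"
  where "partial_t k = (\<lambda>s t. vector_derivative (\<lambda>u. k s u) (at t within {0..1}))"

definition kernel_deriv :: "nat \<Rightarrow> nat \<Rightarrow> (real \<Rightarrow> real \<Rightarrow> real) \<Rightarrow> real \<Rightarrow> real \<Rightarrow> real"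
  where "kernel_deriv a b k = (partial_s ^^ a) ((partial_t ^^ b) k)"

text \<open>The first two conjuncts express that the derivatives of total order at most \<open>m + 1\<close> exist
  (\<open>partial_s\<close> and \<open>partial_t\<close> are total, with junk values where there is no derivative).\<close>

definition smooth_kernel :: "nat \<Rightarrow> (real \<Rightarrow> real \<Rightarrow> real) \<Rightarrow> bool"
  where "smooth_kernel m k \<longleftrightarrow>
    (\<forall>a b. a + b \<le> m \<longrightarrow> (\<forall>s\<in>{0..1}. \<forall>t\<in>{0..1}.
      (\<lambda>u. kernel_deriv a b k u t) differentiable (at s within {0..1}))) \<and>
    (\<forall>b\<le>m. \<forall>s\<in>{0..1}. \<forall>t\<in>{0..1}.
      (\<lambda>u. kernel_deriv 0 b k s u) differentiable (at t within {0..1})) \<and>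
    (\<forall>a b. a + b \<le> m \<longrightarrow>
      continuous_on ({0..1} \<times> {0..1}) (\<lambda>(s, t). kernel_deriv a b k s t)) \<and>
    (\<exists>C. \<forall>a b. a + b \<le> m + 1 \<longrightarrow>
      (\<forall>s\<in>{0..1}. \<forall>t\<in>{0..1}. \<bar>kernel_deriv a b k s t\<bar> \<le> C))"

text \<open>The integral operator maps all essentially bounded functions to continuous ones; the
  operators on the two spaces are obtained by composing with the embedding.\<close>

definition integral_map :: "(real \<Rightarrow> real \<Rightarrow> real) \<Rightarrow> linf \<Rightarrow> C01"
  where "integral_map k x =
    Bcontfun (\<lambda>s. LINT t|lebesgue01. of_real (k (of_unit s) t) * rep_linf x t)"

definition integral_op_C01 :: "(real \<Rightarrow> real \<Rightarrow> real) \<Rightarrow> C01 \<Rightarrow> C01"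
  where "integral_op_C01 k x = integral_map k (C01_to_linf x)"

definition integral_op :: "(real \<Rightarrow> real \<Rightarrow> real) \<Rightarrow> linf \<Rightarrow> linf"
  where "integral_op k x = C01_to_linf (integral_map k x)"


section \<open>Interpolatory projection\<close>

definition subinterval :: "nat \<Rightarrow> nat \<Rightarrow> real set"
  where "subinterval n j = {(real j - 1) / real n .. real j / real n}"

definition node :: "nat \<Rightarrow> nat \<Rightarrow> nat \<Rightarrow> nat \<Rightarrow> real"
  where "node r n j i =
    (if r = 0 then ((real j - 1) / real n + real j / real n) / 2
     else (real j - 1) / real n + real i * (1 / real n) / (2 * real r))"

definition agrees_with_poly :: "linf \<Rightarrow> complex poly \<Rightarrow> real set \<Rightarrow> bool"
  where "agrees_with_poly x p S \<longleftrightarrow> (AE t in lebesgue_on S. rep_linf x t = poly p (of_real t))"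

definition piecewise_polys :: "nat \<Rightarrow> nat \<Rightarrow> linf set"
  where "piecewise_polys r n =
    {x. \<forall>j\<in>{1..n}. \<exists>p. degree p \<le> 2 * r \<and> agrees_with_poly x p (subinterval n j)}"

definition interpolates :: "nat \<Rightarrow> nat \<Rightarrow> C01 \<Rightarrow> linf \<Rightarrow> bool"
  where "interpolates r n x y \<longleftrightarrow>
    (\<forall>j\<in>{1..n}. \<exists>p. degree p \<le> 2 * r \<and>
      (\<forall>i\<le>2 * r. poly p (of_real (node r n j i)) = x (to_unit (node r n j i))) \<and>
      agrees_with_poly y p (subinterval n j))"

text \<open>A bounded projection onto the piecewise polynomials that extends interpolation of continuous
  functions.  Such extensions are not unique.\<close>

definition interpolatory_projection :: "nat \<Rightarrow> nat \<Rightarrow> (linf \<Rightarrow> linf) \<Rightarrow> bool"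
  where "interpolatory_projection r n Q \<longleftrightarrow>
    bounded_linear Q \<and> (\<forall>c x. Q (c *\<^sub>C x) = c *\<^sub>C Q x) \<and>
    range Q \<subseteq> piecewise_polys r n \<and> (\<forall>x\<in>piecewise_polys r n. Q x = x) \<and>
    (\<forall>x. interpolates r n x (Q (C01_to_linf x)))"

definition modified_op :: "(real \<Rightarrow> real \<Rightarrow> real) \<Rightarrow> (linf \<Rightarrow> linf) \<Rightarrow> linf \<Rightarrow> linf"
  where "modified_op k Q x =
    Q (integral_op k x) + integral_op k (Q x) - Q (integral_op k (Q x))"

end

theory Submission
  imports Defs
begin

text \<open>Let \<open>\<psi>\<close> be an eigenfunction of the modified operator and \<open>\<mu>\<close> its eigenvalue.
  From the eigenvalue equation, \<open>\<mu> (I - Q) \<psi> = (I - Q) K Q \<psi>\<close>, so the residual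
  \<open>\<delta> = K \<psi> - \<mu> \<psi>\<close> equals \<open>\<mu>\<inverse> (I - Q) K (I - Q) K Q \<psi>\<close>.  Each factor \<open>K (I - Q)\<close> gains
  \<open>h\<^bsup>2r+2\<^esup>\<close>, one order more than \<open>I - Q\<close>, because the leading interpolation error on a
  subinterval is an odd function about its midpoint.  Hence \<open>\<delta> = O(h\<^bsup>4r+3\<^esup>)\<close> and
  \<open>K \<delta> = O(h\<^bsup>4r+4\<^esup>)\<close>.  Integrating \<open>(K - z)\<inverse> x = ((K - z)\<inverse> (K x - \<mu> x) - x) / (z - \<mu>)\<close> along \<open>\<Gamma>\<close>
  bounds \<open>x - E x\<close> by the residual of \<open>x\<close>, which gives the estimates for \<open>x = \<psi>\<close> and for
  \<open>x = K \<psi> / \<mu>\<close>.  Applying \<open>E\<close> to the residual of \<open>K \<psi>\<close> yields \<open>(\<lambda> - \<mu>) E K \<psi>\<close> by simplicity of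
  \<open>\<lambda>\<close>, and thereby the eigenvalue estimate.\<close>

text \<open>Two obstacles shape the proof. Off the continuous functions \<open>Q n\<close> is an
  arbitrary extension with no bound uniform in n, so the modified operators cannot be compared with
  K in operator norm. Instead everything is evaluated at \<psi>, which by its eigenvalue equation is
  a piecewise polynomial plus a continuous function, and there \<open>Q n\<close> is interpolation.
  In particular the closeness of \<mu> to \<lambda> is derived: on the compact region enclosed by
  \<Gamma>, away from \<lambda>, the resolvent of K is bounded, so the small residual of K \<psi>
  would force K \<psi> itself to be small, although its norm stays away from 0. The second obstacle
  is that \<lambda>, \<Gamma> and simplicity refer to K on C[0,1], while \<psi> is only essentially
  bounded. Since K maps the larger space into the smaller one, resolvents at z \<noteq> 0 carry
  over, and the eigenvalue estimate is made on C[0,1] with K \<psi> in place of \<psi>. That 0 lies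
  outside \<Gamma>, being in the spectrum, makes the transfer applicable on \<Gamma> and bounds
  \<mu> away from 0.\<close>

subsection \<open>Riemann--Stieltjes sums along rectifiable paths\<close>

text \<open>Cells of two divisions often have empty intersection, where \<open>Sup\<close> and
  \<open>Inf\<close> carry no information; the value 0 there keeps the increment additive.\<close>

definition increment :: "(real \<Rightarrow> complex) \<Rightarrow> real set \<Rightarrow> complex"
  where "increment g K = (if K = {} then 0 else g (Sup K) - g (Inf K))"

lemma increment_interval: "increment g {a..b} = (if a \<le> b then g b - g a else 0)"
  by (simp add: increment_def)

lemma increment_neutral: "b \<le> a \<Longrightarrow> increment g {a..b} = 0"
  by (cases "a = b") (auto simp: increment_def)

text \<open>A telescoping sum: the increment over the part of a cell inside \<open>{u..v}\<close> is
  additive when the cell is cut, so its sum over a division is its value on the whole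
  interval.\<close>

lemma sum_increment_tagged_division:
  assumes "p tagged_division_of {a..b}" "{u..v} \<subseteq> {a..b}"
  shows "(\<Sum>x\<in>p. increment g (snd x \<inter> {u..v})) = increment g {u..v}"
proof -
  interpret operative_real plus 0 "\<lambda>K. increment g (K \<inter> {u..v})"
    rewrites "comm_monoid_set.F (+) 0 = sum"
  proof -
    show "operative_real (+) 0 (\<lambda>K. increment g (K \<inter> {u..v}))"
    proof
      show "increment g ({a..b} \<inter> {u..v}) = 0" if "b \<le> a" for a b
        using that by (simp add: increment_neutral)
      show "increment g ({a..c} \<inter> {u..v}) + increment g ({c..b} \<inter> {u..v}) = increment g ({a..b} \<inter> {u..v})"
        if "a < c" "c < b" for a b c
        using that by (auto simp: increment_interval max_def min_def)
    qed
  qed (simp add: sum_def)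
  have "(\<Sum>(_, l)\<in>p. increment g (l \<inter> {u..v})) = increment g ({a..b} \<inter> {u..v})"
    using tagged_division[of p a b] assms(1) by simp
  then show ?thesis
    using Int_absorb1[OF assms(2)] by (simp only: case_prod_unfold)
qed

lemma increment_eq_0:
  assumes "interior {a..b::real} = {}"
  shows "increment g {a..b} = 0"
  using assms by (auto simp: increment_interval)

text \<open>The nonempty intersections of cells form the common refinement, which is a division and
  so subject to the variation bound.\<close>

lemma sum_increment_refinement_le:
  assumes V: "\<And>d. d division_of {a..b} \<Longrightarrow> (\<Sum>k\<in>d. dist (g (Inf k)) (g (Sup k))) \<le> V"
    and p: "p tagged_division_of {a..b}" and q: "q tagged_division_of {a..b}"
  shows "(\<Sum>x\<in>p. \<Sum>y\<in>q. cmod (increment g (snd x \<inter> snd y))) \<le> V"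
proof -
  define G where "G K = cmod (increment g K)" for K
  let ?d = "snd ` p" and ?e = "snd ` q"
  have d: "?d division_of {a..b}" and e: "?e division_of {a..b}"
    using division_of_tagged_division p q by auto
  have G0: "G (K \<inter> L) = 0" if int: "interior (K \<inter> L) = {}" and K: "K \<in> ?d" and L: "L \<in> ?e" for K L
  proof -
    obtain u v u' v' where "K = {u..v}" "L = {u'..v'}"
      using division_ofD(4)[OF d K] division_ofD(4)[OF e L] by auto
    then show ?thesis
      using int increment_eq_0 by (auto simp: G_def Int_atLeastAtMost)
  qed
  have [simp]: "finite p" "finite q"
    using p q by auto
  have inner: "(\<Sum>y\<in>q. G (K \<inter> snd y)) = (\<Sum>L\<in>?e. G (K \<inter> L))" if K: "K \<in> ?d" for K
  proof -
    obtain u v where uv: "K = {u..v}"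
      using division_ofD(4)[OF d K] by auto
    have "(\<Sum>(_, l)\<in>q. G (K \<inter> l)) = (\<Sum>L\<in>?e. G (K \<inter> L))"
      by (rule sum.over_tagged_division_lemma[OF q])
        (auto simp: uv G_def increment_interval Int_atLeastAtMost)
    then show ?thesis by (simp add: case_prod_unfold)
  qed
  have outer: "(\<Sum>x\<in>p. \<Sum>L\<in>?e. G (snd x \<inter> L)) = (\<Sum>K\<in>?d. \<Sum>L\<in>?e. G (K \<inter> L))"
  proof -
    have "(\<Sum>(_, k)\<in>p. \<Sum>L\<in>?e. G (k \<inter> L)) = (\<Sum>K\<in>?d. \<Sum>L\<in>?e. G (K \<inter> L))"
    proof (rule sum.over_tagged_division_lemma[OF p])
      fix u v :: real assume "box u v = {}"
      then show "(\<Sum>L\<in>?e. G (cbox u v \<inter> L)) = 0"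
        using division_ofD(4)[OF e]
        by (intro sum.neutral) (fastforce simp: G_def increment_interval Int_atLeastAtMost)
    qed
    then show ?thesis by (simp add: case_prod_unfold)
  qed
  let ?R = "{K \<inter> L |K L. K \<in> ?d \<and> L \<in> ?e \<and> K \<inter> L \<noteq> {}}"
  have R: "?R division_of {a..b}"
    using division_inter[OF d e] by simp
  have "(\<Sum>x\<in>p. \<Sum>y\<in>q. G (snd x \<inter> snd y)) = (\<Sum>K\<in>?d. \<Sum>L\<in>?e. G (K \<inter> L))"
    using inner outer by simp
  also have "\<dots> = sum (G \<circ> (\<lambda>(K, L). K \<inter> L)) (?d \<times> ?e)"
    by (simp add: sum.cartesian_product case_prod_unfold)
  also have "\<dots> = sum G ((\<lambda>(K, L). K \<inter> L) ` (?d \<times> ?e))"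
  \<comment> \<open>Different pairs of cells can share an intersection, but only one with empty
    interior, where \<open>G\<close> vanishes.\<close>
  proof (rule sum.reindex_nontrivial[symmetric])
    fix x y assume xy: "x \<in> ?d \<times> ?e" "y \<in> ?d \<times> ?e" "x \<noteq> y"
      "(case x of (K, L) \<Rightarrow> K \<inter> L) = (case y of (K, L) \<Rightarrow> K \<inter> L)"
    obtain K L K' L' where KL: "x = (K, L)" "y = (K', L')" by fastforce
    have "K \<inter> L = K' \<inter> L'"
      using xy(4) by (simp add: KL)
    then have "interior (K \<inter> L) = interior K \<inter> interior L" "interior (K \<inter> L) = interior K' \<inter> interior L'"
      by (metis interior_Int)+
    then have "interior (K \<inter> L) = {}"
      using division_ofD(5)[OF d, of K K'] division_ofD(5)[OF e, of L L'] xy(1-3) unfolding KL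
      by auto
    then show "G (case x of (K, L) \<Rightarrow> K \<inter> L) = 0"
      using G0 xy(1) KL by auto
  qed simp
  also have "\<dots> = sum G ?R"
    by (rule sum.mono_neutral_right) (auto simp: G_def increment_def)
  also have "\<dots> = (\<Sum>k\<in>?R. dist (g (Inf k)) (g (Sup k)))"
    by (rule sum.cong) (auto simp: G_def increment_def dist_norm norm_minus_commute)
  also have "\<dots> \<le> V"
    by (rule V[OF R])
  finally show ?thesis
    by (simp add: G_def)
qed

definition rs_sum :: "(real \<Rightarrow> complex) \<Rightarrow> (real \<Rightarrow> 'a) \<Rightarrow> (real \<times> real set) set \<Rightarrow> 'a :: complex_normed_vector"
  where "rs_sum g F p = (\<Sum>(t, k)\<in>p. (g (Sup k) - g (Inf k)) *\<^sub>C F t)"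

lemma sum_dist_tagged_division_le:
  assumes V: "\<And>d. d division_of {a..b} \<Longrightarrow> (\<Sum>k\<in>d. dist (g (Inf k)) (g (Sup k))) \<le> V"
    and p: "p tagged_division_of {a..b}"
  shows "(\<Sum>(t, k)\<in>p. dist (g (Inf k)) (g (Sup k :: real) :: complex)) \<le> V"
proof -
  have "(\<Sum>(t, k)\<in>p. dist (g (Inf k)) (g (Sup k))) = (\<Sum>(t, k)\<in>p. cmod (increment g k))"
    using p by (intro sum.cong) (auto simp: increment_def dist_norm norm_minus_commute)
  also have "\<dots> = (\<Sum>k\<in>snd ` p. cmod (increment g k))"
    by (rule sum.over_tagged_division_lemma[OF p]) (simp add: increment_neutral)
  also have "\<dots> = (\<Sum>k\<in>snd ` p. dist (g (Inf k)) (g (Sup k)))"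
    using p by (intro sum.cong) (auto simp: increment_def dist_norm norm_minus_commute)
  also have "\<dots> \<le> V"
    by (rule V[OF division_of_tagged_division[OF p]])
  finally show ?thesis .
qed

lemma norm_rs_sum_le:
  assumes V: "\<And>d. d division_of {a..b} \<Longrightarrow> (\<Sum>k\<in>d. dist (g (Inf k)) (g (Sup k))) \<le> V"
    and p: "p tagged_division_of {a..b}"
    and B: "\<And>t. t \<in> {a..b} \<Longrightarrow> norm (F t) \<le> B" and "a \<le> b"
  shows "norm (rs_sum g F p) \<le> V * B"
proof -
  have B0: "B \<ge> 0"
    using B[of a] norm_ge_zero[of "F a"] \<open>a \<le> b\<close> by (meson atLeastAtMost_iff order.refl order_trans)
  have "norm (rs_sum g F p) \<le> (\<Sum>(t, k)\<in>p. dist (g (Inf k)) (g (Sup k)) * B)"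
    unfolding rs_sum_def
  proof (rule sum_norm_le, clarify)
    fix t k assume "(t, k) \<in> p"
    then have "t \<in> {a..b}"
      using tag_in_interval[OF p] by blast
    then show "norm ((g (Sup k) - g (Inf k)) *\<^sub>C F t) \<le> dist (g (Inf k)) (g (Sup k)) * B"
      by (simp add: norm_scaleC dist_norm norm_minus_commute B mult_left_mono)
  qed
  also have "\<dots> = (\<Sum>(t, k)\<in>p. dist (g (Inf k)) (g (Sup k))) * B"
    by (simp add: sum_distrib_right case_prod_unfold)
  also have "\<dots> \<le> V * B"
    by (rule mult_right_mono[OF sum_dist_tagged_division_le[OF V p] B0])
  finally show ?thesis .
qed

text \<open>Over the common refinement both sums have the same increments as weights and differ only
  in the tags. Only cells that meet contribute, and for these the values of \<open>F\<close> are
  within \<open>e\<close>.\<close>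

lemma norm_rs_sum_diff_le:
  fixes F :: "real \<Rightarrow> 'a :: complex_normed_vector"
  assumes V: "\<And>d. d division_of {a..b} \<Longrightarrow> (\<Sum>k\<in>d. dist (g (Inf k)) (g (Sup k))) \<le> V"
    and p: "p tagged_division_of {a..b}" and q: "q tagged_division_of {a..b}"
    and close: "\<And>t k t' k'. (t, k) \<in> p \<Longrightarrow> (t', k') \<in> q \<Longrightarrow> k \<inter> k' \<noteq> {} \<Longrightarrow> norm (F t - F t') \<le> e"
    and e: "e \<ge> 0"
  shows "norm (rs_sum g F p - rs_sum g F q) \<le> V * e"
proof -
  have *: "rs_sum g F p = (\<Sum>x\<in>p. \<Sum>y\<in>q. increment g (snd x \<inter> snd y) *\<^sub>C F (fst x))"
    if p: "p tagged_division_of {a..b}" and q: "q tagged_division_of {a..b}" for p q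
    unfolding rs_sum_def
  proof (rule sum.cong, simp, clarify)
    fix t k assume tk: "(t, k) \<in> p"
    then obtain u v where k: "k = {u..v}" "{u..v} \<subseteq> {a..b}" "t \<in> {u..v}"
      using tagged_division_ofD(2-4)[OF p tk] by auto
    have "(\<Sum>y\<in>q. increment g (snd (t, k) \<inter> snd y)) = g v - g u"
      using sum_increment_tagged_division[OF q k(2)] k
      by (simp add: Int_commute increment_interval)
    then show "(g (Sup k) - g (Inf k)) *\<^sub>C F t =
        (\<Sum>y\<in>q. increment g (snd (t, k) \<inter> snd y) *\<^sub>C F (fst (t, k)))"
      using k by (simp flip: complex_vector.scale_sum_left)
  qed
  have "rs_sum g F q = (\<Sum>x\<in>p. \<Sum>y\<in>q. increment g (snd x \<inter> snd y) *\<^sub>C F (fst y))"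
    by (subst *[OF q p], subst sum.swap) (simp add: Int_commute)
  then have "norm (rs_sum g F p - rs_sum g F q) =
      norm (\<Sum>x\<in>p. \<Sum>y\<in>q. increment g (snd x \<inter> snd y) *\<^sub>C (F (fst x) - F (fst y)))"
    by (simp add: *[OF p q] sum_subtractf complex_vector.scale_right_diff_distrib)
  also have "\<dots> \<le> (\<Sum>x\<in>p. \<Sum>y\<in>q. cmod (increment g (snd x \<inter> snd y)) * e)"
  proof (intro sum_norm_le)
    fix x y assume xy: "x \<in> p" "y \<in> q"
    show "norm (increment g (snd x \<inter> snd y) *\<^sub>C (F (fst x) - F (fst y))) \<le>
        cmod (increment g (snd x \<inter> snd y)) * e"
    proof (cases "snd x \<inter> snd y = {}")
      case False
      then show ?thesis
        using close[of "fst x" "snd x" "fst y" "snd y"] xy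
        by (simp add: norm_scaleC mult_left_mono)
    qed (simp add: increment_def)
  qed
  also have "\<dots> = (\<Sum>x\<in>p. \<Sum>y\<in>q. cmod (increment g (snd x \<inter> snd y))) * e"
    by (simp add: sum_distrib_right)
  also have "\<dots> \<le> V * e"
    by (rule mult_right_mono[OF sum_increment_refinement_le[OF V p q] e])
  finally show ?thesis .
qed

lemma eventually_division_filter_mesh:
  assumes "e > 0"
  shows "\<forall>\<^sub>F p in division_filter {a..b::real}.
    p tagged_division_of {a..b} \<and> (\<forall>(t, k)\<in>p. k \<subseteq> ball t e)"
  unfolding eventually_division_filter
  by (rule exI[of _ "\<lambda>t. ball t e"]) (auto simp: assms gauge_ball fine_def)

text \<open>Uniform continuity of \<open>F\<close> makes the sums over any two fine tagged divisions
  close, so they form a Cauchy filter in a complete space.\<close>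

lemma rs_sum_convergent:
  fixes F :: "real \<Rightarrow> 'a :: {complex_normed_vector, complete_space}"
  assumes V: "\<And>d. d division_of {a..b} \<Longrightarrow> (\<Sum>k\<in>d. dist (g (Inf k)) (g (Sup k))) \<le> V"
    and F: "continuous_on {a..b} F"
  shows "\<exists>L. (rs_sum g F \<longlongrightarrow> L) (division_filter {a..b})"
proof -
  let ?D = "division_filter {a..b}"
  have unif: "uniformly_continuous_on {a..b} F"
    using F by (rule compact_uniformly_continuous) simp
  have "cauchy_filter (filtermap (rs_sum g F) ?D)"
    unfolding cauchy_filter_def le_filter_def eventually_uniformity_metric eventually_prod_same
  proof clarify
    fix P e assume e: "e > (0::real)" and P: "\<forall>x y. dist x y < e \<longrightarrow> P (x :: 'a, y)"
    \<comment> \<open>The sign of \<open>V\<close> is not known here, hence the absolute value; the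
      added 1 keeps the denominator positive and the final bound strict.\<close>
    define e' where "e' = e / (2 * (\<bar>V\<bar> + 1))"
    have e': "e' > 0" using e by (simp add: e'_def)
    have "V * e' \<le> \<bar>V\<bar> * e'" using e' by (intro mult_right_mono) auto
    also have "\<dots> < (\<bar>V\<bar> + 1) * (2 * e')" using e' by (simp add: algebra_simps add_nonneg_pos)
    also have "\<dots> = e" using abs_ge_zero[of V] by (simp add: e'_def field_simps)
    finally have Ve: "V * e' < e" .
    obtain d where d: "d > 0" "\<And>s t. s \<in> {a..b} \<Longrightarrow> t \<in> {a..b} \<Longrightarrow> dist s t < d \<Longrightarrow> dist (F s) (F t) < e'"
      using unif e' unfolding uniformly_continuous_on_def by metis
    let ?Q = "\<lambda>p. p tagged_division_of {a..b} \<and> (\<forall>(t, k)\<in>p. k \<subseteq> ball t (d/2))"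
    have Q: "eventually ?Q ?D"
      using d by (intro eventually_division_filter_mesh) simp
    have close: "dist (rs_sum g F p) (rs_sum g F q) < e" if p: "?Q p" and q: "?Q q" for p q
    proof -
      have "norm (rs_sum g F p - rs_sum g F q) \<le> V * e'"
      proof (rule norm_rs_sum_diff_le[OF V])
        fix t k t' k' assume tk: "(t, k) \<in> p" "(t', k') \<in> q" "k \<inter> k' \<noteq> {}"
        then obtain s where s: "s \<in> k" "s \<in> k'" by auto
        have "s \<in> ball t (d/2)" "s \<in> ball t' (d/2)"
          using p q tk s by blast+
        then have "dist t t' < d"
          using dist_triangle_half_r by (metis dist_commute dist_triangle_half_l mem_ball)
        moreover have "t \<in> {a..b}"
          by (rule tag_in_interval[OF _ tk(1)]) (use p in simp)
        moreover have "t' \<in> {a..b}"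
          by (rule tag_in_interval[OF _ tk(2)]) (use q in simp)
        ultimately show "norm (F t - F t') \<le> e'"
          using d(2)[of t t'] by (simp add: dist_norm)
      qed (use p q e' in auto)
      then show ?thesis using Ve by (simp add: dist_norm)
    qed
    show "\<exists>Q'. eventually Q' (filtermap (rs_sum g F) ?D) \<and> (\<forall>x y. Q' x \<longrightarrow> Q' y \<longrightarrow> P (x, y))"
    proof (intro exI[of _ "\<lambda>x. \<exists>p. ?Q p \<and> x = rs_sum g F p"] conjI)
      show "eventually (\<lambda>x. \<exists>p. ?Q p \<and> x = rs_sum g F p) (filtermap (rs_sum g F) ?D)"
        unfolding eventually_filtermap using Q by (rule eventually_mono) blast
    qed (use close P in blast)
  qed
  moreover have "filtermap (rs_sum g F) ?D \<noteq> bot"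
    using division_filter_not_empty[of a b] by (simp add: filtermap_bot_iff)
  ultimately obtain L where "filtermap (rs_sum g F) ?D \<le> nhds L"
    using cauchy_filter_complete_converges[OF _ complete_UNIV, of "filtermap (rs_sum g F) ?D"]
    by auto
  then show ?thesis
    by (auto simp: filterlim_def)
qed


text \<open>The derivative of \<open>exp w - w\<close> is small near 0, so the error is at most
  \<open>e\<close> times the modulus of \<open>b - a\<close>. As \<open>e\<close> is at most 1/2,
  that modulus is at most twice the modulus of \<open>exp b - exp a\<close>. The error is measured
  by the latter because it becomes an increment of the path, whose sum the variation bounds; no such
  bound is given for the logarithm.\<close>

lemma exp_increment_estimate:
  fixes a b :: complex
  assumes d: "\<And>w. w \<in> ball 0 d \<Longrightarrow> cmod (exp w - 1) \<le> e" and e: "e \<le> 1/2"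
    and a: "a \<in> ball 0 d" and b: "b \<in> ball 0 d"
  shows "cmod (exp b - exp a - (b - a)) \<le> 2 * e * cmod (exp b - exp a)"
proof -
  have "cmod ((exp b - b) - (exp a - a)) \<le> e * cmod (b - a)"
    by (rule field_differentiable_bound[OF convex_ball[of 0 d], where f' = "\<lambda>w. exp w - 1"])
      (use a b d in \<open>auto intro!: derivative_eq_intros\<close>)
  then have le: "cmod (exp b - exp a - (b - a)) \<le> e * cmod (b - a)"
    by (simp add: algebra_simps)
  have "0 \<le> e"
    using d[OF a] norm_ge_zero order_trans by blast
  have "cmod (b - a) \<le> cmod (exp b - exp a) + cmod (exp b - exp a - (b - a))"
    by (metis add.commute add_diff_cancel_left' diff_add_cancel norm_minus_commute norm_triangle_sub)
  also have "\<dots> \<le> cmod (exp b - exp a) + 1/2 * cmod (b - a)"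
    using le mult_right_mono[OF e norm_ge_zero[of "b - a"]] by linarith
  finally have "cmod (b - a) \<le> 2 * cmod (exp b - exp a)" by simp
  with le \<open>0 \<le> e\<close> show ?thesis
    using mult_left_mono[of "cmod (b - a)" "2 * cmod (exp b - exp a)" e] by simp
qed

text \<open>Along a continuous logarithm \<open>q\<close> of \<open>g - z\<close> the sums telescope up to an error that the
  total variation of \<open>g\<close> controls.\<close>

lemma rs_sum_winding_number:
  fixes g :: "real \<Rightarrow> complex"
  assumes V: "\<And>d. d division_of {0..1} \<Longrightarrow> (\<Sum>k\<in>d. dist (g (Inf k)) (g (Sup k))) \<le> V"
    and g: "path g" and z: "z \<notin> path_image g"
  shows "(rs_sum g (\<lambda>t. 1 / (g t - z)) \<longlongrightarrow> 2 * of_real pi * \<i> * winding_number g z) (division_filter {0..1})"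
proof -
  obtain q where q: "path q" "pathfinish q - pathstart q = 2 * of_real pi * \<i> * winding_number g z"
    "\<And>t. t \<in> {0..1} \<Longrightarrow> g t = z + exp (q t)"
    using winding_number_as_continuous_log[OF g z] by blast
  have "closed (path_image g)"
    using g by (simp add: closed_path_image)
  then obtain m where m: "m > 0" "\<And>w. w \<in> path_image g \<Longrightarrow> m \<le> dist z w"
    using separate_point_closed[OF _ z] by blast
  have unif: "uniformly_continuous_on {0..1} q"
    using q(1) unfolding path_def by (rule compact_uniformly_continuous) simp
  have V0: "V \<ge> 0"
    using V[of "{cbox 0 1}"] division_of_self[of 0 "1::real"]
    by (simp add: order_trans[OF zero_le_dist])
  show ?thesis
  proof (rule tendstoI)
    fix e :: real assume e: "e > 0"
    define W where "W = V + 1"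
    have W: "W > 0" "V < 2 * W" using V0 by (auto simp: W_def)
    \<comment> \<open>The bound 1/2 is what \<open>exp_increment_estimate\<close> asks for; the
      other one makes the accumulated error \<open>V * (2 * e' / m)\<close> smaller than
      \<open>e\<close>. \<open>W\<close> replaces \<open>V\<close> to have a positive
      denominator.\<close>
    define e' where "e' = min (1/2) (e * m / (4 * W))"
    have e': "e' > 0" using e m W by (simp add: e'_def)
    have e'2: "e' \<le> 1/2" unfolding e'_def by (rule min.cobounded1)
    have "V * (2 * e' / m) < e"
    proof -
      have "e' \<le> e * m / (4 * W)" by (simp add: e'_def)
      then have "V * (2 * e' / m) \<le> V * (2 * (e * m / (4 * W)) / m)"
        using V0 m by (intro mult_left_mono divide_right_mono) auto
      also have "\<dots> = e * (V / (2 * W))"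
        using m W by (simp add: field_simps)
      also have "\<dots> < e * 1"
        using e W by (intro mult_strict_left_mono) (auto simp: divide_less_eq)
      finally show ?thesis by simp
    qed
    have "((\<lambda>w. exp w - 1 :: complex) \<longlongrightarrow> exp 0 - 1) (at 0)"
      by (intro tendsto_intros)
    then have "\<forall>\<^sub>F w in at 0. cmod (exp w - 1) < e'"
      using e' by (auto simp: tendsto_iff dist_norm)
    then obtain d where d: "d > 0" "\<And>w. w \<noteq> 0 \<Longrightarrow> dist w 0 < d \<Longrightarrow> cmod (exp w - 1) < e'"
      unfolding eventually_at by blast
    have d': "cmod (exp w - 1) \<le> e'" if "w \<in> ball 0 d" for w
      using d(2)[of w] that e' by (cases "w = 0") (auto simp: dist_commute)
    obtain c where c: "c > 0" "\<And>s t. s \<in> {0..1} \<Longrightarrow> t \<in> {0..1} \<Longrightarrow> dist s t < c \<Longrightarrow> dist (q s) (q t) < d"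
      using unif d(1) unfolding uniformly_continuous_on_def by metis
    have "\<forall>\<^sub>F p in division_filter {0..1::real}. p tagged_division_of {0..1} \<and> (\<forall>(t, k)\<in>p. k \<subseteq> ball t c)"
      using c by (intro eventually_division_filter_mesh) simp
    then show "\<forall>\<^sub>F p in division_filter {0..1}.
        dist (rs_sum g (\<lambda>t. 1 / (g t - z)) p) (2 * of_real pi * \<i> * winding_number g z) < e"
    proof eventually_elim
      case (elim p)
      then have p: "p tagged_division_of {0..1}" by simp
      have "2 * of_real pi * \<i> * winding_number g z = q 1 - q 0"
        using q(2) by (simp add: pathfinish_def pathstart_def)
      also have "\<dots> = (\<Sum>(t, k)\<in>p. q (Sup k) - q (Inf k))"
        using additive_tagged_division_1[OF _ p, of q] by simp
      finally have "dist (rs_sum g (\<lambda>t. 1 / (g t - z)) p) (2 * of_real pi * \<i> * winding_number g z) =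
          cmod (\<Sum>(t, k)\<in>p. (g (Sup k) - g (Inf k)) / (g t - z) - (q (Sup k) - q (Inf k)))"
        by (simp add: dist_norm rs_sum_def scaleC_complex_def sum_subtractf case_prod_unfold)
      also have "\<dots> \<le> (\<Sum>(t, k)\<in>p. dist (g (Inf k)) (g (Sup k)) * (2 * e' / m))"
      proof (rule sum_norm_le, clarify)
        fix t k assume tk: "(t, k) \<in> p"
        obtain u v where k: "k = {u..v}" "{u..v} \<subseteq> {0..1}" "t \<in> {u..v}"
          using tagged_division_ofD(2-4)[OF p tk] by auto
        have ball: "{u..v} \<subseteq> ball t c"
          using elim tk k by blast
        have uv: "u \<in> {u..v}" "v \<in> {u..v}" using k(3) by auto
        then have in01: "u \<in> {0..1}" "v \<in> {0..1}" "t \<in> {0..1}" using k by auto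
        have "dist t u < c" "dist t v < c" using uv ball by auto
        then have ab: "q u - q t \<in> ball 0 d" "q v - q t \<in> ball 0 d"
          using c(2)[of u t] c(2)[of v t] in01 by (auto simp: dist_commute dist_norm norm_minus_commute)
        have gt: "m \<le> cmod (g t - z)" "g t - z \<noteq> 0"
          using m(2)[of "g t"] in01 m(1) by (auto simp: path_image_def dist_norm norm_minus_commute)
        \<comment> \<open>Dividing by the value at the tag leaves exponentials of differences of the
          logarithm, which are small on a fine cell.\<close>
        have eq: "exp (q v - q t) - exp (q u - q t) = (g v - g u) / (g t - z)"
          using in01 q(3) by (simp add: exp_diff diff_divide_distrib)
        have "cmod ((g v - g u) / (g t - z) - (q v - q u)) \<le> 2 * e' * cmod ((g v - g u) / (g t - z))"
          using exp_increment_estimate[OF d' e'2 ab] by (simp add: eq)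
        also have "\<dots> \<le> 2 * e' * (cmod (g v - g u) / m)"
          using gt m(1) e' by (intro mult_left_mono) (auto simp: norm_divide intro!: divide_left_mono mult_pos_pos)
        finally show "cmod ((g (Sup k) - g (Inf k)) / (g t - z) - (q (Sup k) - q (Inf k)))
            \<le> dist (g (Inf k)) (g (Sup k)) * (2 * e' / m)"
          using k by (simp add: dist_norm norm_minus_commute mult_ac)
      qed
      also have "\<dots> = (\<Sum>(t, k)\<in>p. dist (g (Inf k)) (g (Sup k))) * (2 * e' / m)"
        by (simp only: sum_distrib_right case_prod_unfold)
      also have "\<dots> \<le> V * (2 * e' / m)"
        using e' m by (intro mult_right_mono sum_dist_tagged_division_le[OF V p]) auto
      also have "\<dots> < e" by fact
      finally show ?case .
    qed
  qed
qed

subsection \<open>Resolvents and spectral projections\<close>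

definition complex_linear :: "('a :: complex_normed_vector \<Rightarrow> 'b :: complex_normed_vector) \<Rightarrow> bool"
  where "complex_linear T \<longleftrightarrow> bounded_linear T \<and> (\<forall>c x. T (c *\<^sub>C x) = c *\<^sub>C T x)"

lemma complex_linearD:
  assumes "complex_linear T"
  shows "bounded_linear T" "T (c *\<^sub>C x) = c *\<^sub>C T x" "T (x + y) = T x + T y" "T (x - y) = T x - T y" "T 0 = 0"
    "T (- x) = - T x"
  using assms bounded_linear.linear[of T]
  by (auto simp: complex_linear_def linear_add linear_diff linear_0 linear_neg)

lemma complex_linear_compose:
  "complex_linear S \<Longrightarrow> complex_linear T \<Longrightarrow> complex_linear (\<lambda>x. S (T x))"
  by (simp add: complex_linear_def bounded_linear_compose)

lemma complex_linear_diff: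
  "complex_linear S \<Longrightarrow> complex_linear T \<Longrightarrow> complex_linear (\<lambda>x. S x - T x)"
  by (simp add: complex_linear_def bounded_linear_sub complex_vector.scale_right_diff_distrib)

lemma complex_linear_scaleC: "complex_linear T \<Longrightarrow> complex_linear (\<lambda>x. c *\<^sub>C T x)"
  by (simp add: complex_linear_def bounded_linear_compose[OF bounded_linear_scaleC_right]
      scaleC_scaleC mult.commute)

lemma resolvent_inverse:
  assumes "z \<in> resolvent_set T"
  shows "resolvent T z (T x - z *\<^sub>C x) = x"
    and "T (resolvent T z x) - z *\<^sub>C resolvent T z x = x"
proof -
  have bij: "bij (shifted T z)" and bl: "bounded_linear (inv (shifted T z))"
    using assms by (auto simp: resolvent_set_def)
  have R: "blinfun_apply (resolvent T z) = inv (shifted T z)"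
    unfolding resolvent_def by (rule bounded_linear_Blinfun_apply[OF bl])
  show "resolvent T z (T x - z *\<^sub>C x) = x"
    using inv_f_f[OF bij_is_inj[OF bij], of x] by (simp add: R shifted_def)
  show "T (resolvent T z x) - z *\<^sub>C resolvent T z x = x"
    using surj_f_inv_f[OF bij_is_surj[OF bij], of x] by (simp add: R shifted_def)
qed

lemma resolvent_setI:
  assumes T: "complex_linear T" and S: "bounded_linear S"
    and "\<And>x. S (T x - z *\<^sub>C x) = x" "\<And>x. T (S x) - z *\<^sub>C S x = x"
  shows "z \<in> resolvent_set T"
proof -
  have inv: "S \<circ> shifted T z = id" "shifted T z \<circ> S = id"
    using assms(3,4) by (auto simp: shifted_def)
  then have "inv (shifted T z) = S" "bij (shifted T z)"
    by (metis inv_unique_comp, metis o_bij)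
  with S show ?thesis by (simp add: resolvent_set_def)
qed

lemma resolvent_scaleC:
  assumes T: "complex_linear T" and z: "z \<in> resolvent_set T"
  shows "resolvent T z (c *\<^sub>C x) = c *\<^sub>C resolvent T z x"
proof -
  let ?R = "resolvent T z"
  have "c *\<^sub>C x = c *\<^sub>C (T (?R x) - z *\<^sub>C ?R x)"
    by (simp add: resolvent_inverse(2)[OF z])
  also have "\<dots> = T (c *\<^sub>C ?R x) - z *\<^sub>C (c *\<^sub>C ?R x)"
    by (simp add: complex_linearD[OF T] complex_vector.scale_right_diff_distrib scaleC_scaleC mult.commute)
  finally show ?thesis
    by (simp only: resolvent_inverse(1)[OF z])
qed

lemma resolvent_commute:
  assumes T: "complex_linear T" and z: "z \<in> resolvent_set T"
  shows "resolvent T z (T x) = T (resolvent T z x)"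
proof -
  have "T x = T (T (resolvent T z x) - z *\<^sub>C resolvent T z x)"
    by (simp add: resolvent_inverse(2)[OF z])
  also have "\<dots> = T (T (resolvent T z x)) - z *\<^sub>C T (resolvent T z x)"
    by (simp add: complex_linearD[OF T])
  finally show ?thesis
    by (simp add: resolvent_inverse(1)[OF z])
qed

lemma resolvent_identity:
  assumes T: "complex_linear T" and z: "z \<in> resolvent_set T" and w: "w \<in> resolvent_set T"
  shows "resolvent T z x - resolvent T w x = (z - w) *\<^sub>C resolvent T z (resolvent T w x)"
proof -
  let ?y = "resolvent T w x"
  have "x = (T ?y - z *\<^sub>C ?y) + (z - w) *\<^sub>C ?y"
    using resolvent_inverse(2)[OF w, of x] by (simp add: complex_vector.scale_left_diff_distrib)
  then have "resolvent T z x = resolvent T z (T ?y - z *\<^sub>C ?y) + resolvent T z ((z - w) *\<^sub>C ?y)"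
    by (metis blinfun.add_right)
  then show ?thesis
    by (simp add: resolvent_inverse(1)[OF z] resolvent_scaleC[OF T z])
qed

lemma norm_resolvent_diff_le:
  assumes T: "complex_linear T" and z: "z \<in> resolvent_set T" and w: "w \<in> resolvent_set T"
  shows "norm (resolvent T z - resolvent T w) \<le> cmod (z - w) * norm (resolvent T z) * norm (resolvent T w)"
proof (rule norm_blinfun_bound)
  fix x
  have "norm ((resolvent T z - resolvent T w) x) = cmod (z - w) * norm (resolvent T z (resolvent T w x))"
    by (simp add: blinfun.diff_left resolvent_identity[OF T z w] norm_scaleC)
  also have "\<dots> \<le> cmod (z - w) * (norm (resolvent T z) * (norm (resolvent T w) * norm x))"
    by (intro mult_left_mono order_trans[OF norm_blinfun] norm_blinfun) auto
  finally show "norm ((resolvent T z - resolvent T w) x) \<le>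
      cmod (z - w) * norm (resolvent T z) * norm (resolvent T w) * norm x"
    by (simp add: mult_ac)
qed simp

text \<open>Continuity is relative to the resolvent set, so both points come with a resolvent and
  the resolvent identity applies.\<close>

lemma continuous_on_resolvent:
  assumes T: "complex_linear T"
  shows "continuous_on (resolvent_set T) (resolvent T)"
  unfolding continuous_on_iff
proof (intro ballI allI impI)
  fix w e assume w: "w \<in> resolvent_set T" and e: "0 < (e :: real)"
  define M where "M = norm (resolvent T w) + 1"
  have M: "M > 0" "norm (resolvent T w) \<le> M" by (auto simp: M_def add_nonneg_pos)
  show "\<exists>d>0. \<forall>z\<in>resolvent_set T. dist z w < d \<longrightarrow> dist (resolvent T z) (resolvent T w) < e"
  \<comment> \<open>The first radius lets the difference be absorbed, which bounds the resolvent at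
    \<open>z\<close> by \<open>2 * M\<close>; with that bound the second radius makes the difference
    smaller than \<open>e\<close>.\<close>
  proof (intro exI[of _ "min (1 / (2 * M)) (e / (2 * M * M))"] conjI ballI impI)
    fix z assume z: "z \<in> resolvent_set T" and d: "dist z w < min (1 / (2 * M)) (e / (2 * M * M))"
    have d1: "cmod (z - w) * M \<le> 1/2" and d2: "cmod (z - w) * (2 * M * M) < e"
      using d M by (auto simp: dist_norm field_simps)
    have le: "norm (resolvent T z - resolvent T w) \<le> cmod (z - w) * norm (resolvent T z) * M"
      by (rule order_trans[OF norm_resolvent_diff_le[OF T z w] mult_left_mono[OF M(2)]]) simp
    also have "\<dots> = norm (resolvent T z) * (cmod (z - w) * M)" by simp
    also have "\<dots> \<le> norm (resolvent T z) * (1/2)"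
      by (intro mult_left_mono d1) simp
    finally have "norm (resolvent T z) \<le> 2 * M"
      using norm_triangle_sub[of "resolvent T z" "resolvent T w"] M(2) by linarith
    then have "cmod (z - w) * norm (resolvent T z) * M \<le> cmod (z - w) * (2 * M) * M"
      using M by (intro mult_right_mono mult_left_mono) auto
    with le d2 show "dist (resolvent T z) (resolvent T w) < e"
      by (simp add: dist_norm mult_ac)
  qed (use M e in auto)
qed

lemma bounded_resolvent:
  assumes "complex_linear T" "compact A" "A \<subseteq> resolvent_set T"
  obtains M where "M > 0" "\<And>z. z \<in> A \<Longrightarrow> norm (resolvent T z) \<le> M"
proof -
  have "compact (resolvent T ` A)"
    using assms continuous_on_subset[OF continuous_on_resolvent] by (blast intro: compact_continuous_image)
  then have "bounded (resolvent T ` A)" by (rule compact_imp_bounded)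
  then show ?thesis using that by (auto simp: bounded_pos)
qed

section \<open>The spectral projection as a limit of Riemann-Stieltjes sums\<close>

lemma rectifiableE:
  assumes "rectifiable g"
  obtains V where "V \<ge> 0" "\<And>d. d division_of {0..1} \<Longrightarrow> (\<Sum>k\<in>d. dist (g (Inf k)) (g (Sup k))) \<le> V"
proof -
  obtain V where V: "\<And>d. d division_of {0..1} \<Longrightarrow> (\<Sum>k\<in>d. dist (g (Inf k)) (g (Sup k))) \<le> V"
    using assms by (auto simp: rectifiable_def)
  moreover have "V \<ge> 0"
    using V[of "{cbox 0 1}"] division_of_self[of 0 "1::real"] by (simp add: order_trans[OF zero_le_dist])
  ultimately show ?thesis using that by blast
qed

text \<open>The defining integral is a limit in the space of operators. Evaluation at
  \<open>x\<close> is continuous, so it passes inside, and all later estimates deal with sums of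
  vectors.\<close>

lemma spectral_projection_limit:
  fixes T :: "'a :: {complex_normed_vector, banach} \<Rightarrow> 'a"
  assumes T: "complex_linear T" and g: "rectifiable g" "path_image g \<subseteq> resolvent_set T"
  shows "((\<lambda>p. (- (1 / (2 * of_real pi * \<i>))) *\<^sub>C rs_sum g (\<lambda>t. resolvent T (g t) x) p) \<longlongrightarrow>
    spectral_projection g T x) (division_filter {0..1})"
proof -
  have cont: "continuous_on {0..1} (\<lambda>t. resolvent T (g t))"
    using g unfolding rectifiable_def path_def path_image_def
    by (blast intro: continuous_on_compose2[OF continuous_on_resolvent[OF T]])
  obtain V where "\<And>d. d division_of {0..1} \<Longrightarrow> (\<Sum>k\<in>d. dist (g (Inf k)) (g (Sup k))) \<le> V"
    using rectifiableE[OF g(1)] by blast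
  from rs_sum_convergent[OF this cont]
  obtain L where L: "(rs_sum g (\<lambda>t. resolvent T (g t)) \<longlongrightarrow> L) (division_filter {0..1})" by blast
  have "path_integral g (resolvent T) = L"
    unfolding path_integral_def
    using L division_filter_not_empty[of 0 "1::real"]
    by (intro tendsto_Lim) (simp_all add: rs_sum_def[abs_def])
  moreover have "rs_sum g (\<lambda>t. resolvent T (g t)) p x = rs_sum g (\<lambda>t. resolvent T (g t) x) p" for p
    by (simp add: rs_sum_def case_prod_unfold scaleC_blinfun.rep_eq blinfun.sum_left)
  moreover have "((\<lambda>p. rs_sum g (\<lambda>t. resolvent T (g t)) p x) \<longlongrightarrow> L x) (division_filter {0..1})"
    by (intro tendsto_intros L)
  ultimately have "((\<lambda>p. rs_sum g (\<lambda>t. resolvent T (g t) x) p) \<longlongrightarrow> path_integral g (resolvent T) x)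
      (division_filter {0..1})"
    by simp
  then show ?thesis
    unfolding spectral_projection_def scaleC_blinfun.rep_eq
    by (rule bounded_linear.tendsto[OF bounded_linear_scaleC_right])
qed

lemma rs_sum_cong:
  assumes "p tagged_division_of {a..b}" "\<And>t. t \<in> {a..b} \<Longrightarrow> F t = H t"
  shows "rs_sum g F p = rs_sum g H p"
  unfolding rs_sum_def
proof (rule sum.cong, simp, clarify)
  fix t k assume "(t, k) \<in> p"
  then show "(g (Sup k) - g (Inf k)) *\<^sub>C F t = (g (Sup k) - g (Inf k)) *\<^sub>C H t"
    using assms(2)[OF tag_in_interval[OF assms(1)]] by simp
qed

lemma rs_sum_diff: "rs_sum g F p - rs_sum g H p = rs_sum g (\<lambda>t. F t - H t) p"
  by (simp add: rs_sum_def case_prod_unfold sum_subtractf complex_vector.scale_right_diff_distrib)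

lemma rs_sum_scaleC_const: "rs_sum g (\<lambda>t. f t *\<^sub>C x) p = rs_sum g f p *\<^sub>C x"
  by (simp add: rs_sum_def case_prod_unfold complex_vector.scale_sum_left scaleC_scaleC scaleC_complex_def)

lemma complex_linear_rs_sum:
  "complex_linear S \<Longrightarrow> S (rs_sum g F p) = rs_sum g (\<lambda>t. S (F t)) p"
  by (simp add: rs_sum_def case_prod_unfold complex_linearD linear_sum[OF bounded_linear.linear])

text \<open>With \<open>\<delta> = T x - \<mu> x\<close> one has \<open>(T - z)\<inverse> x = ((T - z)\<inverse> \<delta> - x) / (z - \<mu>)\<close>,
  and the second summand integrates to the winding number.\<close>

lemma spectral_projection_residual:
  fixes T :: "'a :: {complex_normed_vector, banach} \<Rightarrow> 'a"
  assumes T: "complex_linear T" and g: "rectifiable g" "path_image g \<subseteq> resolvent_set T"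
    and V: "\<And>d. d division_of {0..1} \<Longrightarrow> (\<Sum>k\<in>d. dist (g (Inf k)) (g (Sup k))) \<le> V"
    and M: "\<And>z. z \<in> path_image g \<Longrightarrow> norm (resolvent T z) \<le> M"
    and d: "d > 0" "\<And>z. z \<in> path_image g \<Longrightarrow> d \<le> cmod (z - \<mu>)"
    and wind: "winding_number g \<mu> = 1"
  shows "norm (x - spectral_projection g T x) \<le> V * (M / d) * norm (T x - \<mu> *\<^sub>C x)"
proof -
  let ?c = "- (1 / (2 * of_real pi * \<i>)) :: complex" and ?D = "division_filter {0..1 :: real}"
  let ?\<delta> = "T x - \<mu> *\<^sub>C x"
  define F where "F t = (1 / (g t - \<mu>)) *\<^sub>C resolvent T (g t) ?\<delta>" for t
  have notin: "\<mu> \<notin> path_image g"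
    using d by force
  have g_in: "g t \<in> path_image g" if "t \<in> {0..1}" for t
    using that by (auto simp: path_image_def)
  have F: "resolvent T (g t) x = F t - (1 / (g t - \<mu>)) *\<^sub>C x" if t: "t \<in> {0..1}" for t
  proof -
    let ?z = "g t"
    have z: "?z \<in> resolvent_set T" and ne: "?z - \<mu> \<noteq> 0"
      using g_in[OF t] g(2) notin by auto
    have "?\<delta> = (T x - ?z *\<^sub>C x) + (?z - \<mu>) *\<^sub>C x"
      by (simp add: complex_vector.scale_left_diff_distrib)
    then have "resolvent T ?z ?\<delta> = resolvent T ?z ((T x - ?z *\<^sub>C x) + (?z - \<mu>) *\<^sub>C x)"
      by (rule arg_cong)
    then have "resolvent T ?z ?\<delta> = x + (?z - \<mu>) *\<^sub>C resolvent T ?z x"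
      by (simp only: blinfun.add_right resolvent_inverse(1)[OF z] resolvent_scaleC[OF T z])
    then show ?thesis
      using ne by (simp add: F_def complex_vector.scale_right_distrib scaleC_scaleC scaleC_one)
  qed
  have Fle: "norm (F t) \<le> M / d * norm ?\<delta>" if t: "t \<in> {0..1}" for t
  proof -
    have "norm (F t) \<le> 1 / d * (M * norm ?\<delta>)"
      unfolding F_def norm_scaleC
    proof (rule mult_mono)
      show "cmod (1 / (g t - \<mu>)) \<le> 1 / d"
        using d(1) d(2)[OF g_in[OF t]] by (simp add: norm_divide frac_le)
      show "norm (resolvent T (g t) ?\<delta>) \<le> M * norm ?\<delta>"
        by (rule order_trans[OF norm_blinfun mult_right_mono[OF M[OF g_in[OF t]]]]) simp
    qed (use d in auto)
    then show ?thesis by simp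
  qed
  have "(rs_sum g (\<lambda>t. 1 / (g t - \<mu>)) \<longlongrightarrow> 2 * of_real pi * \<i> * winding_number g \<mu>) ?D"
    using g(1) notin by (intro rs_sum_winding_number[OF V]) (auto simp: rectifiable_def)
  then have "((\<lambda>p. ?c * rs_sum g (\<lambda>t. 1 / (g t - \<mu>)) p) \<longlongrightarrow> ?c * (2 * of_real pi * \<i> * 1)) ?D"
    unfolding wind by (intro tendsto_intros)
  \<comment> \<open>Adding this multiple of \<open>x\<close> to the sums for the projection turns
    their limit into the difference of the projection and \<open>x\<close>, while the sums reduce to
    those of \<open>F\<close>.\<close>
  then have lim1: "((\<lambda>p. ?c * rs_sum g (\<lambda>t. 1 / (g t - \<mu>)) p) \<longlongrightarrow> - 1) ?D"
    by simp
  have bl: "bounded_linear (\<lambda>c. c *\<^sub>C x)"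
  proof (rule bounded_linear_intro[where K = "norm x"])
    show "(r *\<^sub>R c) *\<^sub>C x = r *\<^sub>R (c *\<^sub>C x)" for r c
      by (simp add: scaleC_scaleC scaleR_conv_of_real flip: scaleC_of_real)
  qed (simp_all add: scaleC_add_left norm_scaleC)
  have "((\<lambda>p. ?c *\<^sub>C rs_sum g (\<lambda>t. resolvent T (g t) x) p + (?c * rs_sum g (\<lambda>t. 1 / (g t - \<mu>)) p) *\<^sub>C x)
      \<longlongrightarrow> spectral_projection g T x + (- 1) *\<^sub>C x) ?D"
    by (intro tendsto_add spectral_projection_limit[OF T g] bounded_linear.tendsto[OF bl lim1])
  then have lim: "((\<lambda>p. ?c *\<^sub>C rs_sum g (\<lambda>t. resolvent T (g t) x) p + (?c * rs_sum g (\<lambda>t. 1 / (g t - \<mu>)) p) *\<^sub>C x)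
      \<longlongrightarrow> spectral_projection g T x - x) ?D"
    by (simp add: complex_vector.scale_minus_left scaleC_one)
  have "norm (spectral_projection g T x - x) \<le> V * (M / d * norm ?\<delta>)"
  proof (rule Lim_norm_ubound[OF _ lim])
    show "?D \<noteq> bot" using division_filter_not_empty[of 0 "1::real"] by simp
    have "\<forall>\<^sub>F p in ?D. p tagged_division_of {0..1}"
      by (rule eventually_division_filter_tagged_division)
    then show "\<forall>\<^sub>F p in ?D. norm (?c *\<^sub>C rs_sum g (\<lambda>t. resolvent T (g t) x) p +
        (?c * rs_sum g (\<lambda>t. 1 / (g t - \<mu>)) p) *\<^sub>C x) \<le> V * (M / d * norm ?\<delta>)"
    proof eventually_elim
      case (elim p)
      have "rs_sum g (\<lambda>t. resolvent T (g t) x) p = rs_sum g (\<lambda>t. F t - (1 / (g t - \<mu>)) *\<^sub>C x) p"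
        by (rule rs_sum_cong[OF elim F])
      also have "\<dots> = rs_sum g F p - rs_sum g (\<lambda>t. 1 / (g t - \<mu>)) p *\<^sub>C x"
        by (simp only: rs_sum_scaleC_const flip: rs_sum_diff)
      finally have "?c *\<^sub>C rs_sum g (\<lambda>t. resolvent T (g t) x) p +
          (?c * rs_sum g (\<lambda>t. 1 / (g t - \<mu>)) p) *\<^sub>C x = ?c *\<^sub>C rs_sum g F p"
        by (simp add: complex_vector.scale_right_diff_distrib scaleC_scaleC)
      moreover have "norm (rs_sum g F p) \<le> V * (M / d * norm ?\<delta>)"
        by (rule norm_rs_sum_le[OF V elim Fle]) auto
      \<comment> \<open>The factor has modulus 1/(2 pi), bounded crudely by 1.\<close>
      moreover have "norm (?c *\<^sub>C rs_sum g F p) \<le> 1 * norm (rs_sum g F p)"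
        unfolding norm_scaleC using pi_gt3
        by (intro mult_right_mono) (auto simp: norm_divide norm_mult)
      ultimately show ?case by simp
    qed
  qed
  then show ?thesis
    by (simp add: norm_minus_commute mult_ac)
qed

text \<open>A bounded complex linear map that commutes with every resolvent passes through the sums
  and their limit; this is applied to \<open>T\<close> and to multiplication by
  \<open>c\<close>.\<close>

lemma spectral_projection_commute:
  fixes T :: "'a :: {complex_normed_vector, banach} \<Rightarrow> 'a"
  assumes T: "complex_linear T" and g: "rectifiable g" "path_image g \<subseteq> resolvent_set T"
  shows "spectral_projection g T (T x) = T (spectral_projection g T x)"
    and "spectral_projection g T (c *\<^sub>C x) = c *\<^sub>C spectral_projection g T x"
proof -
  let ?c = "- (1 / (2 * of_real pi * \<i>)) :: complex" and ?D = "division_filter {0..1 :: real}"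
  have D: "?D \<noteq> bot" using division_filter_not_empty[of 0 "1::real"] by simp
  have *: "spectral_projection g T (S x) = S (spectral_projection g T x)"
    if S: "complex_linear S" "\<And>z. z \<in> resolvent_set T \<Longrightarrow> resolvent T z (S x) = S (resolvent T z x)" for S
  proof (rule tendsto_unique[OF D])
    have "((\<lambda>p. S (?c *\<^sub>C rs_sum g (\<lambda>t. resolvent T (g t) x) p)) \<longlongrightarrow> S (spectral_projection g T x)) ?D"
      by (rule bounded_linear.tendsto[OF complex_linearD(1)[OF S(1)] spectral_projection_limit[OF T g]])
    moreover have "\<forall>\<^sub>F p in ?D. p tagged_division_of {0..1}"
      by (rule eventually_division_filter_tagged_division)
    then have "\<forall>\<^sub>F p in ?D. S (?c *\<^sub>C rs_sum g (\<lambda>t. resolvent T (g t) x) p) =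
        ?c *\<^sub>C rs_sum g (\<lambda>t. resolvent T (g t) (S x)) p"
    proof eventually_elim
      case (elim p)
      have "rs_sum g (\<lambda>t. resolvent T (g t) (S x)) p = rs_sum g (\<lambda>t. S (resolvent T (g t) x)) p"
        using g(2) by (intro rs_sum_cong[OF elim] S(2)) (auto simp: path_image_def)
      then show ?case
        by (simp add: complex_linearD(2)[OF S(1)] complex_linear_rs_sum[OF S(1)] del: complex_vector.scale_minus_left)
    qed
    ultimately show "((\<lambda>p. ?c *\<^sub>C rs_sum g (\<lambda>t. resolvent T (g t) (S x)) p) \<longlongrightarrow> S (spectral_projection g T x)) ?D"
      by (rule Lim_transform_eventually)
  qed (rule spectral_projection_limit[OF T g])
  show "spectral_projection g T (T x) = T (spectral_projection g T x)"
    using T resolvent_commute by (intro *) auto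
  show "spectral_projection g T (c *\<^sub>C x) = c *\<^sub>C spectral_projection g T x"
    using resolvent_scaleC[OF T] by (intro *) (auto intro: complex_linear_scaleC simp: complex_linear_def
        bounded_linear_scaleC_right scaleC_scaleC mult.commute)
qed

subsection \<open>Interpolation on a single subinterval\<close>

text \<open>The nodes rescaled to an interval of length 1 centred at 0, so that symmetry about the
  midpoint is a change of sign. The case \<open>r = 0\<close> is separate because division by 0
  would put the node at -1/2.\<close>

definition ref_node :: "nat \<Rightarrow> nat \<Rightarrow> real"
  where "ref_node r i = (if r = 0 then 0 else real i / (2 * real r) - 1/2)"

definition lagrange :: "nat \<Rightarrow> nat \<Rightarrow> real \<Rightarrow> real"
  where "lagrange r i u = (\<Prod>m\<in>{..2*r} - {i}. (u - ref_node r m) / (ref_node r i - ref_node r m))"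

lemma node_eq_ref_node:
  "node r n j i = (real j - 1/2) / real n + 1 / real n * ref_node r i"
  by (cases "n = 0"; cases "r = 0") (auto simp: node_def ref_node_def field_simps)

lemma ref_node_mem: "i \<le> 2 * r \<Longrightarrow> ref_node r i \<in> {-1/2..1/2}"
  by (auto simp: ref_node_def field_simps)

lemma inj_on_ref_node: "inj_on (ref_node r) {..2*r}"
  by (rule inj_onI) (auto simp: ref_node_def split: if_splits)

lemma ref_node_reflect: "i \<le> 2 * r \<Longrightarrow> ref_node r (2 * r - i) = - ref_node r i"
  by (auto simp: ref_node_def field_simps of_nat_diff)

text \<open>The node set is symmetric about 0, so reversing the index and the argument only permutes
  the factors.\<close>

lemma lagrange_reflect:
  assumes "i \<le> 2 * r"
  shows "lagrange r (2 * r - i) (- u) = lagrange r i u"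
  unfolding lagrange_def
proof (rule prod.reindex_bij_witness[of _ "\<lambda>m. 2 * r - m" "\<lambda>m. 2 * r - m"])
  fix m assume m: "m \<in> {..2*r} - {2 * r - i}"
  then have "ref_node r (2 * r - m) = - ref_node r m"
    by (intro ref_node_reflect) simp
  moreover have "(- u - b) / (- a - b) = (u + b) / (a + b)" for a b :: real
    using minus_divide_divide[of "u + b" "a + b"] by simp
  ultimately show "(u - ref_node r (2 * r - m)) / (ref_node r i - ref_node r (2 * r - m)) =
      (- u - ref_node r m) / (ref_node r (2 * r - i) - ref_node r m)"
    using assms by (simp add: ref_node_reflect)
qed (use assms in auto)

text \<open>As polynomials in \<open>u\<close>, both sides have degree at most \<open>2 * r\<close>
  and agree at the \<open>2 * r + 1\<close> distinct reference nodes. The affine substitution lets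
  one set of basis polynomials serve every subinterval.\<close>

lemma lagrange_interpolation:
  fixes p :: "complex poly"
  assumes p: "degree p \<le> 2 * r"
  shows "poly p (of_real (c + h * u)) =
    (\<Sum>i\<le>2*r. poly p (of_real (c + h * ref_node r i)) * of_real (lagrange r i u))"
proof -
  let ?u = "\<lambda>i. of_real (ref_node r i) :: complex"
  define q where "q = pcompose p [:of_real c, of_real h:]"
  define l where "l i = (\<Prod>m\<in>{..2*r} - {i}. smult (1 / (?u i - ?u m)) [:- ?u m, 1:])" for i
  define L where "L = (\<Sum>i\<le>2*r. smult (poly q (?u i)) (l i))"
  have ne: "?u i \<noteq> ?u m" if "i \<le> 2*r" "m \<le> 2*r" "i \<noteq> m" for i m
    using inj_on_ref_node[of r] that by (auto simp: inj_on_def)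
  have l_poly: "poly (l i) x = (\<Prod>m\<in>{..2*r} - {i}. (x - ?u m) / (?u i - ?u m))" for i x
    by (simp add: l_def poly_prod diff_divide_distrib)
  have "degree (l i) \<le> 2 * r" if "i \<le> 2*r" for i
  proof -
    have "degree (smult b [:x, 1:]) \<le> 1" for b x :: complex
      by (rule order_trans[OF degree_smult_le]) simp
    then have "degree (l i) \<le> (\<Sum>m\<in>{..2*r} - {i}. 1)"
      unfolding l_def by (intro order_trans[OF degree_prod_sum_le] sum_mono) (auto simp: o_def)
    also have "\<dots> = 2 * r" using that by simp
    finally show ?thesis .
  qed
  then have degL: "degree L \<le> 2 * r"
    unfolding L_def by (intro degree_sum_le) (auto intro: order_trans[OF degree_smult_le])
  have degq: "degree q \<le> 2 * r"
    unfolding q_def using p by (intro order_trans[OF degree_pcompose_le]) auto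
  have "q = L"
  proof (rule poly_eqI_degree[where A = "?u ` {..2*r}"])
    have card: "card (?u ` {..2*r}) = 2 * r + 1"
      using ne by (subst card_image) (auto simp: inj_on_def)
    show "card (?u ` {..2*r}) > degree q" "card (?u ` {..2*r}) > degree L"
      using card degq degL by auto
    fix x assume "x \<in> ?u ` {..2*r}"
    then obtain k where k: "x = ?u k" "k \<le> 2*r" by auto
    have "poly (l i) (?u k) = (if i = k then 1 else 0)" if "i \<le> 2*r" for i
    proof (cases "i = k")
      case True
      have "(?u k - ?u m) / (?u k - ?u m) = 1" if "m \<in> {..2*r} - {k}" for m
        using ne[of k m] k(2) that by auto
      then show ?thesis by (simp add: l_poly True)
    next
      case False
      then show ?thesis
        using k(2) by (auto simp: l_poly intro!: prod_zero bexI[of _ k])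
    qed
    then have "poly L x = (\<Sum>i\<le>2*r. poly q (?u i) * (if i = k then 1 else 0))"
      by (simp add: L_def poly_sum k)
    also have "\<dots> = poly q x"
      using k by (simp add: if_distrib cong: if_cong)
    finally show "poly q x = poly L x" by simp
  qed
  have "poly p (of_real (c + h * u)) = poly q (of_real u)" for u
    by (simp add: q_def poly_pcompose mult.commute)
  moreover have "poly L (of_real u) = (\<Sum>i\<le>2*r. poly q (?u i) * of_real (lagrange r i u))"
    by (simp add: L_def poly_sum l_poly lagrange_def)
  ultimately show ?thesis
    using \<open>q = L\<close> by simp
qed

lemma lagrange_monomial:
  assumes "m \<le> 2 * r"
  shows "(\<Sum>i\<le>2*r. ref_node r i ^ m * lagrange r i u) = u ^ m"
proof -
  have "complex_of_real (u ^ m) = of_real (\<Sum>i\<le>2*r. ref_node r i ^ m * lagrange r i u)"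
    using lagrange_interpolation[of "monom 1 m" r 0 1 u] assms
    by (simp add: degree_monom_eq poly_monom)
  then show ?thesis by (metis of_real_eq_iff)
qed

section \<open>Lebesgue constant and interpolation error on one subinterval\<close>

definition lebesgue_const :: "nat \<Rightarrow> real"
  where "lebesgue_const r = (SUP u\<in>{-1/2..1/2}. \<Sum>i\<le>2*r. \<bar>lagrange r i u\<bar>)"

lemma continuous_on_lagrange [continuous_intros]: "continuous_on S (lagrange r i)"
  unfolding lagrange_def by (cases "i \<in> {..2*r}") (auto intro!: continuous_intros simp: divide_inverse)

lemma lagrange_sum_le:
  assumes "u \<in> {-1/2..1/2}"
  shows "(\<Sum>i\<le>2*r. \<bar>lagrange r i u\<bar>) \<le> lebesgue_const r"
  unfolding lebesgue_const_def
proof (rule cSUP_upper[OF assms])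
  have "compact ((\<lambda>u. \<Sum>i\<le>2*r. \<bar>lagrange r i u\<bar>) ` {-1/2..1/2})"
    by (intro compact_continuous_image continuous_intros) simp
  then show "bdd_above ((\<lambda>u. \<Sum>i\<le>2*r. \<bar>lagrange r i u\<bar>) ` {-1/2..1/2})"
    by (intro bounded_imp_bdd_above compact_imp_bounded)
qed

lemma lebesgue_const_nonneg: "0 \<le> lebesgue_const r"
  by (rule order_trans[OF sum_nonneg lagrange_sum_le[of 0]]) auto

lemma norm_lagrange_sum_le:
  fixes f :: "nat \<Rightarrow> complex"
  assumes u: "u \<in> {-1/2..1/2}" and f: "\<And>i. i \<le> 2*r \<Longrightarrow> cmod (f i) \<le> B"
  shows "cmod (\<Sum>i\<le>2*r. f i * of_real (lagrange r i u)) \<le> lebesgue_const r * B"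
proof -
  have B: "B \<ge> 0" using f[of 0] norm_ge_zero order_trans by blast
  have "cmod (\<Sum>i\<le>2*r. f i * of_real (lagrange r i u)) \<le> (\<Sum>i\<le>2*r. B * \<bar>lagrange r i u\<bar>)"
    by (rule sum_norm_le) (auto simp: norm_mult intro!: mult_right_mono f)
  also have "\<dots> = (\<Sum>i\<le>2*r. \<bar>lagrange r i u\<bar>) * B"
    by (simp add: sum_distrib_left mult.commute)
  also have "\<dots> \<le> lebesgue_const r * B"
    by (rule mult_right_mono[OF lagrange_sum_le[OF u] B])
  finally show ?thesis .
qed

text \<open>The interpolation error of the lowest power that is not reproduced; the leading error of
  a smooth function is a multiple of it.\<close>

definition monomial_error :: "nat \<Rightarrow> real \<Rightarrow> real"
  where "monomial_error r u = u ^ (2*r+1) - (\<Sum>i\<le>2*r. ref_node r i ^ (2*r+1) * lagrange r i u)"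

text \<open>Interpolation at symmetric nodes commutes with reflection, and the exponent
  \<open>2 * r + 1\<close> is odd.\<close>

lemma monomial_error_odd: "monomial_error r (- u) = - monomial_error r u"
proof -
  have "(\<Sum>i\<le>2*r. ref_node r i ^ (2*r+1) * lagrange r i (-u)) =
      (\<Sum>i\<le>2*r. ref_node r (2*r-i) ^ (2*r+1) * lagrange r (2*r-i) (-u))"
    by (rule sum.reindex_bij_witness[of _ "\<lambda>i. 2*r-i" "\<lambda>i. 2*r-i"]) auto
  also have "\<dots> = (\<Sum>i\<le>2*r. - (ref_node r i ^ (2*r+1) * lagrange r i u))"
    by (rule sum.cong) (simp_all add: ref_node_reflect lagrange_reflect)
  finally show ?thesis
    by (simp add: monomial_error_def sum_negf)
qed

lemma continuous_on_monomial_error [continuous_intros]: "continuous_on S (monomial_error r)"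
  unfolding monomial_error_def by (intro continuous_intros)

lemma monomial_error_le:
  assumes u: "u \<in> {-1/2..1/2}"
  shows "\<bar>monomial_error r u\<bar> \<le> 1 + lebesgue_const r"
proof -
  have pow: "\<bar>v ^ (2*r+1)\<bar> \<le> 1" if "v \<in> {-1/2..1/2}" for v :: real
    unfolding power_abs using that by (intro power_le_one) auto
  have "\<bar>\<Sum>i\<le>2*r. ref_node r i ^ (2*r+1) * lagrange r i u\<bar> =
      cmod (\<Sum>i\<le>2*r. of_real (ref_node r i ^ (2*r+1)) * of_real (lagrange r i u))"
    by (simp flip: of_real_mult of_real_sum)
  also have "\<dots> \<le> lebesgue_const r * 1"
    using pow[OF ref_node_mem] by (intro norm_lagrange_sum_le[OF u]) (simp only: norm_of_real)
  finally show ?thesis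
    using pow[OF u] by (simp add: monomial_error_def)
qed

text \<open>Interpolation reproduces the expansion up to degree \<open>2 * r\<close>, leaves
  \<open>monomial_error\<close> from degree \<open>2 * r + 1\<close>, and enlarges the remainder by
  at most the Lebesgue constant.\<close>

lemma interpolation_error:
  fixes g :: "real \<Rightarrow> complex" and a :: "nat \<Rightarrow> complex"
  assumes p: "degree p \<le> 2 * r"
    and interp: "\<And>i. i \<le> 2 * r \<Longrightarrow> poly p (of_real (c + h * ref_node r i)) = g (c + h * ref_node r i)"
    and taylor: "\<And>t. t \<in> {c - h/2..c + h/2} \<Longrightarrow> cmod (g t - (\<Sum>m\<le>2*r+1. a m * of_real ((t - c) ^ m))) \<le> B"
    and h: "h \<ge> 0" and u: "u \<in> {-1/2..1/2}"
  shows "cmod (g (c + h * u) - poly p (of_real (c + h * u)) -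
      a (2*r+1) * of_real (h ^ (2*r+1) * monomial_error r u)) \<le> (1 + lebesgue_const r) * B"
proof -
  define \<rho> where "\<rho> t = g t - (\<Sum>m\<le>2*r+1. a m * of_real ((t - c) ^ m))" for t
  have in_iv: "c + h * v \<in> {c - h/2..c + h/2}" if "v \<in> {-1/2..1/2}" for v
    using that h mult_left_mono[of "-1/2" v h] mult_left_mono[of v "1/2" h] by auto
  have \<rho>: "cmod (\<rho> (c + h * v)) \<le> B" if "v \<in> {-1/2..1/2}" for v
    unfolding \<rho>_def by (rule taylor[OF in_iv[OF that]])
  have g: "g (c + h * v) = (\<Sum>m\<le>2*r+1. a m * of_real (h ^ m * v ^ m)) + \<rho> (c + h * v)" for v
    by (simp add: \<rho>_def power_mult_distrib)
  let ?l = "\<lambda>i. complex_of_real (lagrange r i u)"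
  define S where "S m = (\<Sum>i\<le>2*r. ref_node r i ^ m * lagrange r i u)" for m
  have "poly p (of_real (c + h * u)) = (\<Sum>i\<le>2*r. g (c + h * ref_node r i) * ?l i)"
    by (subst lagrange_interpolation[OF p], rule sum.cong) (simp_all only: interp atMost_iff)
  also have "\<dots> = (\<Sum>i\<le>2*r. \<Sum>m\<le>2*r+1. a m * of_real (h ^ m * ref_node r i ^ m) * ?l i) +
      (\<Sum>i\<le>2*r. \<rho> (c + h * ref_node r i) * ?l i)"
    unfolding g distrib_right sum.distrib sum_distrib_right ..
  also have "(\<Sum>i\<le>2*r. \<Sum>m\<le>2*r+1. a m * of_real (h ^ m * ref_node r i ^ m) * ?l i) =
      (\<Sum>m\<le>2*r+1. a m * of_real (h ^ m * S m))"
    unfolding S_def by (subst sum.swap) (simp only: sum_distrib_left mult.assoc of_real_mult of_real_sum)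
  also have "\<dots> = (\<Sum>m\<le>2*r. a m * of_real (h ^ m * S m)) + a (2*r+1) * of_real (h ^ (2*r+1) * S (2*r+1))"
    by simp
  also have "(\<Sum>m\<le>2*r. a m * of_real (h ^ m * S m)) = (\<Sum>m\<le>2*r. a m * of_real (h ^ m * u ^ m))"
    by (rule sum.cong) (simp_all add: S_def lagrange_monomial)
  also have "S (2*r+1) = u ^ (2*r+1) - monomial_error r u"
    by (simp add: S_def monomial_error_def)
  finally have "g (c + h * u) - poly p (of_real (c + h * u)) -
      a (2*r+1) * of_real (h ^ (2*r+1) * monomial_error r u) =
      \<rho> (c + h * u) - (\<Sum>i\<le>2*r. \<rho> (c + h * ref_node r i) * ?l i)"
    by (simp add: g[of u] algebra_simps)
  also have "cmod \<dots> \<le> B + lebesgue_const r * B"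
    by (intro norm_triangle_le_diff add_mono \<rho> norm_lagrange_sum_le u ref_node_mem)
  finally show ?thesis by (simp add: algebra_simps)
qed

text \<open>The reflection of \<open>t\<close> to \<open>2 * c - t\<close> preserves the interval
  and carries the integral to its negative.\<close>

lemma has_integral_odd_about:
  fixes f :: "real \<Rightarrow> real"
  assumes cont: "continuous_on {c - d..c + d} f" and odd: "\<And>t. f (2 * c - t) = - f t"
  shows "(f has_integral 0) {c - d..c + d}"
proof -
  obtain I where I: "(f has_integral I) {c - d..c + d}"
    using integrable_continuous_interval[OF cont] by blast
  have "((\<lambda>t. f ((- 1) *\<^sub>R t + 2 * c)) has_integral (1 / \<bar>- 1\<bar> ^ DIM(real)) *\<^sub>R I)
      ((\<lambda>x. (1 / (- 1)) *\<^sub>R x + - ((1 / (- 1)) *\<^sub>R (2 * c))) ` cbox (c - d) (c + d))"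
    using I by (intro has_integral_affinity) auto
  moreover have "(\<lambda>x. (1 / (- 1)) *\<^sub>R x + - ((1 / (- 1)) *\<^sub>R (2 * c))) ` cbox (c - d) (c + d) = {c - d..c + d}"
  proof -
    have "(\<lambda>x. (1 / (- 1)) *\<^sub>R x + - ((1 / (- 1)) *\<^sub>R (2 * c))) ` cbox (c - d) (c + d) = (\<lambda>x. 2 * c - x) ` {c - d..c + d}"
      by (simp add: algebra_simps)
    then show ?thesis by simp
  qed
  ultimately have "((\<lambda>t. - f t) has_integral I) {c - d..c + d}"
    using odd by (simp add: add.commute)
  from has_integral_unique[OF this has_integral_neg[OF I]] I show ?thesis by simp
qed

text \<open>In the second bound the leading error \<open>w\<close>, weighted by the constant
  \<open>k c\<close>, may be subtracted since it is odd about the midpoint and integrates to 0. What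
  remains is of order \<open>2 * r + 2\<close>: the remainder of the expansion, and \<open>w\<close>
  times \<open>k t - k c\<close>, where the Lipschitz bound supplies a further \<open>h\<close>. The
  last factor \<open>h\<close> is the length of the interval. In both bounds the 2 counts the
  remainder and the leading term.\<close>

lemma interpolation_error_bounds:
  fixes g :: "real \<Rightarrow> complex" and a :: "nat \<Rightarrow> complex" and k :: "real \<Rightarrow> real"
  assumes p: "degree p \<le> 2 * r"
    and interp: "\<And>i. i \<le> 2 * r \<Longrightarrow> poly p (of_real (c + h * ref_node r i)) = g (c + h * ref_node r i)"
    and taylor: "\<And>t. t \<in> {c - h/2..c + h/2} \<Longrightarrow>
      cmod (g t - (\<Sum>m\<le>2*r+1. a m * of_real ((t - c) ^ m))) \<le> L * h ^ (2*r+2)"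
    and a: "cmod (a (2*r+1)) \<le> L" and h: "0 < h" "h \<le> 1"
  shows "t \<in> {c - h/2..c + h/2} \<Longrightarrow>
      cmod (g t - poly p (of_real t)) \<le> 2 * (1 + lebesgue_const r) * L * h ^ (2*r+1)"
    and "\<lbrakk>continuous_on {c - h/2..c + h/2} g; continuous_on {c - h/2..c + h/2} k;
      \<And>t. t \<in> {c - h/2..c + h/2} \<Longrightarrow> \<bar>k t\<bar> \<le> M;
      \<And>t. t \<in> {c - h/2..c + h/2} \<Longrightarrow> \<bar>k t - k c\<bar> \<le> M * \<bar>t - c\<bar>\<rbrakk> \<Longrightarrow>
      cmod (integral {c - h/2..c + h/2} (\<lambda>t. of_real (k t) * (g t - poly p (of_real t))))
        \<le> 2 * (1 + lebesgue_const r) * L * M * h ^ (2*r+2) * h"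
proof -
  define \<Lambda> where "\<Lambda> = 1 + lebesgue_const r"
  have \<Lambda>: "\<Lambda> \<ge> 1" using lebesgue_const_nonneg by (simp add: \<Lambda>_def)
  have L: "L \<ge> 0" using a norm_ge_zero order_trans by blast
  define w where "w t = h ^ (2*r+1) * monomial_error r ((t - c) / h)" for t
  have unit: "(t - c) / h \<in> {-1/2..1/2}" if "t \<in> {c - h/2..c + h/2}" for t
    using that h by (auto simp: field_simps)
  have err: "cmod (g t - poly p (of_real t) - a (2*r+1) * of_real (w t)) \<le> \<Lambda> * (L * h ^ (2*r+2))"
    if t: "t \<in> {c - h/2..c + h/2}" for t
    using interpolation_error[OF p interp taylor less_imp_le[OF h(1)] unit[OF t]] h
    by (simp add: w_def \<Lambda>_def)
  have w: "\<bar>w t\<bar> \<le> \<Lambda> * h ^ (2*r+1)" if t: "t \<in> {c - h/2..c + h/2}" for t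
    using monomial_error_le[OF unit[OF t]] h
    by (simp add: w_def abs_mult \<Lambda>_def mult.commute mult_left_mono)
  show "cmod (g t - poly p (of_real t)) \<le> 2 * (1 + lebesgue_const r) * L * h ^ (2*r+1)"
    if t: "t \<in> {c - h/2..c + h/2}" for t
  proof -
    have "cmod (g t - poly p (of_real t)) \<le>
        cmod (g t - poly p (of_real t) - a (2*r+1) * of_real (w t)) + cmod (a (2*r+1)) * \<bar>w t\<bar>"
      by (metis diff_add_cancel norm_mult norm_of_real norm_triangle_ineq)
    also have "\<dots> \<le> \<Lambda> * (L * h ^ (2*r+2)) + L * (\<Lambda> * h ^ (2*r+1))"
      using a L by (intro add_mono err[OF t] mult_mono w[OF t]) auto
    also have "\<dots> \<le> \<Lambda> * (L * h ^ (2*r+1)) + L * (\<Lambda> * h ^ (2*r+1))"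
      using h L \<Lambda> by (intro add_mono mult_left_mono power_decreasing) auto
    finally show ?thesis by (simp add: \<Lambda>_def algebra_simps)
  qed
  assume g: "continuous_on {c - h/2..c + h/2} g" and k: "continuous_on {c - h/2..c + h/2} k"
    and kM: "\<And>t. t \<in> {c - h/2..c + h/2} \<Longrightarrow> \<bar>k t\<bar> \<le> M"
    and kL: "\<And>t. t \<in> {c - h/2..c + h/2} \<Longrightarrow> \<bar>k t - k c\<bar> \<le> M * \<bar>t - c\<bar>"
  let ?S = "{c - h/2..c + h/2}"
  have M: "M \<ge> 0" using kM[of c] h abs_ge_zero order_trans by (metis atLeastAtMost_iff diff_le_eq half_gt_zero le_add_same_cancel1 less_imp_le)
  have wc: "continuous_on ?S w"
    unfolding w_def using h
    by (intro continuous_intros continuous_on_compose2[OF continuous_on_monomial_error[of UNIV]]) auto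
  have "(w has_integral 0) ?S"
  proof (rule has_integral_odd_about[OF wc])
    fix t
    have "(2 * c - t - c) / h = - ((t - c) / h)"
      using h by (simp add: field_simps)
    then show "w (2 * c - t) = - w t"
      by (simp add: w_def monomial_error_odd)
  qed
  then have "((\<lambda>t. complex_of_real (w t)) has_integral of_real 0) ?S"
    using has_integral_linear[OF _ bounded_linear_of_real, of w 0 ?S] by (simp add: o_def)
  from has_integral_mult_right[OF this, of "a (2*r+1) * of_real (k c)"]
  have w0: "((\<lambda>t. a (2*r+1) * of_real (k c) * of_real (w t)) has_integral 0) ?S"
    by simp
  let ?F = "\<lambda>t. of_real (k t) * (g t - poly p (of_real t))"
  have F: "?F integrable_on ?S"
    by (intro integrable_continuous_interval continuous_intros g k)
  let ?G = "\<lambda>t. ?F t - a (2*r+1) * of_real (k c) * of_real (w t)"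
  have "integral ?S ?F = integral ?S ?G"
    using has_integral_diff[OF integrable_integral[OF F] w0] by (simp add: integral_unique)
  also have "cmod \<dots> \<le> 2 * \<Lambda> * L * M * h ^ (2*r+2) * (c + h/2 - (c - h/2))"
  proof (rule integral_bound)
    show "continuous_on ?S ?G"
      by (intro continuous_intros g k wc)
    fix t assume t: "t \<in> ?S"
    have "?G t = of_real (k t) * (g t - poly p (of_real t) - a (2*r+1) * of_real (w t)) +
        a (2*r+1) * of_real ((k t - k c) * w t)"
      by (simp add: algebra_simps)
    also have "cmod \<dots> \<le> \<bar>k t\<bar> * cmod (g t - poly p (of_real t) - a (2*r+1) * of_real (w t)) +
        cmod (a (2*r+1)) * (\<bar>k t - k c\<bar> * \<bar>w t\<bar>)"
      by (rule order_trans[OF norm_triangle_ineq]) (simp add: norm_mult abs_mult flip: of_real_diff)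
    also have "\<dots> \<le> M * (\<Lambda> * (L * h ^ (2*r+2))) + L * ((M * h) * (\<Lambda> * h ^ (2*r+1)))"
    proof (intro add_mono mult_mono kM[OF t] err[OF t] a w[OF t])
      have "M * \<bar>t - c\<bar> \<le> M * h" using t h M by (intro mult_left_mono) auto
      with kL[OF t] show "\<bar>k t - k c\<bar> \<le> M * h" by simp
    qed (use M L \<Lambda> h in auto)
    also have "\<dots> = 2 * \<Lambda> * L * M * h ^ (2*r+2)"
      by simp
    finally show "cmod (?G t) \<le> 2 * \<Lambda> * L * M * h ^ (2*r+2)" .
  qed (use h in auto)
  finally show "cmod (integral ?S ?F) \<le> 2 * (1 + lebesgue_const r) * L * M * h ^ (2*r+2) * h"
    by (simp add: \<Lambda>_def)
qed

subsection \<open>Taylor expansion of the kernel\<close>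

lemma integral_from_0_bounds:
  fixes f :: "real \<Rightarrow> real"
  assumes f: "continuous_on {0..1} f" and B: "\<And>u. u \<in> {0..1} \<Longrightarrow> \<bar>f u\<bar> \<le> B"
    and t: "t \<in> {0..1}" and t': "t' \<in> {0..1}"
  shows "\<bar>integral {0..t} f - integral {0..t'} f\<bar> \<le> B * \<bar>t - t'\<bar>"
proof -
  have *: "\<bar>integral {0..v} f - integral {0..u} f\<bar> \<le> B * \<bar>v - u\<bar>"
    if "0 \<le> u" "u \<le> v" "v \<le> 1" for u v
  proof -
    have int: "f integrable_on {0..v}"
      using that by (intro integrable_continuous_interval continuous_on_subset[OF f]) auto
    have "integral {0..v} f - integral {0..u} f = integral {u..v} f"
      using Henstock_Kurzweil_Integration.integral_combine[OF that(1,2) int] by simp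
    moreover have "norm (integral {u..v} f) \<le> B * (v - u)"
      using that by (intro integral_bound continuous_on_subset[OF f]) (auto simp: B)
    ultimately show ?thesis using that by simp
  qed
  show ?thesis
    using *[of t t'] *[of t' t] t t' by (cases "t \<le> t'") (auto simp: abs_minus_commute)
qed

text \<open>Expanding \<open>\<kappa>(s, t) = \<kappa>(s, 0) + \<integral>\<^sub>0\<^sup>t \<partial>\<^sub>t \<kappa>(s, u) du\<close> in \<open>s\<close> makes coefficients and remainder
  Lipschitz in \<open>t\<close> without interchanging partial derivatives.\<close>

lemma kernel_taylor:
  assumes smooth: "smooth_kernel (Suc N) \<kappa>"
  obtains C A where "C \<ge> 0"
    "\<And>c i t. c \<in> {0..1} \<Longrightarrow> i \<le> N \<Longrightarrow> t \<in> {0..1} \<Longrightarrow> \<bar>A c i t\<bar> \<le> C"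
    "\<And>c i t t'. c \<in> {0..1} \<Longrightarrow> i \<le> N \<Longrightarrow> t \<in> {0..1} \<Longrightarrow> t' \<in> {0..1} \<Longrightarrow> \<bar>A c i t - A c i t'\<bar> \<le> C * \<bar>t - t'\<bar>"
    "\<And>c s t. c \<in> {0..1} \<Longrightarrow> s \<in> {0..1} \<Longrightarrow> t \<in> {0..1} \<Longrightarrow>
      \<bar>\<kappa> s t - (\<Sum>i\<le>N. A c i t * (s - c) ^ i)\<bar> \<le> C * \<bar>s - c\<bar> ^ Suc N"
    "\<And>c s t t'. c \<in> {0..1} \<Longrightarrow> s \<in> {0..1} \<Longrightarrow> t \<in> {0..1} \<Longrightarrow> t' \<in> {0..1} \<Longrightarrow>
      \<bar>\<kappa> s t - (\<Sum>i\<le>N. A c i t * (s - c) ^ i) - (\<kappa> s t' - (\<Sum>i\<le>N. A c i t' * (s - c) ^ i))\<bar>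
        \<le> C * \<bar>s - c\<bar> ^ Suc N * \<bar>t - t'\<bar>"
    "\<And>s t. s \<in> {0..1} \<Longrightarrow> t \<in> {0..1} \<Longrightarrow> \<bar>\<kappa> s t\<bar> \<le> C"
    "\<And>s s' t. s \<in> {0..1} \<Longrightarrow> s' \<in> {0..1} \<Longrightarrow> t \<in> {0..1} \<Longrightarrow> \<bar>\<kappa> s t - \<kappa> s' t\<bar> \<le> C * \<bar>s - s'\<bar>"
    "\<And>s t t'. s \<in> {0..1} \<Longrightarrow> t \<in> {0..1} \<Longrightarrow> t' \<in> {0..1} \<Longrightarrow> \<bar>\<kappa> s t - \<kappa> s t'\<bar> \<le> C * \<bar>t - t'\<bar>"
proof -
  let ?I = "{0..1 :: real}"
  define D where "D a b = kernel_deriv a b \<kappa>" for a b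
  obtain B where "\<forall>a b. a + b \<le> Suc N + 1 \<longrightarrow> (\<forall>s\<in>?I. \<forall>t\<in>?I. \<bar>kernel_deriv a b \<kappa> s t\<bar> \<le> B)"
    using smooth unfolding smooth_kernel_def by blast
  then have B: "\<bar>D a b s t\<bar> \<le> B" if "a + b \<le> Suc (Suc N)" "s \<in> ?I" "t \<in> ?I" for a b s t
    using that by (simp add: D_def)
  have B0: "B \<ge> 0"
    using B[of 0 0 0 0] abs_ge_zero[of "D 0 0 0 0"] by (simp del: abs_ge_zero)
  have D00: "D 0 0 = \<kappa>" by (simp add: D_def kernel_deriv_def)
  have Ds: "((\<lambda>u. D a b u t) has_field_derivative D (Suc a) b s t) (at s within ?I)"
    if "a + b \<le> Suc N" "s \<in> ?I" "t \<in> ?I" for a b s t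
  proof -
    have "(\<lambda>u. D a b u t) differentiable (at s within ?I)"
      using smooth that unfolding smooth_kernel_def D_def by blast
    then show ?thesis
      by (simp add: vector_derivative_works has_real_derivative_iff_has_vector_derivative
          D_def kernel_deriv_def partial_s_def)
  qed
  have Dt: "((\<lambda>u. D 0 0 s u) has_vector_derivative D 0 1 s t) (at t within ?I)"
    if "s \<in> ?I" "t \<in> ?I" for s t
  proof -
    have "(\<lambda>u. D 0 0 s u) differentiable (at t within ?I)"
      using smooth that unfolding smooth_kernel_def D_def by blast
    then show ?thesis
      by (simp add: vector_derivative_works D_def kernel_deriv_def partial_t_def)
  qed
  have Dc: "continuous_on ?I (\<lambda>u. D a b s u)" if "a + b \<le> Suc N" "s \<in> ?I" for a b s
  proof -
    have "continuous_on (?I \<times> ?I) (\<lambda>(s, t). D a b s t)"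
      using smooth that(1) unfolding smooth_kernel_def D_def by blast
    then have "continuous_on ?I (\<lambda>u. (\<lambda>(s, t). D a b s t) (s, u))"
      by (rule continuous_on_compose2) (use that in \<open>auto intro!: continuous_intros\<close>)
    then show ?thesis by simp
  qed
  \<comment> \<open>Taylor remainder in \<open>s\<close> of the \<open>b\<close>-th derivative in
    \<open>t\<close>. For \<open>b = 1\<close> its bound involves \<open>D (Suc N) 1\<close>, of
    order \<open>N + 2\<close>, the highest order that \<open>smooth_kernel (Suc N)\<close>
    bounds.\<close>
  define R where "R b c s t = D 0 b s t - (\<Sum>i\<le>N. D i b c t * ((s - c) ^ i / fact i))" for b c s t
  have R: "\<bar>R b c s t\<bar> \<le> B * \<bar>s - c\<bar> ^ Suc N" if "b \<le> 1" "c \<in> ?I" "s \<in> ?I" "t \<in> ?I" for b c s t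
  proof -
    have "norm (D 0 b s t - (\<Sum>i\<le>N. D i b c t * (s - c) ^ i / fact i)) \<le> B * norm (s - c) ^ Suc N / fact N"
      by (rule field_Taylor[where f = "\<lambda>i s. D i b s t" and S = ?I]) (use that B Ds in auto)
    also have "\<dots> \<le> B * norm (s - c) ^ Suc N / 1"
      using B0 by (intro divide_left_mono) (auto simp: fact_ge_1)
    finally show ?thesis by (simp add: R_def)
  qed
  \<comment> \<open>In place of \<open>D i 0 c t\<close> stands its value at \<open>t = 0\<close>
    plus an integral of \<open>D i 1\<close>, whose boundedness makes the coefficient Lipschitz in
    \<open>t\<close>.\<close>
  define A where "A c i t = (D i 0 c 0 + integral {0..t} (\<lambda>u. D i 1 c u)) / fact i" for c i t
  have FTC: "(D 0 1 s has_integral \<kappa> s t - \<kappa> s 0) {0..t}" if "s \<in> ?I" "t \<in> ?I" for s t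
    using that unfolding D00[symmetric]
    by (intro fundamental_theorem_of_calculus has_vector_derivative_within_subset[OF Dt]) auto
  have Rem: "\<kappa> s t - (\<Sum>i\<le>N. A c i t * (s - c) ^ i) = R 0 c s 0 + integral {0..t} (R 1 c s)"
    if "s \<in> ?I" "t \<in> ?I" "c \<in> ?I" for s t c
  proof -
    have "(D i 1 c has_integral integral {0..t} (D i 1 c)) {0..t}" if "i \<le> N" for i
      using \<open>t \<in> ?I\<close> \<open>c \<in> ?I\<close> that
      by (intro integrable_integral integrable_continuous_interval continuous_on_subset[OF Dc]) auto
    then have "((\<lambda>u. \<Sum>i\<le>N. D i 1 c u * ((s - c) ^ i / fact i)) has_integral
        (\<Sum>i\<le>N. integral {0..t} (D i 1 c) * ((s - c) ^ i / fact i))) {0..t}"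
      by (intro has_integral_sum has_integral_mult_left) auto
    from has_integral_diff[OF FTC[OF that(1,2)] this]
    have "integral {0..t} (R 1 c s) = \<kappa> s t - \<kappa> s 0 -
        (\<Sum>i\<le>N. integral {0..t} (D i 1 c) * ((s - c) ^ i / fact i))"
      by (simp add: integral_unique R_def[abs_def])
    moreover have "(\<Sum>i\<le>N. A c i t * (s - c) ^ i) = (\<Sum>i\<le>N. D i 0 c 0 * ((s - c) ^ i / fact i)) +
        (\<Sum>i\<le>N. integral {0..t} (D i 1 c) * ((s - c) ^ i / fact i))"
      by (simp add: A_def add_divide_distrib distrib_right sum.distrib)
    ultimately show ?thesis by (simp add: R_def D00)
  qed
  have Rc: "continuous_on ?I (R 1 c s)" if "c \<in> ?I" "s \<in> ?I" for c s
    unfolding R_def using that by (intro continuous_intros Dc) auto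
  have int_le: "\<bar>integral {0..t} f\<bar> \<le> b"
    if "continuous_on ?I f" "\<And>u. u \<in> ?I \<Longrightarrow> \<bar>f u\<bar> \<le> b" "t \<in> ?I" for f :: "real \<Rightarrow> real" and b t
  proof -
    have "\<bar>integral {0..t} f\<bar> \<le> b * \<bar>t\<bar>"
      using integral_from_0_bounds[OF that, of 0] by simp
    also have "\<dots> \<le> b * 1"
      using that(2)[of 0] that(3) by (intro mult_left_mono) auto
    finally show ?thesis by simp
  qed
  show ?thesis
  \<comment> \<open>One \<open>B\<close> for the contribution at \<open>t = 0\<close>, one for the
    integral from 0 to \<open>t\<close>.\<close>
  proof (rule that[of "2 * B" A])
    fix c s t t' :: real and i
    assume c: "c \<in> ?I"
    show "\<bar>A c i t\<bar> \<le> 2 * B" if "i \<le> N" "t \<in> ?I"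
    proof -
      have "\<bar>A c i t\<bar> \<le> (\<bar>D i 0 c 0\<bar> + \<bar>integral {0..t} (D i 1 c)\<bar>) / 1"
        unfolding A_def abs_divide by (intro frac_le abs_triangle_ineq) (auto simp: fact_ge_1)
      also have "\<dots> \<le> B + B"
        unfolding div_by_1 using that c by (intro add_mono int_le B Dc) auto
      finally show ?thesis by simp
    qed
    show "\<bar>A c i t - A c i t'\<bar> \<le> 2 * B * \<bar>t - t'\<bar>" if "i \<le> N" "t \<in> ?I" "t' \<in> ?I"
    proof -
      have "A c i t - A c i t' = (integral {0..t} (D i 1 c) - integral {0..t'} (D i 1 c)) / fact i"
        by (simp add: A_def diff_divide_distrib add_divide_distrib)
      then have "\<bar>A c i t - A c i t'\<bar> \<le> \<bar>integral {0..t} (D i 1 c) - integral {0..t'} (D i 1 c)\<bar> / 1"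
        by (simp only: abs_divide) (intro frac_le, auto simp: fact_ge_1)
      also have "\<dots> \<le> B * \<bar>t - t'\<bar>"
        unfolding div_by_1 using that c by (intro integral_from_0_bounds B Dc) auto
      also have "\<dots> \<le> 2 * B * \<bar>t - t'\<bar>"
        using B0 by (intro mult_right_mono) auto
      finally show ?thesis .
    qed
    assume s: "s \<in> ?I"
    show "\<bar>\<kappa> s t - (\<Sum>i\<le>N. A c i t * (s - c) ^ i)\<bar> \<le> 2 * B * \<bar>s - c\<bar> ^ Suc N" if t: "t \<in> ?I"
    proof -
      have "\<bar>R 0 c s 0 + integral {0..t} (R 1 c s)\<bar> \<le> B * \<bar>s - c\<bar> ^ Suc N + B * \<bar>s - c\<bar> ^ Suc N"
        using c s t by (intro order_trans[OF abs_triangle_ineq] add_mono R int_le Rc) auto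
      then show ?thesis by (simp add: Rem[OF s t c])
    qed
    show "\<bar>\<kappa> s t - (\<Sum>i\<le>N. A c i t * (s - c) ^ i) - (\<kappa> s t' - (\<Sum>i\<le>N. A c i t' * (s - c) ^ i))\<bar>
        \<le> 2 * B * \<bar>s - c\<bar> ^ Suc N * \<bar>t - t'\<bar>" if t: "t \<in> ?I" and t': "t' \<in> ?I"
    proof -
      have "\<bar>integral {0..t} (R 1 c s) - integral {0..t'} (R 1 c s)\<bar> \<le> B * \<bar>s - c\<bar> ^ Suc N * \<bar>t - t'\<bar>"
        using c s t t' by (intro integral_from_0_bounds R Rc) auto
      also have "\<dots> \<le> 2 * B * \<bar>s - c\<bar> ^ Suc N * \<bar>t - t'\<bar>"
        using B0 by (intro mult_right_mono) auto
      finally show ?thesis by (simp add: Rem[OF s t c] Rem[OF s t' c])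
    qed
  next
    fix s s' t t' :: real
    assume s: "s \<in> ?I" and t: "t \<in> ?I"
    show "\<bar>\<kappa> s t\<bar> \<le> 2 * B"
      using B[of 0 0 s t] s t B0 by (simp add: D00)
    show "\<bar>\<kappa> s t - \<kappa> s' t\<bar> \<le> 2 * B * \<bar>s - s'\<bar>" if "s' \<in> ?I"
    proof -
      have "norm (D 0 0 s t - D 0 0 s' t) \<le> B * norm (s - s')"
        by (rule field_differentiable_bound[of ?I _ "\<lambda>s. D 1 0 s t"]) (use s t that B Ds[of 0 0] in auto)
      also have "\<dots> \<le> 2 * B * norm (s - s')"
        using B0 by (intro mult_right_mono) auto
      finally show ?thesis by (simp add: D00)
    qed
    show "\<bar>\<kappa> s t - \<kappa> s t'\<bar> \<le> 2 * B * \<bar>t - t'\<bar>" if t': "t' \<in> ?I"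
    proof -
      have "\<bar>integral {0..t} (D 0 1 s) - integral {0..t'} (D 0 1 s)\<bar> \<le> B * \<bar>t - t'\<bar>"
        using s t t' by (intro integral_from_0_bounds B Dc) auto
      also have "\<dots> \<le> 2 * B * \<bar>t - t'\<bar>"
        using B0 by (intro mult_right_mono) auto
      finally show ?thesis using FTC[OF s t] FTC[OF s t'] by (simp add: integral_unique)
    qed
  qed (use B0 in auto)
qed

subsection \<open>The integral operator on essentially bounded functions\<close>

definition pairing :: "(real \<Rightarrow> real) \<Rightarrow> linf \<Rightarrow> complex"
  where "pairing k x = (LINT t|lebesgue01. of_real (k t) * rep_linf x t)"

lemma ess_bounded_rep_linf: "ess_bounded (rep_linf x)"
  using Quotient3_rep_reflp[OF Quotient3_linf, of x] by (simp add: linf_rel_def)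

lemma abs_rep_linf: "abs_linf (rep_linf x) = x"
  by (rule Quotient3_abs_rep[OF Quotient3_linf])

lemma rep_abs_linf: "ess_bounded f \<Longrightarrow> AE t in lebesgue01. rep_linf (abs_linf f) t = f t"
  by (rule abs_linf_eqD) (simp_all add: abs_rep_linf ess_bounded_rep_linf)

lemma rep_linf_add: "AE t in lebesgue01. rep_linf (x + y) t = rep_linf x t + rep_linf y t"
proof -
  have "x + y = abs_linf (\<lambda>t. rep_linf x t + rep_linf y t)"
    using plus_linf.abs_eq[OF linf_rel_refl linf_rel_refl, OF ess_bounded_rep_linf ess_bounded_rep_linf, of x y]
    by (simp add: abs_rep_linf)
  then show ?thesis
    using rep_abs_linf[OF ess_bounded_add[OF ess_bounded_rep_linf ess_bounded_rep_linf], of x y] by simp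
qed

lemma rep_linf_scaleC: "AE t in lebesgue01. rep_linf (c *\<^sub>C x) t = c * rep_linf x t"
proof -
  have "c *\<^sub>C x = abs_linf (\<lambda>t. c * rep_linf x t)"
    using scaleC_linf.abs_eq[OF linf_rel_refl, OF ess_bounded_rep_linf, of c x]
    by (simp add: abs_rep_linf)
  then show ?thesis
    using rep_abs_linf[OF ess_bounded_cmult[OF ess_bounded_rep_linf], of c x] by simp
qed

lemma rep_linf_diff: "AE t in lebesgue01. rep_linf (x - y) t = rep_linf x t - rep_linf y t"
  using rep_linf_add[of "x - y" y]
  by eventually_elim simp

lemma norm_rep_linf_le: "AE t in lebesgue01. cmod (rep_linf x t) \<le> norm x"
  using linf_norm_AE[OF ess_bounded_rep_linf, of x] by (simp add: abs_rep_linf norm_linf_def)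

lemma norm_linf_le:
  assumes "AE t in lebesgue01. cmod (rep_linf x t) \<le> B"
  shows "norm x \<le> B"
  using linf_norm_le[OF ess_bounded_rep_linf assms] by (simp add: abs_rep_linf norm_linf_def)

lemma measure_lebesgue01: "measure lebesgue01 {0..1} = 1"
  by (simp add: measure_restrict_space)

lemma finite_measure_lebesgue01: "finite_measure lebesgue01"
  by (rule finite_measureI) (simp add: emeasure_restrict_space)

lemma rep_linf_measurable: "rep_linf x \<in> borel_measurable lebesgue01"
  using ess_bounded_rep_linf by (simp add: ess_bounded_def)

lemma integrable_pairing:
  assumes "continuous_on {0..1} k"
  shows "integrable lebesgue01 (\<lambda>t. of_real (k t) * rep_linf x t)"
proof -
  interpret finite_measure lebesgue01 by (rule finite_measure_lebesgue01)
  have "bounded (k ` {0..1})"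
    by (intro compact_imp_bounded compact_continuous_image assms) simp
  then obtain B where "\<forall>t\<in>{0..1}. \<bar>k t\<bar> \<le> B"
    by (auto simp: bounded_iff)
  then have B: "\<bar>k t\<bar> \<le> B" if "t \<in> {0..1}" for t
    using that by blast
  show ?thesis
  proof (rule integrable_const_bound[where B = "B * norm x"])
    have "AE t in lebesgue01. t \<in> {0..1}"
      by (rule AE_I2) (simp add: space_restrict_space)
    with norm_rep_linf_le[of x] show "AE t in lebesgue01. cmod (of_real (k t) * rep_linf x t) \<le> B * norm x"
      by eventually_elim (auto simp: norm_mult intro!: mult_mono B order_trans[OF abs_ge_zero B])
    have "k \<in> borel_measurable lebesgue01"
      by (intro continuous_imp_measurable_on_sets_lebesgue assms) simp
    then show "(\<lambda>t. of_real (k t) * rep_linf x t) \<in> borel_measurable lebesgue01"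
      using rep_linf_measurable by (intro borel_measurable_times borel_measurable_of_real) auto
  qed
qed

lemma norm_pairing_le:
  assumes k: "continuous_on {0..1} k" and B: "\<And>t. t \<in> {0..1} \<Longrightarrow> \<bar>k t\<bar> \<le> B"
  shows "cmod (pairing k x) \<le> B * norm x"
proof -
  interpret finite_measure lebesgue01 by (rule finite_measure_lebesgue01)
  have "cmod (pairing k x) \<le> (LINT t|lebesgue01. cmod (of_real (k t) * rep_linf x t))"
    unfolding pairing_def by (rule integral_norm_bound)
  also have "\<dots> \<le> (LINT t|lebesgue01. B * norm x)"
  proof (rule integral_mono_AE)
    have "AE t in lebesgue01. t \<in> {0..1}"
      by (rule AE_I2) (simp add: space_restrict_space)
    with norm_rep_linf_le[of x] show "AE t in lebesgue01. cmod (of_real (k t) * rep_linf x t) \<le> B * norm x"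
      by eventually_elim (auto simp: norm_mult intro!: mult_mono B order_trans[OF abs_ge_zero B])
  qed (use integrable_pairing[OF k] in auto)
  also have "\<dots> = B * norm x"
    by (simp add: measure_lebesgue01 space_restrict_space)
  finally show ?thesis .
qed

lemma pairing_add_right:
  assumes "continuous_on {0..1} k"
  shows "pairing k (x + y) = pairing k x + pairing k y"
proof -
  have "pairing k (x + y) = (LINT t|lebesgue01. of_real (k t) * rep_linf x t + of_real (k t) * rep_linf y t)"
    unfolding pairing_def
  proof (rule integral_cong_AE)
    show "AE t in lebesgue01. of_real (k t) * rep_linf (x + y) t = of_real (k t) * rep_linf x t + of_real (k t) * rep_linf y t"
      using rep_linf_add[of x y] by eventually_elim (simp add: distrib_left)
  qed (intro borel_measurable_add borel_measurable_integrable integrable_pairing assms)+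
  then show ?thesis
    using integrable_pairing[OF assms] by (simp add: pairing_def)
qed

lemma pairing_scaleC_right:
  assumes "continuous_on {0..1} k"
  shows "pairing k (c *\<^sub>C x) = c * pairing k x"
proof -
  have "pairing k (c *\<^sub>C x) = (LINT t|lebesgue01. c * (of_real (k t) * rep_linf x t))"
    unfolding pairing_def
  proof (rule integral_cong_AE)
    show "AE t in lebesgue01. of_real (k t) * rep_linf (c *\<^sub>C x) t = c * (of_real (k t) * rep_linf x t)"
      using rep_linf_scaleC[of c x] by eventually_elim simp
  qed (intro borel_measurable_times borel_measurable_const borel_measurable_integrable integrable_pairing assms)+
  then show ?thesis
    by (simp add: pairing_def)
qed

lemma pairing_diff_left:
  assumes "continuous_on {0..1} k" "continuous_on {0..1} l"
  shows "pairing (\<lambda>t. k t - l t) x = pairing k x - pairing l x"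
  using assms[THEN integrable_pairing, of x] by (simp add: pairing_def left_diff_distrib)

lemma pairing_sum_left:
  assumes "\<And>i. i \<in> S \<Longrightarrow> continuous_on {0..1} (k i)"
  shows "pairing (\<lambda>t. \<Sum>i\<in>S. k i t * b i) x = (\<Sum>i\<in>S. pairing (k i) x * of_real (b i))"
proof -
  have "integrable lebesgue01 (\<lambda>t. of_real (k i t) * rep_linf x t)" if "i \<in> S" for i
    by (rule integrable_pairing[OF assms[OF that]])
  then have "(\<Sum>i\<in>S. pairing (k i) x * of_real (b i)) =
      (LINT t|lebesgue01. (\<Sum>i\<in>S. of_real (k i t) * rep_linf x t * of_real (b i)))"
    by (simp add: pairing_def)
  then show ?thesis
    by (simp add: pairing_def sum_distrib_left sum_distrib_right mult_ac)
qed

lemma complex_linearI: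
  assumes "\<And>x y. T (x + y) = T x + T y" "\<And>c x. T (c *\<^sub>C x) = c *\<^sub>C T x" "\<And>x. norm (T x) \<le> K * norm x"
  shows "complex_linear T"
  unfolding complex_linear_def
proof
  show "bounded_linear T"
  proof (rule bounded_linear_intro[where K = K])
    show "T (a *\<^sub>R x) = a *\<^sub>R T x" for a x
      using assms(2)[of "of_real a" x] by (simp add: scaleC_of_real)
  qed (use assms in \<open>auto simp: mult.commute\<close>)
qed (use assms in auto)

lemma apply_bcontfun_scaleC:
  "apply_bcontfun (c *\<^sub>C f) x = c *\<^sub>C apply_bcontfun f x"
  unfolding scaleC_bcontfun_def
  by (subst Bcontfun_inverse[OF scaleC_bcontfun_aux[OF apply_bcontfun]]) simp

lemma rep_C01_to_linf: "AE t in lebesgue01. rep_linf (C01_to_linf x) t = x (to_unit t)"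
  unfolding C01_to_linf_def by (rule rep_abs_linf[OF ess_bounded_C01])

lemma norm_C01_to_linf_le: "norm (C01_to_linf x) \<le> norm x"
proof (rule norm_linf_le)
  show "AE t in lebesgue01. cmod (rep_linf (C01_to_linf x) t) \<le> norm x"
    using rep_C01_to_linf[of x] by eventually_elim (simp add: norm_bounded)
qed

lemma complex_linear_C01_to_linf: "complex_linear C01_to_linf"
proof (rule complex_linearI[where K = 1])
  show "C01_to_linf (x + y) = C01_to_linf x + C01_to_linf y" for x y
    unfolding C01_to_linf_def
    by (subst plus_linf.abs_eq) (simp_all add: linf_rel_refl ess_bounded_C01 plus_bcontfun.rep_eq)
  show "C01_to_linf (c *\<^sub>C x) = c *\<^sub>C C01_to_linf x" for c x
    unfolding C01_to_linf_def
    by (subst scaleC_linf.abs_eq)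
      (simp_all add: linf_rel_refl ess_bounded_C01 apply_bcontfun_scaleC scaleC_complex_def)
qed (simp add: norm_C01_to_linf_le)

section \<open>Lipschitz weights and expansions of images under the integral operator\<close>

lemma continuous_on_lipschitz_bound:
  fixes k :: "real \<Rightarrow> real"
  assumes "\<And>t t'. t \<in> S \<Longrightarrow> t' \<in> S \<Longrightarrow> \<bar>k t - k t'\<bar> \<le> M * \<bar>t - t'\<bar>"
  shows "continuous_on S k"
proof (rule lipschitz_on_continuous_on)
  show "\<bar>M\<bar>-lipschitz_on S k"
  proof (rule lipschitz_onI)
    fix t t' assume "t \<in> S" "t' \<in> S"
    then have "\<bar>k t - k t'\<bar> \<le> M * \<bar>t - t'\<bar>" by (rule assms)
    also have "\<dots> \<le> \<bar>M\<bar> * \<bar>t - t'\<bar>" by (intro mult_right_mono) auto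
    finally show "dist (k t) (k t') \<le> \<bar>M\<bar> * dist t t'" by (simp add: dist_real_def)
  qed simp
qed

text \<open>The size of a function as seen by integration against Lipschitz functions: for interpolation
  errors it is of higher order than the norm.\<close>

definition weakly_bounded :: "real \<Rightarrow> linf \<Rightarrow> bool"
  where "weakly_bounded \<eta> x \<longleftrightarrow> (\<forall>k M. (\<forall>t\<in>{0..1}. \<bar>k t\<bar> \<le> M) \<longrightarrow>
    (\<forall>t\<in>{0..1}. \<forall>t'\<in>{0..1}. \<bar>k t - k t'\<bar> \<le> M * \<bar>t - t'\<bar>) \<longrightarrow> cmod (pairing k x) \<le> M * \<eta>)"

lemma weakly_boundedD:
  assumes "weakly_bounded \<eta> x" "\<And>t. t \<in> {0..1} \<Longrightarrow> \<bar>k t\<bar> \<le> M"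
    "\<And>t t'. t \<in> {0..1} \<Longrightarrow> t' \<in> {0..1} \<Longrightarrow> \<bar>k t - k t'\<bar> \<le> M * \<bar>t - t'\<bar>"
  shows "cmod (pairing k x) \<le> M * \<eta>"
  using assms unfolding weakly_bounded_def by blast

text \<open>The unit interval has measure 1, so no constant is lost. This is how a function of which
  only the norm is known enters the weak estimates.\<close>

lemma weakly_bounded_norm:
  assumes "norm x \<le> \<eta>"
  shows "weakly_bounded \<eta> x"
  unfolding weakly_bounded_def
proof (intro allI impI)
  fix k :: "real \<Rightarrow> real" and M
  assume k: "\<forall>t\<in>{0..1}. \<bar>k t\<bar> \<le> M" and "\<forall>t\<in>{0..1}. \<forall>t'\<in>{0..1}. \<bar>k t - k t'\<bar> \<le> M * \<bar>t - t'\<bar>"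
  then have "continuous_on {0..1} k"
    by (intro continuous_on_lipschitz_bound) blast
  then have "cmod (pairing k x) \<le> M * norm x"
    by (rule norm_pairing_le) (use k in blast)
  also have "\<dots> \<le> M * \<eta>"
    using k[rule_format, of 0] by (intro mult_left_mono assms) auto
  finally show "cmod (pairing k x) \<le> M * \<eta>" .
qed

text \<open>A substitute for \<open>N + 1\<close> times differentiability with bounds on the derivatives of order
  \<open>N\<close> and \<open>N + 1\<close>.\<close>

definition taylor_bounded :: "nat \<Rightarrow> real \<Rightarrow> C01 \<Rightarrow> bool"
  where "taylor_bounded N L g \<longleftrightarrow> (\<forall>c\<in>{0..1}. \<exists>a. cmod (a N) \<le> L \<and>
    (\<forall>s\<in>{0..1}. cmod (g (to_unit s) - (\<Sum>m\<le>N. a m * of_real ((s - c) ^ m))) \<le> L * \<bar>s - c\<bar> ^ Suc N))"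

text \<open>The conclusions of \<open>kernel_taylor\<close> with a single constant: from here on the
  kernel enters only through these bounds.\<close>

locale expandable_kernel =
  fixes N :: nat and \<kappa> :: "real \<Rightarrow> real \<Rightarrow> real" and C :: real and A :: "real \<Rightarrow> nat \<Rightarrow> real \<Rightarrow> real"
  assumes C_nonneg: "C \<ge> 0"
    and coeff_le: "\<And>c i t. c \<in> {0..1} \<Longrightarrow> i \<le> N \<Longrightarrow> t \<in> {0..1} \<Longrightarrow> \<bar>A c i t\<bar> \<le> C"
    and coeff_lipschitz: "\<And>c i t t'. c \<in> {0..1} \<Longrightarrow> i \<le> N \<Longrightarrow> t \<in> {0..1} \<Longrightarrow> t' \<in> {0..1} \<Longrightarrow>
      \<bar>A c i t - A c i t'\<bar> \<le> C * \<bar>t - t'\<bar>"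
    and remainder_le: "\<And>c s t. c \<in> {0..1} \<Longrightarrow> s \<in> {0..1} \<Longrightarrow> t \<in> {0..1} \<Longrightarrow>
      \<bar>\<kappa> s t - (\<Sum>i\<le>N. A c i t * (s - c) ^ i)\<bar> \<le> C * \<bar>s - c\<bar> ^ Suc N"
    and remainder_lipschitz: "\<And>c s t t'. c \<in> {0..1} \<Longrightarrow> s \<in> {0..1} \<Longrightarrow> t \<in> {0..1} \<Longrightarrow> t' \<in> {0..1} \<Longrightarrow>
      \<bar>\<kappa> s t - (\<Sum>i\<le>N. A c i t * (s - c) ^ i) - (\<kappa> s t' - (\<Sum>i\<le>N. A c i t' * (s - c) ^ i))\<bar>
        \<le> C * \<bar>s - c\<bar> ^ Suc N * \<bar>t - t'\<bar>"
    and kernel_le: "\<And>s t. s \<in> {0..1} \<Longrightarrow> t \<in> {0..1} \<Longrightarrow> \<bar>\<kappa> s t\<bar> \<le> C"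
    and kernel_lipschitz_left: "\<And>s s' t. s \<in> {0..1} \<Longrightarrow> s' \<in> {0..1} \<Longrightarrow> t \<in> {0..1} \<Longrightarrow>
      \<bar>\<kappa> s t - \<kappa> s' t\<bar> \<le> C * \<bar>s - s'\<bar>"
    and kernel_lipschitz_right: "\<And>s t t'. s \<in> {0..1} \<Longrightarrow> t \<in> {0..1} \<Longrightarrow> t' \<in> {0..1} \<Longrightarrow>
      \<bar>\<kappa> s t - \<kappa> s t'\<bar> \<le> C * \<bar>t - t'\<bar>"
begin

lemma continuous_on_kernel: "s \<in> {0..1} \<Longrightarrow> continuous_on {0..1} (\<kappa> s)"
  by (rule continuous_on_lipschitz_bound[OF kernel_lipschitz_right])

lemma pairing_kernel_lipschitz:
  assumes "s \<in> {0..1}" "s' \<in> {0..1}"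
  shows "cmod (pairing (\<kappa> s) x - pairing (\<kappa> s') x) \<le> C * \<bar>s - s'\<bar> * norm x"
proof -
  have "cmod (pairing (\<lambda>t. \<kappa> s t - \<kappa> s' t) x) \<le> C * \<bar>s - s'\<bar> * norm x"
    by (intro norm_pairing_le continuous_intros continuous_on_kernel kernel_lipschitz_left assms)
  then show ?thesis
    by (simp only: pairing_diff_left[OF continuous_on_kernel continuous_on_kernel, OF assms])
qed

lemma of_unit_mem: "of_unit s \<in> {0..1}"
  using of_unit by blast

text \<open>\<open>Bcontfun\<close> can be undone only on bounded continuous functions; continuity
  in \<open>s\<close> comes from the Lipschitz bound on the kernel.\<close>

lemma integral_map_apply: "apply_bcontfun (integral_map \<kappa> x) s = pairing (\<kappa> (of_unit s)) x"
proof -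
  have "(\<lambda>s. pairing (\<kappa> (of_unit s)) x) \<in> bcontfun"
    unfolding bcontfun_def
  proof (intro CollectI conjI)
    have "(C * norm x)-lipschitz_on UNIV (\<lambda>s. pairing (\<kappa> (of_unit s)) x)"
      using pairing_kernel_lipschitz[OF of_unit_mem of_unit_mem, where x = x] C_nonneg
      by (intro lipschitz_onI) (auto simp: dist_norm dist_unit_interval_def mult_ac)
    then show "continuous_on UNIV (\<lambda>s. pairing (\<kappa> (of_unit s)) x)"
      by (rule lipschitz_on_continuous_on)
    show "bounded (range (\<lambda>s. pairing (\<kappa> (of_unit s)) x))"
      unfolding bounded_iff
      using norm_pairing_le[OF continuous_on_kernel[OF of_unit_mem] kernel_le[OF of_unit_mem]]
      by (intro exI[of _ "C * norm x"]) blast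
  qed
  then show ?thesis
    unfolding integral_map_def pairing_def[symmetric] by (simp add: Bcontfun_inverse)
qed

lemma norm_integral_map_le: "weakly_bounded \<eta> x \<Longrightarrow> norm (integral_map \<kappa> x) \<le> C * \<eta>"
  by (rule norm_bound)
    (auto simp: integral_map_apply intro!: weakly_boundedD kernel_le kernel_lipschitz_right of_unit_mem[unfolded atLeastAtMost_iff])

lemma complex_linear_integral_map: "complex_linear (integral_map \<kappa>)"
proof (rule complex_linearI[where K = C])
  show "integral_map \<kappa> (x + y) = integral_map \<kappa> x + integral_map \<kappa> y" for x y
    by (rule bcontfun_eqI)
      (simp add: integral_map_apply plus_bcontfun.rep_eq pairing_add_right[OF continuous_on_kernel[OF of_unit_mem]])
  show "integral_map \<kappa> (c *\<^sub>C x) = c *\<^sub>C integral_map \<kappa> x" for c x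
    by (rule bcontfun_eqI)
      (simp add: integral_map_apply apply_bcontfun_scaleC scaleC_complex_def 
        pairing_scaleC_right[OF continuous_on_kernel[OF of_unit_mem]])
qed (rule norm_integral_map_le[OF weakly_bounded_norm[OF order.refl]])

text \<open>The expansion of the kernel is paired with \<open>x\<close> term by term. Coefficients
  and remainder are Lipschitz in \<open>t\<close>, hence admissible weights, so the image inherits
  the weak bound of \<open>x\<close> and not merely its norm. This lets the gain of the first
  interpolation error survive into the second.\<close>

lemma taylor_bounded_integral_map:
  assumes x: "weakly_bounded \<eta> x"
  shows "taylor_bounded N (C * \<eta>) (integral_map \<kappa> x)"
  unfolding taylor_bounded_def
proof
  fix c :: real assume c: "c \<in> {0..1}"
  have contA: "continuous_on {0..1} (A c i)" if "i \<le> N" for i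
    by (rule continuous_on_lipschitz_bound[OF coeff_lipschitz[OF c that]])
  show "\<exists>a. cmod (a N) \<le> C * \<eta> \<and> (\<forall>s\<in>{0..1}. cmod (integral_map \<kappa> x (to_unit s) -
      (\<Sum>m\<le>N. a m * of_real ((s - c) ^ m))) \<le> C * \<eta> * \<bar>s - c\<bar> ^ Suc N)"
  proof (intro exI[of _ "\<lambda>i. pairing (A c i) x"] conjI ballI)
    show "cmod (pairing (A c N) x) \<le> C * \<eta>"
      by (rule weakly_boundedD[OF x coeff_le[OF c] coeff_lipschitz[OF c]]) auto
    fix s :: real assume s: "s \<in> {0..1}"
    let ?R = "\<lambda>t. \<kappa> s t - (\<Sum>i\<le>N. A c i t * (s - c) ^ i)"
    have "pairing ?R x = pairing (\<kappa> s) x - (\<Sum>i\<le>N. pairing (A c i) x * of_real ((s - c) ^ i))"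
    proof (subst pairing_diff_left)
      have "pairing (\<lambda>t. \<Sum>i\<le>N. A c i t * (s - c) ^ i) x = (\<Sum>i\<le>N. pairing (A c i) x * of_real ((s - c) ^ i))"
        by (rule pairing_sum_left) (use contA in auto)
      then show "pairing (\<kappa> s) x - pairing (\<lambda>t. \<Sum>i\<le>N. A c i t * (s - c) ^ i) x =
          pairing (\<kappa> s) x - (\<Sum>i\<le>N. pairing (A c i) x * of_real ((s - c) ^ i))"
        by simp
    qed (use contA s in \<open>auto intro!: continuous_intros continuous_on_kernel\<close>)
    moreover have "cmod (pairing ?R x) \<le> C * \<bar>s - c\<bar> ^ Suc N * \<eta>"
      by (rule weakly_boundedD[OF x remainder_le[OF c s] remainder_lipschitz[OF c s]])
    ultimately show "cmod (integral_map \<kappa> x (to_unit s) - (\<Sum>i\<le>N. pairing (A c i) x * of_real ((s - c) ^ i)))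
        \<le> C * \<eta> * \<bar>s - c\<bar> ^ Suc N"
      using s by (simp add: integral_map_apply to_unit_inverse mult_ac)
  qed
qed

end

subsection \<open>Piecewise interpolation\<close>

lemma subinterval_eq:
  assumes "n \<ge> 1"
  shows "subinterval n j = {(real j - 1/2) / real n - 1 / real n / 2 .. (real j - 1/2) / real n + 1 / real n / 2}"
  using assms by (simp add: subinterval_def field_simps)

lemma subinterval_subset:
  assumes "n \<ge> 1" "j \<in> {1..n}"
  shows "subinterval n j \<subseteq> {0..1}"
proof -
  have "0 \<le> (real j - 1) / real n" "real j / real n \<le> 1"
    using assms by (auto simp: divide_simps)
  then show ?thesis unfolding subinterval_def by auto
qed

text \<open>The index is the ceiling of \<open>t * real n\<close>. At \<open>t = 0\<close> it would
  be 0, a single point that is later discarded as a null set.\<close>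

lemma subinterval_cover:
  assumes "n \<ge> 1" "t \<in> {0<..1}"
  obtains j where "j \<in> {1..n}" "t \<in> subinterval n j"
proof
  define z where "z = \<lceil>t * real n\<rceil>"
  define j where "j = nat z"
  have pos: "0 < t * real n" and le: "t * real n \<le> real n" using assms by (auto simp: mult_left_le_one_le)
  have z: "0 < z" "z \<le> int n"
    using pos le by (auto simp: z_def ceiling_le_iff)
  then show "j \<in> {1..n}" by (auto simp: j_def)
  have j: "real j = of_int \<lceil>t * real n\<rceil>"
    using z by (simp add: j_def flip: z_def)
  have "real j - 1 \<le> t * real n" "t * real n \<le> real j"
    unfolding j using ceiling_correct[of "t * real n"] by auto
  then show "t \<in> subinterval n j"
    using assms(1) by (simp add: subinterval_def divide_le_eq le_divide_eq)
qed

lemma AE_subinterval: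
  assumes "AE t in lebesgue01. P t" "n \<ge> 1" "j \<in> {1..n}"
  shows "AE t in lebesgue_on (subinterval n j). P t"
proof -
  have "AE t in lebesgue. t \<in> {0..1} \<longrightarrow> P t"
    using assms(1) by (subst (asm) AE_restrict_space_iff) auto
  then have "AE t in lebesgue. t \<in> subinterval n j \<longrightarrow> P t"
    by eventually_elim (use subinterval_subset[OF assms(2,3)] in blast)
  then show ?thesis
    by (subst AE_restrict_space_iff) (auto simp: subinterval_def)
qed

lemma AE_of_subintervals:
  assumes "n \<ge> 1" "\<And>j. j \<in> {1..n} \<Longrightarrow> AE t in lebesgue_on (subinterval n j). P t"
  shows "AE t in lebesgue01. P t"
proof -
  have "AE t in lebesgue. t \<in> subinterval n j \<longrightarrow> P t" if "j \<in> {1..n}" for j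
    using assms(2)[OF that] by (subst (asm) AE_restrict_space_iff) (auto simp: subinterval_def)
  then have "AE t in lebesgue. \<forall>j\<in>{1..n}. t \<in> subinterval n j \<longrightarrow> P t"
    by (subst AE_ball_countable) auto
  moreover have "AE t in lebesgue. t \<noteq> (0::real)"
    by (rule AE_completion) (rule AE_lborel_singleton)
  ultimately have "AE t in lebesgue. t \<in> {0..1} \<longrightarrow> P t"
  proof eventually_elim
    case (elim t)
    show ?case
    proof
      assume "t \<in> {0..1}"
      with elim(2) have "t \<in> {0<..1}" by auto
      then obtain j where "j \<in> {1..n}" "t \<in> subinterval n j"
        by (rule subinterval_cover[OF assms(1)])
      with elim(1) show "P t" by blast
    qed
  qed
  then show ?thesis
    by (subst AE_restrict_space_iff) auto
qed

text \<open>A violation would persist on a nonempty open set, which is not negligible. This turns an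
  essential bound into one at the nodes, which are single points.\<close>

lemma continuous_AE_bound:
  fixes f :: "real \<Rightarrow> complex"
  assumes f: "continuous_on {a..b} f" and ab: "a < b"
    and AE: "AE t in lebesgue_on {a..b}. cmod (f t) \<le> B" and t: "t \<in> {a..b}"
  shows "cmod (f t) \<le> B"
proof (rule ccontr)
  assume "\<not> cmod (f t) \<le> B"
  then have e: "0 < cmod (f t) - B" by simp
  then obtain d where d: "d > 0" "\<And>s. s \<in> {a..b} \<Longrightarrow> dist s t < d \<Longrightarrow> dist (f s) (f t) < cmod (f t) - B"
    using f t unfolding continuous_on_iff by metis
  let ?U = "ball t d \<inter> {a<..<b}"
  have big: "cmod (f s) > B" if "s \<in> ?U" for s
  proof -
    have "dist (f s) (f t) < cmod (f t) - B"
      using that by (intro d(2)) (auto simp: dist_commute)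
    then show ?thesis
      using norm_triangle_ineq2[of "f t" "f s"] by (simp add: dist_norm norm_minus_commute)
  qed
  have "AE s in lebesgue. s \<in> {a..b} \<longrightarrow> cmod (f s) \<le> B"
    using AE by (subst (asm) AE_restrict_space_iff) auto
  then have "AE s in lebesgue. s \<notin> ?U"
  proof eventually_elim
    case (elim s)
    then show ?case using big[of s] by auto
  qed
  then have "?U \<in> null_sets lebesgue"
    by (subst (asm) AE_iff_null_sets[symmetric]) (auto simp: Int_commute)
  then have "negligible ?U"
    by (simp add: negligible_iff_null_sets)
  moreover have "t \<in> closure {a<..<b}"
    using t ab by simp
  then have "?U \<noteq> {}"
    using d(1) unfolding closure_approachable by (force simp: dist_commute)
  moreover have "open ?U"
    by (intro open_Int) auto
  ultimately show False
    using open_not_negligible by blast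
qed

lemma interpolatory_projectionD:
  assumes "interpolatory_projection r n Q"
  shows "complex_linear Q" "Q x \<in> piecewise_polys r n" "y \<in> piecewise_polys r n \<Longrightarrow> Q y = y"
    "interpolates r n g (Q (C01_to_linf g))"
  using assms by (auto simp: interpolatory_projection_def complex_linear_def)

text \<open>The extension of \<open>Q\<close> to all essentially bounded functions need not be bounded uniformly in
  \<open>n\<close>, but on sums of a piecewise polynomial and a continuous function it is determined by
  interpolation.\<close>

lemma norm_projection_le:
  assumes Q: "interpolatory_projection r n Q" and n: "n \<ge> 1" and y: "y \<in> piecewise_polys r n"
  shows "norm (Q (y + C01_to_linf g)) \<le> lebesgue_const r * norm (y + C01_to_linf g)"
proof (rule norm_linf_le, rule AE_of_subintervals[OF n])
  fix j assume j: "j \<in> {1..n}"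
  let ?x = "y + C01_to_linf g" and ?c = "(real j - 1/2) / real n" and ?h = "1 / real n"
  let ?S = "subinterval n j"
  have S: "?S = {?c - ?h/2..?c + ?h/2}" by (rule subinterval_eq[OF n])
  obtain p where p: "degree p \<le> 2 * r" "AE t in lebesgue_on ?S. rep_linf y t = poly p (of_real t)"
    using y j unfolding piecewise_polys_def agrees_with_poly_def by blast
  obtain q where q: "degree q \<le> 2 * r" "\<And>i. i \<le> 2 * r \<Longrightarrow> poly q (of_real (node r n j i)) = g (to_unit (node r n j i))"
    "AE t in lebesgue_on ?S. rep_linf (Q (C01_to_linf g)) t = poly q (of_real t)"
    using interpolatory_projectionD(4)[OF Q, of g] j unfolding interpolates_def agrees_with_poly_def by blast
  let ?f = "\<lambda>t. poly p (of_real t) + g (to_unit t)"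
  \<comment> \<open>\<open>?f\<close> is the continuous representative on the subinterval, so the
    bound holds at its nodes; \<open>p + q\<close> is its interpolant there.\<close>
  have f: "cmod (?f t) \<le> norm ?x" if "t \<in> ?S" for t
  proof (rule continuous_AE_bound[where a = "?c - ?h/2" and b = "?c + ?h/2"])
    show "continuous_on {?c - ?h/2..?c + ?h/2} ?f"
      using subinterval_subset[OF n j] unfolding S
      by (intro continuous_intros continuous_on_subset[OF continuous_on_C01])
    show "AE t in lebesgue_on {?c - ?h/2..?c + ?h/2}. cmod (?f t) \<le> norm ?x"
      unfolding S[symmetric]
      using p(2) AE_subinterval[OF rep_linf_add[of y "C01_to_linf g"] n j]
        AE_subinterval[OF rep_C01_to_linf[of g] n j] AE_subinterval[OF norm_rep_linf_le[of ?x] n j]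
      by eventually_elim simp
  qed (use n that S in auto)
  have pq: "cmod (poly (p + q) (of_real t)) \<le> lebesgue_const r * norm ?x" if t: "t \<in> ?S" for t
  proof -
    define u where "u = (t - ?c) / ?h"
    have u: "u \<in> {-1/2..1/2}" and tu: "t = ?c + ?h * u"
      using t n unfolding S u_def by (auto simp: field_simps)
    have "poly (p + q) (of_real (?c + ?h * u)) =
        (\<Sum>i\<le>2*r. poly (p + q) (of_real (?c + ?h * ref_node r i)) * of_real (lagrange r i u))"
      using p(1) q(1) by (intro lagrange_interpolation degree_add_le)
    also have "cmod \<dots> \<le> lebesgue_const r * norm ?x"
    proof (rule norm_lagrange_sum_le[OF u])
      fix i assume i: "i \<le> 2 * r"
      have node: "?c + ?h * ref_node r i = node r n j i"
        by (simp only: node_eq_ref_node)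
      have "node r n j i \<in> ?S"
        unfolding node[symmetric] S
        using ref_node_mem[OF i] mult_left_mono[of "-1/2" "ref_node r i" ?h] mult_left_mono[of "ref_node r i" "1/2" ?h]
        by auto
      from f[OF this] show "cmod (poly (p + q) (of_real (?c + ?h * ref_node r i))) \<le> norm ?x"
        unfolding node using q(2)[OF i] by simp
    qed
    finally show ?thesis by (simp only: tu)
  qed
  have Qx: "Q ?x = y + Q (C01_to_linf g)"
    using complex_linearD(3)[OF interpolatory_projectionD(1)[OF Q]] interpolatory_projectionD(3)[OF Q y] by simp
  have "AE t in lebesgue_on ?S. t \<in> ?S"
    by (rule AE_I2) (simp add: space_restrict_space)
  then show "AE t in lebesgue_on ?S. cmod (rep_linf (Q ?x) t) \<le> lebesgue_const r * norm ?x"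
    using p(2) q(3) AE_subinterval[OF rep_linf_add[of y "Q (C01_to_linf g)"] n j]
    unfolding Qx
  proof eventually_elim
    case (elim t)
    then show ?case using pq[of t] by simp
  qed
qed

section \<open>The interpolation error over the whole unit interval\<close>

lemma pairing_eq_sum_subintervals:
  assumes n: "n \<ge> 1" and k: "continuous_on {0..1} k"
  shows "pairing k x = (\<Sum>j=1..n. LINT t|lebesgue_on (subinterval n j). of_real (k t) * rep_linf x t)"
proof -
  let ?F = "\<lambda>t. complex_of_real (k t) * rep_linf x t"
  have "(LINT t|lebesgue_on {0..real m / real n}. ?F t) = (\<Sum>j=1..m. LINT t|lebesgue_on (subinterval n j). ?F t)"
    if "m \<le> n" for m
    using that
  proof (induction m)
    case 0
    have "(LINT t|lebesgue_on {0}. ?F t) = 0"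
      by (rule integral_eq_zero_null_sets) (simp add: negligible_iff_null_sets[symmetric])
    then show ?case by simp
  next
    case (Suc m)
    have "integrable (lebesgue_on {0..real (Suc m) / real n}) ?F"
      using Suc.prems n by (intro integrable_subinterval[OF integrable_pairing[OF k]]) (auto simp: field_simps)
    then have "(LINT t|lebesgue_on {0..real (Suc m) / real n}. ?F t) =
        (LINT t|lebesgue_on {0..real m / real n}. ?F t) +
        (LINT t|lebesgue_on {real m / real n..real (Suc m) / real n}. ?F t)"
      by (rule integral_combine) (use n in \<open>auto simp: field_simps\<close>)
    with Suc show ?case by (simp add: subinterval_def)
  qed
  from this[of n] n show ?thesis by (simp add: pairing_def)
qed

text \<open>Supplies the hypotheses of \<open>interpolation_error_bounds\<close> on the
  \<open>j\<close>-th subinterval, expanding about its midpoint.\<close>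

lemma interpolation_on_subinterval:
  assumes Q: "interpolatory_projection r n Q" and n: "n \<ge> 1" and j: "j \<in> {1..n}"
    and g: "taylor_bounded (2 * r + 1) L g"
  defines "e \<equiv> C01_to_linf g - Q (C01_to_linf g)"
  obtains p a where "degree p \<le> 2 * r"
    "\<And>i. i \<le> 2 * r \<Longrightarrow> poly p (of_real ((real j - 1/2) / real n + 1 / real n * ref_node r i)) =
      g (to_unit ((real j - 1/2) / real n + 1 / real n * ref_node r i))"
    "\<And>t. t \<in> subinterval n j \<Longrightarrow>
      cmod (g (to_unit t) - (\<Sum>m\<le>2*r+1. a m * of_real ((t - (real j - 1/2) / real n) ^ m))) \<le> L * (1 / real n) ^ (2*r+2)"
    "cmod (a (2*r+1)) \<le> L"
    "AE t in lebesgue_on (subinterval n j). rep_linf e t = g (to_unit t) - poly p (of_real t)"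
proof -
  have abs_le: "\<bar>t - c\<bar> \<le> d" if "0 < d" "t \<in> {c - d/2..c + d/2}" for t c d :: real
    using that by (auto simp: abs_le_iff)
  have "L \<ge> 0"
    using g unfolding taylor_bounded_def by (metis atLeastAtMost_iff norm_ge_zero order_trans order.refl zero_le_one)
  let ?S = "subinterval n j" and ?h = "1 / real n" and ?c = "\<lambda>j. (real j - 1/2) / real n"
  obtain p where p: "degree p \<le> 2 * r" "\<And>i. i \<le> 2 * r \<Longrightarrow> poly p (of_real (node r n j i)) = g (to_unit (node r n j i))"
    "AE t in lebesgue_on ?S. rep_linf (Q (C01_to_linf g)) t = poly p (of_real t)"
    using interpolatory_projectionD(4)[OF Q, of g] j unfolding interpolates_def agrees_with_poly_def by blast
  have "?c j \<in> ?S"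
    unfolding subinterval_eq[OF n] by simp
  then have "?c j \<in> {0..1}" using subinterval_subset[OF n j] by blast
  then obtain a where a: "cmod (a (2*r+1)) \<le> L"
    "\<And>s. s \<in> {0..1} \<Longrightarrow> cmod (g (to_unit s) - (\<Sum>m\<le>2*r+1. a m * of_real ((s - ?c j) ^ m))) \<le> L * \<bar>s - ?c j\<bar> ^ Suc (2*r+1)"
    using g unfolding taylor_bounded_def by blast
  have AE: "AE t in lebesgue_on ?S. rep_linf e t = g (to_unit t) - poly p (of_real t)"
    using p(3) AE_subinterval[OF rep_linf_diff[of "C01_to_linf g" "Q (C01_to_linf g)"] n j]
      AE_subinterval[OF rep_C01_to_linf[of g] n j]
    unfolding e_def by eventually_elim simp
  have taylor: "cmod (g (to_unit t) - (\<Sum>m\<le>2*r+1. a m * of_real ((t - ?c j) ^ m))) \<le> L * ?h ^ (2*r+2)"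
    if t: "t \<in> ?S" for t
  proof -
    have "\<bar>t - ?c j\<bar> \<le> ?h"
      using t n unfolding subinterval_eq[OF n] by (intro abs_le) auto
    then have "L * \<bar>t - ?c j\<bar> ^ Suc (2*r+1) \<le> L * ?h ^ (2*r+2)"
      using \<open>L \<ge> 0\<close> by (intro mult_left_mono) (auto intro!: power_mono simp del: power_Suc)
    moreover have "t \<in> {0..1}" using t subinterval_subset[OF n j] by blast
    ultimately show ?thesis using a(2)[of t] by linarith
  qed
  show thesis
    by (rule that[OF p(1) p(2)[unfolded node_eq_ref_node] taylor a(1) AE])
qed

lemma interpolation_error_subintervals:
  assumes Q: "interpolatory_projection r n Q" and n: "n \<ge> 1"
    and g: "taylor_bounded (2 * r + 1) L g"
  defines "e \<equiv> C01_to_linf g - Q (C01_to_linf g)"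
  shows "norm e \<le> 2 * (1 + lebesgue_const r) * L * (1 / real n) ^ (2 * r + 1)"
    and "weakly_bounded (2 * (1 + lebesgue_const r) * L * (1 / real n) ^ (2 * r + 2)) e"
proof -
  let ?h = "1 / real n" and ?\<Lambda> = "1 + lebesgue_const r"
  let ?c = "\<lambda>j. (real j - 1/2) / real n"
  have h: "0 < ?h" "?h \<le> 1" using n by auto
  show "norm e \<le> 2 * ?\<Lambda> * L * ?h ^ (2*r+1)"
  proof (rule norm_linf_le, rule AE_of_subintervals[OF n])
    fix j assume j: "j \<in> {1..n}"
    obtain p a where p: "degree p \<le> 2 * r"
      and interp: "\<And>i. i \<le> 2 * r \<Longrightarrow> poly p (of_real (?c j + ?h * ref_node r i)) = g (to_unit (?c j + ?h * ref_node r i))"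
      and taylor: "\<And>t. t \<in> subinterval n j \<Longrightarrow>
        cmod (g (to_unit t) - (\<Sum>m\<le>2*r+1. a m * of_real ((t - ?c j) ^ m))) \<le> L * ?h ^ (2*r+2)"
      and a: "cmod (a (2*r+1)) \<le> L"
      and e: "AE t in lebesgue_on (subinterval n j). rep_linf e t = g (to_unit t) - poly p (of_real t)"
      by (rule interpolation_on_subinterval[OF Q n j g, folded e_def]) blast
    note bounds = interpolation_error_bounds[OF p interp taylor[unfolded subinterval_eq[OF n]] a h]
    have "AE t in lebesgue_on (subinterval n j). t \<in> subinterval n j"
      by (rule AE_I2) (simp add: space_restrict_space)
    with e show "AE t in lebesgue_on (subinterval n j). cmod (rep_linf e t) \<le> 2 * ?\<Lambda> * L * ?h ^ (2*r+1)"
    proof eventually_elim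
      case (elim t)
      then show ?case
        using bounds(1)[of t] unfolding subinterval_eq[OF n] by simp
    qed
  qed
  show "weakly_bounded (2 * ?\<Lambda> * L * ?h ^ (2*r+2)) e"
    unfolding weakly_bounded_def
  proof (intro allI impI)
    fix k :: "real \<Rightarrow> real" and M
    assume kM: "\<forall>t\<in>{0..1}. \<bar>k t\<bar> \<le> M" and kL: "\<forall>t\<in>{0..1}. \<forall>t'\<in>{0..1}. \<bar>k t - k t'\<bar> \<le> M * \<bar>t - t'\<bar>"
    have k: "continuous_on {0..1} k"
      using kL by (intro continuous_on_lipschitz_bound) blast
    have "cmod (LINT t|lebesgue_on (subinterval n j). of_real (k t) * rep_linf e t)
        \<le> 2 * ?\<Lambda> * L * M * ?h ^ (2*r+2) * ?h" if j: "j \<in> {1..n}" for j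
    proof -
    obtain p a where p: "degree p \<le> 2 * r"
      and interp: "\<And>i. i \<le> 2 * r \<Longrightarrow> poly p (of_real (?c j + ?h * ref_node r i)) = g (to_unit (?c j + ?h * ref_node r i))"
      and taylor: "\<And>t. t \<in> subinterval n j \<Longrightarrow>
        cmod (g (to_unit t) - (\<Sum>m\<le>2*r+1. a m * of_real ((t - ?c j) ^ m))) \<le> L * ?h ^ (2*r+2)"
      and a: "cmod (a (2*r+1)) \<le> L"
      and e: "AE t in lebesgue_on (subinterval n j). rep_linf e t = g (to_unit t) - poly p (of_real t)"
      by (rule interpolation_on_subinterval[OF Q n j g, folded e_def]) blast
    note bounds = interpolation_error_bounds[OF p interp taylor[unfolded subinterval_eq[OF n]] a h]
      let ?S = "subinterval n j" and ?F = "\<lambda>t. complex_of_real (k t) * (g (to_unit t) - poly p (of_real t))"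
      have sub: "?S \<subseteq> {0..1}" by (rule subinterval_subset[OF n j])
      have cont: "continuous_on ?S k" "continuous_on ?S (\<lambda>t. g (to_unit t))"
        using sub k continuous_on_C01 continuous_on_subset by blast+
      have contF: "continuous_on ?S ?F"
        by (intro continuous_intros cont)
      have int: "integrable (lebesgue_on ?S) ?F"
        using contF unfolding subinterval_def by (rule continuous_imp_integrable_real)
      have "integrable (lebesgue_on ?S) (\<lambda>t. of_real (k t) * rep_linf e t)"
        using sub unfolding subinterval_def by (intro integrable_subinterval[OF integrable_pairing[OF k]])
      then have "(LINT t|lebesgue_on ?S. of_real (k t) * rep_linf e t) = (LINT t|lebesgue_on ?S. ?F t)"
        using e int by (intro integral_cong_AE) (auto elim: eventually_mono)
      also have "\<dots> = integral ?S ?F"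
        using int by (rule lebesgue_integral_eq_integral) (simp add: subinterval_def)
      also have "cmod \<dots> \<le> 2 * ?\<Lambda> * L * M * ?h ^ (2*r+2) * ?h"
        unfolding subinterval_eq[OF n]
      proof (rule bounds(2))
        have cS: "?c j \<in> ?S" unfolding subinterval_eq[OF n] by simp
        fix t assume "t \<in> {?c j - ?h / 2..?c j + ?h / 2}"
        then have "t \<in> ?S" unfolding subinterval_eq[OF n] .
        then show "\<bar>k t\<bar> \<le> M" "\<bar>k t - k (?c j)\<bar> \<le> M * \<bar>t - ?c j\<bar>"
          using kM kL sub cS by blast+
      qed (use cont in \<open>simp_all only: subinterval_eq[OF n]\<close>)
      finally show ?thesis .
    qed
    then have "cmod (pairing k e) \<le> (\<Sum>j=1..n. 2 * ?\<Lambda> * L * M * ?h ^ (2*r+2) * ?h)"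
      unfolding pairing_eq_sum_subintervals[OF n k] by (rule sum_norm_le)
    \<comment> \<open>The \<open>n\<close> lengths \<open>?h\<close> add up to 1, so summing costs
      no power of \<open>?h\<close>.\<close>
    also have "\<dots> = M * (2 * ?\<Lambda> * L * ?h ^ (2*r+2))"
      using n by simp
    finally show "cmod (pairing k e) \<le> M * (2 * ?\<Lambda> * L * ?h ^ (2*r+2))" .
  qed
qed


subsection \<open>The residual of a modified collocation eigenfunction\<close>

context expandable_kernel
begin

lemma complex_linear_integral_op:
  "complex_linear (integral_op \<kappa>)" "complex_linear (integral_op_C01 \<kappa>)"
  using complex_linear_compose[OF complex_linear_C01_to_linf complex_linear_integral_map]
    complex_linear_compose[OF complex_linear_integral_map complex_linear_C01_to_linf]
  by (simp_all add: integral_op_def[abs_def] integral_op_C01_def[abs_def])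

text \<open>An eigenfunction \<open>x\<close> lies in the sum of the piecewise polynomials and the continuous functions,
  and \<open>\<mu> (x - Q x) = (I - Q) K Q x\<close>, so that the residual is
  \<open>\<mu>\<inverse> (I - Q) K (I - Q) K Q x\<close>.\<close>

lemma modified_op_residual:
  assumes Q: "interpolatory_projection r n Q" and n: "n \<ge> 1" and N: "N = 2 * r + 1"
    and x: "modified_op \<kappa> Q x = \<mu> *\<^sub>C x" "norm x = 1" and \<mu>: "\<mu> \<noteq> 0"
  defines "\<delta> \<equiv> integral_op \<kappa> x - \<mu> *\<^sub>C x"
    and "B \<equiv> C * C * lebesgue_const r * (2 * (1 + lebesgue_const r))\<^sup>2 / cmod \<mu>"
  shows "norm \<delta> \<le> B * (1 / real n) ^ (4 * r + 3)"
    and "norm (integral_map \<kappa> \<delta>) \<le> C * B * (1 / real n) ^ (4 * r + 4)"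
proof -
  let ?J = C01_to_linf and ?K = "integral_map \<kappa>" and ?h = "1 / real n" and ?\<Lambda> = "lebesgue_const r"
  note lin_Q = complex_linearD[OF interpolatory_projectionD(1)[OF Q]]
  note lin_J = complex_linearD[OF complex_linear_C01_to_linf]
  note lin_K = complex_linearD[OF complex_linear_integral_map]
  \<comment> \<open>The constant of the interpolation error. \<open>B\<close> collects
    \<open>C\<close> and \<open>c\<close> once for each of the two passes through K and I - Q, the
    Lebesgue constant as a bound for \<open>Q x\<close>, and the reciprocal of the modulus of
    \<open>\<mu>\<close>.\<close>
  define c where "c = 2 * (1 + ?\<Lambda>)"
  have c: "c \<ge> 0" using lebesgue_const_nonneg[of r] by (simp add: c_def)
  define g where "g = ?K (Q x)"
  define y where "y = Q (?J (?K (x - Q x)))"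
  define e where "e = ?J g - Q (?J g)"
  have y_mem: "y \<in> piecewise_polys r n"
    unfolding y_def by (rule interpolatory_projectionD(2)[OF Q])
  \<comment> \<open>The decomposition on which \<open>norm_projection_le\<close> bounds
    \<open>Q\<close> independently of the extension and of \<open>n\<close>.\<close>
  have eq: "\<mu> *\<^sub>C x = y + ?J g"
    using x(1)[symmetric] by (simp add: modified_op_def integral_op_def y_def g_def lin_Q lin_J lin_K)
  have "norm (Q (\<mu> *\<^sub>C x)) \<le> ?\<Lambda> * norm (\<mu> *\<^sub>C x)"
    unfolding eq by (rule norm_projection_le[OF Q n y_mem])
  then have Qx: "norm (Q x) \<le> ?\<Lambda>"
    using \<mu> x(2) by (simp add: lin_Q norm_scaleC mult.commute)
  have "\<mu> *\<^sub>C Q x = y + Q (?J g)"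
    using arg_cong[OF eq, of Q] interpolatory_projectionD(3)[OF Q y_mem] by (simp add: lin_Q)
  then have "\<mu> *\<^sub>C (x - Q x) = e"
    using eq by (simp add: complex_vector.scale_right_diff_distrib e_def)
  then have diff: "x - Q x = inverse \<mu> *\<^sub>C e"
    using \<mu> by (metis scaleC_scaleC left_inverse scaleC_one)
  have "taylor_bounded (2 * r + 1) (C * ?\<Lambda>) g"
    using taylor_bounded_integral_map[OF weakly_bounded_norm[OF Qx]] by (simp add: g_def N)
  then have e: "weakly_bounded (c * (C * ?\<Lambda>) * ?h ^ (2 * r + 2)) e"
    using interpolation_error_subintervals(2)[OF Q n] by (simp add: e_def c_def)
  define g' where "g' = ?K e"
  define e' where "e' = ?J g' - Q (?J g')"
  define L where "L = C * (c * (C * ?\<Lambda>) * ?h ^ (2 * r + 2))"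
  have "taylor_bounded (2 * r + 1) L g'"
    using taylor_bounded_integral_map[OF e] by (simp add: g'_def N L_def)
  \<comment> \<open>\<open>L\<close> already carries the order \<open>2 * r + 2\<close> from the
    weak bound of \<open>e\<close>. The norm of \<open>e'\<close> adds \<open>2 * r + 1\<close>, its
    weak bound \<open>2 * r + 2\<close>.\<close>
  note e' = interpolation_error_subintervals[OF Q n this, folded e'_def c_def]
  have "\<delta> = ?J (?K (x - Q x)) - Q (?J (?K (x - Q x)))"
    unfolding \<delta>_def eq by (simp add: integral_op_def y_def g_def lin_K lin_J lin_Q)
  then have \<delta>: "\<delta> = inverse \<mu> *\<^sub>C e'"
    by (simp add: diff lin_K lin_J lin_Q e'_def g'_def complex_vector.scale_right_diff_distrib)
  have L: "c * L = C * C * ?\<Lambda> * c\<^sup>2 * ?h ^ (2 * r + 2)"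
    by (simp add: L_def power2_eq_square)
  have pow: "?h ^ (2 * r + 2) * ?h ^ (2 * r + 1) = ?h ^ (4 * r + 3)"
    "?h ^ (2 * r + 2) * ?h ^ (2 * r + 2) = ?h ^ (4 * r + 4)"
    unfolding power_add[symmetric] by (rule arg_cong[of _ _ "(^) ?h"]; simp)+
  have B: "B = C * C * ?\<Lambda> * c\<^sup>2 / cmod \<mu>"
    by (simp add: B_def c_def)
  have "norm \<delta> = norm e' / cmod \<mu>"
    by (simp add: \<delta> norm_scaleC norm_inverse divide_inverse mult.commute)
  also have "\<dots> \<le> (c * L * ?h ^ (2 * r + 1)) / cmod \<mu>"
    by (intro divide_right_mono e'(1)) simp
  also have "\<dots> = B * (?h ^ (2 * r + 2) * ?h ^ (2 * r + 1))"
    by (simp only: L B times_divide_eq_left mult.assoc)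
  finally show "norm \<delta> \<le> B * (1 / real n) ^ (4 * r + 3)"
    by (simp only: pow)
  have "norm (?K \<delta>) = norm (?K e') / cmod \<mu>"
    by (simp add: \<delta> lin_K norm_scaleC norm_inverse divide_inverse mult.commute)
  also have "\<dots> \<le> (C * (c * L * ?h ^ (2 * r + 2))) / cmod \<mu>"
    by (intro divide_right_mono norm_integral_map_le e'(2)) simp
  also have "\<dots> = C * B * (?h ^ (2 * r + 2) * ?h ^ (2 * r + 2))"
    by (simp only: L B times_divide_eq_left times_divide_eq_right mult.assoc)
  finally show "norm (?K \<delta>) \<le> C * B * (1 / real n) ^ (4 * r + 4)"
    by (simp only: pow)
qed

end

section \<open>From residuals to the range of the spectral projection\<close>

lemma spectral_projection_near:
  fixes T :: "'a :: {complex_normed_vector, banach} \<Rightarrow> 'a"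
  assumes T: "complex_linear T" and g: "rectifiable g" "path_image g \<subseteq> resolvent_set T" "pathfinish g = pathstart g"
    and z: "z \<notin> path_image g" "winding_number g z = 1"
  obtains e M where "e > 0" "M > 0"
    "\<And>\<mu> x. dist z \<mu> < e \<Longrightarrow> norm (x - spectral_projection g T x) \<le> M * norm (T x - \<mu> *\<^sub>C x)"
proof -
  have path: "path g" using g(1) by (simp add: rectifiable_def)
  obtain d where d: "d > 0" "\<And>w. w \<in> path_image g \<Longrightarrow> d \<le> dist z w"
    using separate_point_closed[OF closed_path_image[OF path] z(1)] by blast
  obtain V where V: "V \<ge> 0" "\<And>d. d division_of {0..1} \<Longrightarrow> (\<Sum>k\<in>d. dist (g (Inf k)) (g (Sup k))) \<le> V"
    using rectifiableE[OF g(1)] by blast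
  obtain R where R: "R > 0" "\<And>w. w \<in> path_image g \<Longrightarrow> norm (resolvent T w) \<le> R"
    using bounded_resolvent[OF T compact_path_image[OF path] g(2)] by blast
  show thesis
  \<comment> \<open>The path stays at distance at least \<open>d\<close> from \<open>z\<close>.
    Within \<open>d/2\<close> of \<open>z\<close> the winding number is therefore unchanged, and the
    distance to the path is still at least \<open>d/2\<close>. The added 1 makes the constant
    positive even if \<open>V\<close> is 0.\<close>
  proof (rule that[of "d/2" "V * (R / (d/2)) + 1"])
    show "V * (R / (d/2)) + 1 > 0"
      using V(1) R(1) d(1) by (intro add_nonneg_pos mult_nonneg_nonneg divide_nonneg_nonneg) auto
    fix \<mu> x assume \<mu>: "dist z \<mu> < d/2"
    have far: "d/2 \<le> cmod (w - \<mu>)" if "w \<in> path_image g" for w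
      using d(2)[OF that] \<mu> dist_triangle[of z w \<mu>] by (simp add: dist_norm norm_minus_commute)
    have "ball z (d/2) \<inter> path_image g = {}"
      using d by force
    then have "winding_number g \<mu> = winding_number g z"
      using \<mu> d(1) by (intro winding_number_eq[OF path g(3) _ _ connected_ball]) auto
    then have "norm (x - spectral_projection g T x) \<le> V * (R / (d/2)) * norm (T x - \<mu> *\<^sub>C x)"
      using far d(1) z(2) by (intro spectral_projection_residual[OF T g(1,2) V(2) R(2)]) auto
    also have "\<dots> \<le> (V * (R / (d/2)) + 1) * norm (T x - \<mu> *\<^sub>C x)"
      by (intro mult_right_mono) auto
    finally show "norm (x - spectral_projection g T x) \<le> (V * (R / (d/2)) + 1) * norm (T x - \<mu> *\<^sub>C x)" .
  qed (use d in auto)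
qed

text \<open>An eigenvector has residual 0, so the projection fixes it; rank one then makes the whole
  range a multiple of it.\<close>

lemma spectral_projection_simple:
  fixes T :: "'a :: {complex_normed_vector, banach} \<Rightarrow> 'a"
  assumes T: "complex_linear T" and g: "rectifiable g" "path_image g \<subseteq> resolvent_set T" "pathfinish g = pathstart g"
    and z: "z \<notin> path_image g" "winding_number g z = 1"
    and eigen: "eigenvalue T z" and rank: "rank (spectral_projection g T) = 1"
  shows "T (spectral_projection g T x) = z *\<^sub>C spectral_projection g T x"
proof -
  let ?E = "spectral_projection g T"
  obtain v where v: "v \<noteq> 0" "T v = z *\<^sub>C v"
    using eigen by (auto simp: eigenvalue_def)
  obtain e M where near: "e > 0" "\<And>\<mu> x. dist z \<mu> < e \<Longrightarrow> norm (x - ?E x) \<le> M * norm (T x - \<mu> *\<^sub>C x)"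
    using spectral_projection_near[OF T g z] by metis
  have "norm (v - ?E v) \<le> M * norm (T v - z *\<^sub>C v)"
    using near by simp
  then have Ev: "?E v = v" by (simp add: v)
  obtain B where B: "range ?E \<subseteq> complex_vector.span B" "card B = complex_vector.dim (range ?E)"
    using complex_vector.basis_exists[of "range ?E"] by metis
  then obtain b where b: "B = {b}"
    using rank by (auto simp: rank_def card_1_singleton_iff)
  have span: "\<exists>c. ?E u = c *\<^sub>C b" for u
    using B(1) unfolding b complex_vector.span_singleton by blast
  obtain k where k: "v = k *\<^sub>C b"
    using span[of v] Ev by auto
  then have "k \<noteq> 0" using v(1) by auto
  then have "b = inverse k *\<^sub>C v"
    by (simp add: k scaleC_scaleC scaleC_one)
  moreover obtain c where "?E x = c *\<^sub>C b"
    using span by blast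
  ultimately have "?E x = (c * inverse k) *\<^sub>C v"
    by (simp add: scaleC_scaleC)
  then show ?thesis
    by (simp add: complex_linearD[OF T] v(2) scaleC_scaleC mult_ac)
qed

section \<open>Spectra on continuous and on essentially bounded functions\<close>

instance bcontfun :: (metric_space, banach) banach ..

context expandable_kernel
begin

lemma integral_op_simps:
  "integral_op \<kappa> x = C01_to_linf (integral_map \<kappa> x)"
  "integral_op_C01 \<kappa> y = integral_map \<kappa> (C01_to_linf y)"
  by (simp_all add: integral_op_def integral_op_C01_def)

text \<open>Images under the operator are Lipschitz and the square root is not, so the operator is
  not surjective.\<close>

lemma zero_in_spectrum: "0 \<in> spectrum (integral_op_C01 \<kappa>)"
proof (rule ccontr)
  let ?f = "\<lambda>s. complex_of_real (sqrt (of_unit s))"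
  assume "0 \<notin> spectrum (integral_op_C01 \<kappa>)"
  then have "surj (shifted (integral_op_C01 \<kappa>) 0)"
    by (auto simp: spectrum_def resolvent_set_def bij_is_surj)
  then obtain x where x: "Bcontfun ?f = integral_op_C01 \<kappa> x"
    by (auto simp: shifted_def surj_def)
  have "continuous_on UNIV of_unit"
    unfolding continuous_on_iff by (auto simp: dist_unit_interval_def)
  then have "?f \<in> bcontfun"
    using of_unit_mem by (auto simp: bcontfun_def bounded_iff intro!: continuous_intros exI[of _ 1])
  then have f: "pairing (\<kappa> (of_unit s)) (C01_to_linf x) = ?f s" for s
    using x by (metis Bcontfun_inverse integral_map_apply integral_op_simps(2))
  define D where "D = C * norm (C01_to_linf x)"
  have D: "D \<ge> 0" using C_nonneg by (simp add: D_def)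
  \<comment> \<open>With \<open>D\<close> a Lipschitz constant of the image,
    \<open>sqrt s = 1 / (D + 1)\<close> exceeds \<open>D * s\<close> at this point.\<close>
  define s where "s = (1 / (D + 1))\<^sup>2"
  have s: "0 \<le> s" "s \<le> 1" "sqrt s = 1 / (D + 1)"
    using D by (auto simp: s_def power_le_one_iff real_sqrt_unique divide_le_eq)
  have "cmod (pairing (\<kappa> s) (C01_to_linf x) - pairing (\<kappa> 0) (C01_to_linf x)) \<le> D * s"
    using pairing_kernel_lipschitz[of s 0 "C01_to_linf x"] s by (simp add: D_def mult_ac)
  moreover have "pairing (\<kappa> s) (C01_to_linf x) = of_real (sqrt s)" "pairing (\<kappa> 0) (C01_to_linf x) = 0"
    using f[of "to_unit s"] f[of "to_unit 0"] s by (simp_all add: to_unit_inverse)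
  ultimately have "1 / (D + 1) \<le> D * s"
    using s(1) by (simp only: diff_zero norm_of_real real_sqrt_abs2 abs_of_nonneg real_sqrt_ge_0_iff flip: s(3))
  then show False
    using D by (simp add: s_def power2_eq_square divide_simps split: if_splits)
qed

text \<open>If K x - z x = y, then K x solves the same equation on C[0,1] with right side K y, and x
  = (K x - y) / z. Solving for K x with the resolvent on C[0,1] gives the inverse
  \<open>S\<close>.\<close>

lemma resolvent_set_integral_op:
  assumes z: "z \<in> resolvent_set (integral_op_C01 \<kappa>)" "z \<noteq> 0"
  shows "z \<in> resolvent_set (integral_op \<kappa>)"
proof -
  let ?J = C01_to_linf and ?K = "integral_map \<kappa>" and ?R = "resolvent (integral_op_C01 \<kappa>) z"
  define S where "S y = inverse z *\<^sub>C (?J (?R (?K y)) - y)" for y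
  note lin_J = complex_linearD[OF complex_linear_C01_to_linf]
  note lin_K = complex_linearD[OF complex_linear_integral_map]
  note lin_C = complex_linearD[OF complex_linear_integral_op(2)]
  have "complex_linear (blinfun_apply ?R)"
    using resolvent_scaleC[OF complex_linear_integral_op(2) z(1)]
    by (simp add: complex_linear_def blinfun.bounded_linear_right)
  note R_map = complex_linear_compose[OF this complex_linear_integral_map]
  have "complex_linear (\<lambda>y. y :: linf)"
    by (simp add: complex_linear_def)
  then have "complex_linear S"
    unfolding S_def
    by (rule complex_linear_scaleC[OF complex_linear_diff[OF complex_linear_compose[OF complex_linear_C01_to_linf R_map]]])
  moreover have "S (integral_op \<kappa> y - z *\<^sub>C y) = y" for y
  proof -
    have "?K (integral_op \<kappa> y - z *\<^sub>C y) = integral_op_C01 \<kappa> (?K y) - z *\<^sub>C ?K y"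
      by (simp add: integral_op_simps lin_K)
    then have "?R (?K (integral_op \<kappa> y - z *\<^sub>C y)) = ?K y"
      by (simp only: resolvent_inverse(1)[OF z(1)])
    then have "S (integral_op \<kappa> y - z *\<^sub>C y) = inverse z *\<^sub>C (z *\<^sub>C y)"
      unfolding S_def by (simp only: integral_op_simps(1) diff_diff_eq2 add_diff_cancel_left')
    then show ?thesis using z(2) by (simp add: scaleC_scaleC scaleC_one)
  qed
  moreover have "integral_op \<kappa> (S y) - z *\<^sub>C S y = y" for y
  proof -
    let ?u = "?R (?K y)"
    have "?K (?J ?u) = z *\<^sub>C ?u + ?K y"
      using resolvent_inverse(2)[OF z(1), of "?K y"] by (simp add: integral_op_simps diff_eq_eq add.commute)
    then have "?K (S y) = ?u"
      using z(2) by (simp add: S_def lin_K scaleC_scaleC scaleC_one)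
    then show ?thesis
      using z(2) by (simp add: integral_op_simps) (simp add: S_def scaleC_scaleC scaleC_one)
  qed
  ultimately show ?thesis
    by (intro resolvent_setI[OF complex_linear_integral_op(1)]) (auto simp: complex_linear_def)
qed

end

section \<open>Assembling the three estimates\<close>

lemma eventually_const_mult_power_less:
  fixes X Y :: real
  assumes "Y > 0" "k > 0"
  shows "\<forall>\<^sub>F n in sequentially. X * (1 / real n) ^ k < Y"
proof -
  have "(\<lambda>n. X * (1 / real n) ^ k) \<longlonglongrightarrow> X * 0 ^ k"
    by (intro tendsto_intros lim_1_over_n)
  then have "(\<lambda>n. X * (1 / real n) ^ k) \<longlonglongrightarrow> 0"
    using assms(2) by (simp add: zero_power del: power_one_over)
  then show ?thesis using assms(1) by (rule order_tendstoD(2))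
qed

theorem theorem4p7:
  fixes r :: nat and \<kappa> :: "real \<Rightarrow> real \<Rightarrow> real"
    and lam :: complex and \<Gamma> :: "real \<Rightarrow> complex"
    and Q :: "nat \<Rightarrow> linf \<Rightarrow> linf"
    and lamM :: "nat \<Rightarrow> complex" and \<psi> \<psi>_it :: "nat \<Rightarrow> linf"
  assumes kernel: "smooth_kernel (2 * r + 2) \<kappa>"
    and eigen: "lam \<noteq> 0" "eigenvalue (integral_op_C01 \<kappa>) lam"
    and curve: "isolating_curve (integral_op_C01 \<kappa>) lam \<Gamma>"
    and simple: "rank (spectral_projection \<Gamma> (integral_op_C01 \<kappa>)) = 1"
    and proj: "\<And>n. n \<ge> 1 \<Longrightarrow> interpolatory_projection r n (Q n)"
    and eigenM: "\<forall>\<^sub>F n in sequentially.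
      path_image \<Gamma> \<subseteq> resolvent_set (modified_op \<kappa> (Q n)) \<and>
      rank (spectral_projection \<Gamma> (modified_op \<kappa> (Q n))) = 1 \<and>
      {\<mu> \<in> inside (path_image \<Gamma>). eigenvalue (modified_op \<kappa> (Q n)) \<mu>} = {lamM n}"
    and eigenfunM: "\<forall>\<^sub>F n in sequentially.
      \<psi> n \<in> range (blinfun_apply (spectral_projection \<Gamma> (modified_op \<kappa> (Q n)))) \<and>
      norm (\<psi> n) = 1 \<and> modified_op \<kappa> (Q n) (\<psi> n) = lamM n *\<^sub>C \<psi> n"
    and iterated: "\<forall>\<^sub>F n in sequentially. \<psi>_it n = (1 / lamM n) *\<^sub>C integral_op \<kappa> (\<psi> n)"
  shows "(\<lambda>n. norm (\<psi> n - spectral_projection \<Gamma> (integral_op \<kappa>) (\<psi> n)))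
          \<in> O(\<lambda>n. (1 / real n) ^ (4 * r + 3)) \<and>
        (\<lambda>n. norm (\<psi>_it n - spectral_projection \<Gamma> (integral_op \<kappa>) (\<psi>_it n)))
          \<in> O(\<lambda>n. (1 / real n) ^ (4 * r + 4)) \<and>
        (\<lambda>n. cmod (lam - lamM n)) \<in> O(\<lambda>n. (1 / real n) ^ (4 * r + 4))"
proof -
  have "smooth_kernel (Suc (2 * r + 1)) \<kappa>" using kernel by simp
  then obtain C A where "expandable_kernel (2 * r + 1) \<kappa> C A"
    by (rule kernel_taylor) (rule that, unfold_locales)
  then interpret expandable_kernel "2 * r + 1" \<kappa> C A .
  let ?K = "integral_op \<kappa>" and ?KC = "integral_op_C01 \<kappa>" and ?map = "integral_map \<kappa>"
  let ?E = "spectral_projection \<Gamma> ?K" and ?EC = "spectral_projection \<Gamma> ?KC"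
  let ?in = "inside (path_image \<Gamma>)" and ?out = "outside (path_image \<Gamma>)"
  note lin = complex_linear_integral_op
  have curve': "simple_path \<Gamma>" "pathfinish \<Gamma> = pathstart \<Gamma>" "rectifiable \<Gamma>"
    "path_image \<Gamma> \<subseteq> resolvent_set ?KC" "lam \<in> ?in" "spectrum ?KC - {lam} \<subseteq> ?out" "winding_number \<Gamma> lam = 1"
    using curve by (auto simp: isolating_curve_def)
  have "path \<Gamma>" using curve'(1) by (rule simple_path_imp_path)
  have closed: "closed (path_image \<Gamma>)"
    using \<open>path \<Gamma>\<close> by (rule closed_path_image)
  have notin: "lam \<notin> path_image \<Gamma>"
    using curve'(5) inside_no_overlap by blast
  have out0: "0 \<in> ?out"
    using zero_in_spectrum eigen(1) curve'(6) by auto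
  then have "0 \<notin> path_image \<Gamma>"
    using outside_no_overlap by blast
  then have curveK: "path_image \<Gamma> \<subseteq> resolvent_set ?K"
    using curve'(4) resolvent_set_integral_op by blast
  obtain e M where near: "e > 0" "M > 0"
    "\<And>\<mu> x. dist lam \<mu> < e \<Longrightarrow> norm (x - ?E x) \<le> M * norm (?K x - \<mu> *\<^sub>C x)"
    using spectral_projection_near[OF lin(1) curve'(3) curveK curve'(2) notin curve'(7)] by metis
  obtain eC MC where nearC: "eC > 0" "MC > 0"
    "\<And>\<mu> x. dist lam \<mu> < eC \<Longrightarrow> norm (x - ?EC x) \<le> MC * norm (?KC x - \<mu> *\<^sub>C x)"
    using spectral_projection_near[OF lin(2) curve'(3,4,2) notin curve'(7)] by metis
  \<comment> \<open>The radius \<open>c\<close> is a lower bound, uniform in n, for the moduli of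
    all points inside the curve, in particular of \<open>lamM n\<close>.\<close>
  obtain c where c: "c > 0" "ball 0 c \<subseteq> ?out"
    using open_outside[OF closed] out0 open_contains_ball by blast
  have in_ge: "c \<le> cmod \<mu>" if "\<mu> \<in> ?in" for \<mu>
  proof (rule ccontr)
    assume "\<not> c \<le> cmod \<mu>"
    then have "\<mu> \<in> ball 0 c" by simp
    with that c(2) show False
      using inside_Int_outside[of "path_image \<Gamma>"] by blast
  qed
  \<comment> \<open>The places for \<open>lamM n\<close> that have to be excluded. As
    \<open>lam\<close> is the only spectral point inside the curve, \<open>S\<close> is a compact
    part of the resolvent set, with a uniform bound on the resolvent.\<close>
  define S where "S = (path_image \<Gamma> \<union> ?in) - ball lam (min e eC)"
  have "compact S"
    unfolding S_def using bounded_inside[OF compact_imp_bounded[OF compact_path_image[OF \<open>path \<Gamma>\<close>]]]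
    by (intro compact_diff) (auto simp: compact_eq_bounded_closed closed_path_image_Un_inside[OF \<open>path \<Gamma>\<close>]
        compact_imp_bounded[OF compact_path_image[OF \<open>path \<Gamma>\<close>]])
  moreover have "S \<subseteq> resolvent_set ?KC"
  proof
    fix w assume w: "w \<in> S"
    then have "w \<noteq> lam" using near(1) nearC(1) by (auto simp: S_def)
    moreover have "w \<in> path_image \<Gamma> \<or> w \<in> ?in" using w by (auto simp: S_def)
    ultimately have "w \<in> path_image \<Gamma> \<or> w \<notin> spectrum ?KC"
      using curve'(6) inside_Int_outside[of "path_image \<Gamma>"] by blast
    then show "w \<in> resolvent_set ?KC"
      using curve'(4) by (auto simp: spectrum_def)
  qed
  ultimately obtain R where R: "R > 0" "\<And>w. w \<in> S \<Longrightarrow> norm (resolvent ?KC w) \<le> R"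
    using bounded_resolvent[OF lin(2)] by blast
  \<comment> \<open>The constant of \<open>modified_op_residual\<close> with the modulus of the
    eigenvalue replaced by its lower bound \<open>c\<close>.\<close>
  define B where "B = C * C * lebesgue_const r * (2 * (1 + lebesgue_const r))\<^sup>2 / c"
  have B: "B \<ge> 0"
    using lebesgue_const_nonneg[of r] c(1) by (simp add: B_def)
  define h where "h n = (1 / real n)" for n
  \<comment> \<open>The first threshold keeps the norm of K \<psi> at least \<open>c / 2\<close>,
    the second contradicts this when \<open>lamM n\<close> lies in \<open>S\<close>, and the third
    keeps the norm of its spectral projection at least \<open>c / 4\<close>.\<close>
  have small: "\<forall>\<^sub>F n in sequentially. B * h n ^ (4 * r + 3) < c / 2"
    "\<forall>\<^sub>F n in sequentially. R * C * B * h n ^ (4 * r + 4) < c / 2"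
    "\<forall>\<^sub>F n in sequentially. MC * C * B * h n ^ (4 * r + 4) < c / 4"
    unfolding h_def using c(1) by (intro eventually_const_mult_power_less; simp)+
  have bounds: "\<forall>\<^sub>F n in sequentially.
      norm (\<psi> n - ?E (\<psi> n)) \<le> M * B * h n ^ (4 * r + 3) \<and>
      norm (\<psi>_it n - ?E (\<psi>_it n)) \<le> M * C * B / c * h n ^ (4 * r + 4) \<and>
      cmod (lam - lamM n) \<le> 4 / c * norm ?EC * C * B * h n ^ (4 * r + 4)"
    using eigenM eigenfunM iterated eventually_ge_at_top[of 1] small
  proof eventually_elim
    case (elim n)
    let ?\<mu> = "lamM n"
    have \<mu>_in: "?\<mu> \<in> ?in" using elim(1) by blast
    have \<mu>: "c \<le> cmod ?\<mu>" "?\<mu> \<noteq> 0"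
      using in_ge[OF \<mu>_in] c(1) by auto
    define \<delta> where "\<delta> = ?K (\<psi> n) - ?\<mu> *\<^sub>C \<psi> n"
    define Bn where "Bn = C * C * lebesgue_const r * (2 * (1 + lebesgue_const r))\<^sup>2 / cmod ?\<mu>"
    have Bn: "Bn \<le> B"
      unfolding Bn_def B_def using \<mu>(1) c(1) lebesgue_const_nonneg[of r]
      by (intro divide_left_mono) (auto intro!: mult_pos_pos)
    have hn: "0 \<le> h n" by (simp add: h_def)
    have res: "norm \<delta> \<le> Bn * h n ^ (4 * r + 3)" "norm (?map \<delta>) \<le> C * Bn * h n ^ (4 * r + 4)"
      unfolding \<delta>_def Bn_def h_def
      using elim \<mu>(2) by (intro modified_op_residual[OF proj]; simp)+
    have \<delta>: "norm \<delta> \<le> B * h n ^ (4 * r + 3)"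
      by (rule order_trans[OF res(1)]) (intro mult_right_mono Bn zero_le_power hn)
    have map_\<delta>: "norm (?map \<delta>) \<le> C * B * h n ^ (4 * r + 4)"
      by (rule order_trans[OF res(2)]) (intro mult_right_mono mult_left_mono Bn zero_le_power hn C_nonneg)
    \<comment> \<open>K \<psi> as a continuous function. Its residual is the image of
      \<open>\<delta>\<close> under K, which is one order smaller than
      \<open>\<delta>\<close>.\<close>
    define x where "x = ?map (\<psi> n)"
    have K\<psi>: "C01_to_linf x = ?\<mu> *\<^sub>C \<psi> n + \<delta>"
      by (simp add: \<delta>_def x_def integral_op_simps)
    have x_res: "?KC x - ?\<mu> *\<^sub>C x = ?map \<delta>"
      by (simp add: \<delta>_def x_def integral_op_simps complex_linearD[OF complex_linear_integral_map])
    have "c \<le> norm (?\<mu> *\<^sub>C \<psi> n)"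
      using \<mu>(1) elim by (simp add: norm_scaleC)
    also have "\<dots> \<le> norm x + norm \<delta>"
      using norm_C01_to_linf_le[of x] norm_triangle_ineq2[of "?\<mu> *\<^sub>C \<psi> n" "- \<delta>"] by (simp add: K\<psi>)
    finally have x_ge: "c / 2 \<le> norm x"
      using \<delta> elim by linarith
    \<comment> \<open>Otherwise \<open>x\<close> would be the bounded resolvent applied to its own
      small residual, against its lower bound.\<close>
    have \<mu>_near: "dist lam ?\<mu> < min e eC"
    proof (rule ccontr)
      assume "\<not> dist lam ?\<mu> < min e eC"
      then have "?\<mu> \<in> S" using \<mu>_in by (simp add: S_def)
      then have \<mu>S: "?\<mu> \<in> resolvent_set ?KC" "norm (resolvent ?KC ?\<mu>) \<le> R"
        using R(2) \<open>S \<subseteq> resolvent_set ?KC\<close> by auto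
      have "norm x = norm (resolvent ?KC ?\<mu> (?map \<delta>))"
        using resolvent_inverse(1)[OF \<mu>S(1), of x] by (simp add: x_res)
      also have "\<dots> \<le> R * (C * B * h n ^ (4 * r + 4))"
        by (intro order_trans[OF norm_blinfun] mult_mono \<mu>S(2) map_\<delta>) (use R in auto)
      finally show False using x_ge elim by (simp add: mult.assoc)
    qed
    \<comment> \<open>Iteration replaces the residual \<open>\<delta>\<close> by a multiple of its
      image under K, which is the source of the additional order.\<close>
    have it: "?K (\<psi>_it n) - ?\<mu> *\<^sub>C \<psi>_it n = (1 / ?\<mu>) *\<^sub>C C01_to_linf (?map \<delta>)"
    proof -
      have "?K (\<psi>_it n) - ?\<mu> *\<^sub>C \<psi>_it n = (1 / ?\<mu>) *\<^sub>C (?K (?K (\<psi> n)) - ?\<mu> *\<^sub>C ?K (\<psi> n))"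
        using elim by (simp add: complex_linearD[OF lin(1)] complex_vector.scale_right_diff_distrib scaleC_scaleC mult.commute)
      also have "?K (?K (\<psi> n)) - ?\<mu> *\<^sub>C ?K (\<psi> n) = ?K \<delta>"
        by (simp add: \<delta>_def complex_linearD[OF lin(1)])
      finally show ?thesis by (simp add: integral_op_simps)
    qed
    have "norm (\<psi> n - ?E (\<psi> n)) \<le> M * norm \<delta>"
      unfolding \<delta>_def using \<mu>_near by (intro near(3)) simp
    also have "\<dots> \<le> M * (B * h n ^ (4 * r + 3))"
      using near(2) by (intro mult_left_mono \<delta>) simp
    finally have 1: "norm (\<psi> n - ?E (\<psi> n)) \<le> M * B * h n ^ (4 * r + 3)"
      by (simp add: mult.assoc)
    have "norm (\<psi>_it n - ?E (\<psi>_it n)) \<le> M * norm (?K (\<psi>_it n) - ?\<mu> *\<^sub>C \<psi>_it n)"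
      using \<mu>_near by (intro near(3)) simp
    also have "\<dots> = M * (1 / cmod ?\<mu> * norm (C01_to_linf (?map \<delta>)))"
      by (simp only: it norm_scaleC norm_divide norm_one)
    also have "\<dots> \<le> M * (1 / c * (C * B * h n ^ (4 * r + 4)))"
      using near(2) c(1) \<mu>
      by (intro mult_left_mono mult_mono order_trans[OF norm_C01_to_linf_le map_\<delta>] divide_left_mono)
        (auto simp: \<mu>(2) intro!: mult_pos_pos)
    finally have 2: "norm (\<psi>_it n - ?E (\<psi>_it n)) \<le> M * C * B / c * h n ^ (4 * r + 4)"
      by (simp add: mult.assoc)
    have EC: "?KC (?EC x) = lam *\<^sub>C ?EC x"
      by (rule spectral_projection_simple[OF lin(2) curve'(3,4,2) notin curve'(7) eigen(2) simple])
    have "?EC (?map \<delta>) = ?KC (?EC x) - ?\<mu> *\<^sub>C ?EC x"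
      unfolding x_res[symmetric]
      by (simp add: blinfun.diff_right spectral_projection_commute[OF lin(2) curve'(3,4)])
    also have "\<dots> = (lam - ?\<mu>) *\<^sub>C ?EC x"
      by (simp add: EC complex_vector.scale_left_diff_distrib)
    finally have "cmod (lam - ?\<mu>) * norm (?EC x) = norm (?EC (?map \<delta>))"
      by (simp add: norm_scaleC)
    also have "\<dots> \<le> norm ?EC * (C * B * h n ^ (4 * r + 4))"
      by (intro order_trans[OF norm_blinfun] mult_left_mono map_\<delta>) simp
    finally have upper: "cmod (lam - ?\<mu>) * norm (?EC x) \<le> norm ?EC * (C * B * h n ^ (4 * r + 4))" .
    have "norm (x - ?EC x) \<le> MC * norm (?KC x - ?\<mu> *\<^sub>C x)"
      using \<mu>_near by (intro nearC(3)) simp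
    also have "\<dots> \<le> MC * (C * B * h n ^ (4 * r + 4))"
      unfolding x_res using nearC(2) by (intro mult_left_mono map_\<delta>) simp
    also have "\<dots> < c / 4" using elim by (simp add: mult.assoc)
    \<comment> \<open>This lower bound permits cancelling the projected function in
      \<open>upper\<close>, leaving the eigenvalue difference alone.\<close>
    finally have "c / 4 \<le> norm (?EC x)"
      using x_ge norm_triangle_ineq2[of x "?EC x"] by linarith
    then have "cmod (lam - ?\<mu>) * (c / 4) \<le> norm ?EC * (C * B * h n ^ (4 * r + 4))"
      by (intro order_trans[OF mult_left_mono upper]) auto
    then have 3: "cmod (lam - ?\<mu>) \<le> 4 / c * norm ?EC * C * B * h n ^ (4 * r + 4)"
      using c(1) by (simp add: field_simps)
    from 1 2 3 show ?case by blast
  qed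
  have bigo: "f \<in> O(\<lambda>n. (1 / real n) ^ k)"
    if "\<forall>\<^sub>F n in sequentially. f n \<le> D * h n ^ k" "\<And>n. f n \<ge> 0" for f :: "nat \<Rightarrow> real" and D k
    using that by (intro bigoI[of _ D]) (auto simp: h_def)
  show ?thesis
    using bounds unfolding eventually_conj_iff
    by (elim conjE) (intro conjI bigo; (assumption | rule norm_ge_zero))
qed

end
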